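(* Let $\Sigma_\circ$ be a totally mutable seed in $\mathcal F$. If some seed mutation equivalent to $\Sigma_\circ$ is both coprime and acyclic, then the cluster algebra $\mathcal A(\Sigma_\circ)$ coincides with the corresponding upper cluster algebra $\overline{\mathcal A}(\Sigma_\circ)$.
   Context: Let $\mathbb P$ be a torsion-free abelian group, written multiplicatively, $\mathbb{ZP}$ its integer group ring, $n\ge 1$, and $\mathcal F$ a field isomorphic to the field of rational functions in $n$ independent variables over the fraction field of $\mathbb{ZP}$. A seed in $\mathcal F$ is a triple $\Sigma=(\mathbf x,\mathbf p,B)$ where: $\mathbf x=\{x_1,\dots,x_n\}$ (the cluster; its elements are the cluster variables) is a transcendence basis of $\mathcal F$ over the fraction field of $\mathbb{ZP}$ (so that $\mathcal F$ is the field of rational functions in $\mathbf x$); $\mathbf p=(p_1^\pm,\dots,p_n^\pm)$ is a $2n$-tuple of elements of $\mathbb P$; $B=(b_{ij})$ is an $n\times n$ integer matrix (the exchange matrix) which is sign-skew-symmetric, i.e. for all $i,j$ either $b_{ij}=b_{ji}=0$ or $b_{ij}b_{ji}<0$. Seeds differing by a simultaneous relabeling are identified. For $j\in\{1,\dots,n\}$ put $P_j=p_j^+\prod_{b_{ij}>0}x_i^{b_{ij}}+p_j^-\prod_{b_{ij}<0}x_i^{-b_{ij}}$, define $x_j'\in\mathcal F$ by $x_jx_j'=P_j$, and let $\mathbf x_j=(\mathbf x-\{x_j\})\cup\{x_j'\}$. A seed is coprime if $P_1,\dots,P_n$ are pairwise coprime in $\mathbb{ZP}[x_1,\dots,x_n]$,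 i.e. for $i\neq j$ any common divisor of $P_i$ and $P_j$ belongs to $\mathbb P$ up to sign. It is acyclic if the directed graph with vertices $1,\dots,n$ and edges $(i,j)$ for $b_{ij}>0$ has no oriented cycles. Matrix mutation in direction $k$: $\mu_k(B)=(b'_{ij})$ with $b'_{ij}=-b_{ij}$ if $i=k$ or $j=k$, and $b'_{ij}=b_{ij}+\frac{|b_{ik}|b_{kj}+b_{ik}|b_{kj}|}{2}$ otherwise. A seed $\Sigma'=(\mathbf x',\mathbf p',B')$ is obtained from $\Sigma$ by a seed mutation in direction $k$ if $\mathbf x'=\mathbf x_k$, $B'=\mu_k(B)$, $p_k'^{\pm}=p_k^{\mp}$, and for $i\ne k$: $p_i'^+/p_i'^-=(p_k^+)^{b_{ki}}p_i^+/p_i^-$ if $b_{ki}\ge0$ and $p_i'^+/p_i'^-=(p_k^-)^{b_{ki}}p_i^+/p_i^-$ if $b_{ki}\le 0$. Mutation equivalence $\sim$ of seeds (or matrices) is the equivalence relation generated by mutations. A seed is totally mutable if every matrix mutation equivalent to its exchange matrix is sign-skew-symmetric. For a totally mutable seed $\Sigma_\circ$: the cluster algebra $\mathcal A(\Sigma_\circ)$ is the $\mathbb{ZP}$-subalgebra of $\mathcal F$ generated by all cluster variables from all seeds $\Sigma\sim\Sigma_\circ$; the upper cluster algebra $\overline{\mathcal A}(\Sigma_\circ)$ consists of all elements of $\mathcal F$ that are Laurent polynomials over $\mathbb{ZP}$ in the cluster variables of each seed $\Sigma\sim\Sigma_\circ$. *)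

theory Defs
  imports Complex_Main "HOL-Library.Poly_Mapping"
begin

text \<open>
  The coefficient group is a type \<open>'p\<close> of class \<open>ab_group_add\<close>. It is thus written additively,
  so that its integer group ring is the convolution ring \<open>'p \<Rightarrow>\<^sub>0 int\<close> of
  \<^theory>\<open>HOL-Library.Poly_Mapping\<close>, in which the group element \<open>a\<close> is
  \<open>Poly_Mapping.single a 1\<close>. A power \<open>a\<^sup>k\<close> of the multiplicative notation becomes \<open>zmul k a\<close>
  and a quotient \<open>a / b\<close> becomes \<open>a - b\<close>.
\<close>

definition zmul :: "int \<Rightarrow> 'p::ab_group_add \<Rightarrow> 'p" where
  "zmul k a = (\<Sum>_<nat k. a) - (\<Sum>_<nat (- k). a)"

definition torsion_free :: "'p::ab_group_add itself \<Rightarrow> bool" where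
  "torsion_free _ \<longleftrightarrow> (\<forall>(a::'p) k. zmul k a = 0 \<longrightarrow> k = 0 \<or> a = 0)"

text \<open>
  The ambient field is a type \<open>'f::field\<close> together with an embedding \<open>\<iota>\<close> of the group ring; the
  index set \<open>{1, \<dots>, n}\<close> is a finite (hence nonempty) type \<open>'n\<close>.
\<close>

definition ring_embedding :: "('a::comm_ring_1 \<Rightarrow> 'f::field) \<Rightarrow> bool" where
  "ring_embedding \<iota> \<longleftrightarrow>
     \<iota> 1 = 1 \<and> (\<forall>a b. \<iota> (a + b) = \<iota> a + \<iota> b) \<and> (\<forall>a b. \<iota> (a * b) = \<iota> a * \<iota> b) \<and> inj \<iota>"

definition frac_subfield :: "('a::comm_ring_1 \<Rightarrow> 'f::field) \<Rightarrow> 'f set" where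
  "frac_subfield \<iota> = {\<iota> a / \<iota> b | a b. b \<noteq> 0}"

definition polys_over :: "'f::field set \<Rightarrow> (('n \<Rightarrow>\<^sub>0 'e::zero) \<Rightarrow>\<^sub>0 'f) set" where
  "polys_over R = {q. \<forall>m. Poly_Mapping.lookup q m \<in> R}"

definition poly_eval :: "('n::finite \<Rightarrow> 'f::field) \<Rightarrow> (('n \<Rightarrow>\<^sub>0 nat) \<Rightarrow>\<^sub>0 'f) \<Rightarrow> 'f" where
  "poly_eval x q = (\<Sum>m\<in>Poly_Mapping.keys q.
     Poly_Mapping.lookup q m * (\<Prod>i\<in>UNIV. x i ^ Poly_Mapping.lookup m i))"

definition laurent_eval :: "('n::finite \<Rightarrow> 'f::field) \<Rightarrow> (('n \<Rightarrow>\<^sub>0 int) \<Rightarrow>\<^sub>0 'f) \<Rightarrow> 'f" where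
  "laurent_eval x q = (\<Sum>m\<in>Poly_Mapping.keys q.
     Poly_Mapping.lookup q m * (\<Prod>i\<in>UNIV. x i powi Poly_Mapping.lookup m i))"

definition poly_ring :: "'f::field set \<Rightarrow> ('n::finite \<Rightarrow> 'f) \<Rightarrow> 'f set" where
  "poly_ring R x = poly_eval x ` polys_over R"

definition laurent_ring :: "'f::field set \<Rightarrow> ('n::finite \<Rightarrow> 'f) \<Rightarrow> 'f set" where
  "laurent_ring R x = laurent_eval x ` polys_over R"

definition alg_independent :: "'f::field set \<Rightarrow> ('n::finite \<Rightarrow> 'f) \<Rightarrow> bool" where
  "alg_independent K x \<longleftrightarrow> (\<forall>q \<in> polys_over K. poly_eval x q = 0 \<longrightarrow> q = 0)"

text \<open>
  \<open>x\<close> is a transcendence basis of \<open>'f\<close> over \<open>K\<close> for which moreover \<open>'f = K(x)\<close>, so that \<open>'f\<close> is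
  the field of rational functions in \<open>x\<close> over \<open>K\<close>.
\<close>

definition free_generators :: "'f::field set \<Rightarrow> ('n::finite \<Rightarrow> 'f) \<Rightarrow> bool" where
  "free_generators K x \<longleftrightarrow> alg_independent K x \<and>
     (\<forall>f. \<exists>a \<in> poly_ring K x. \<exists>b \<in> poly_ring K x. b \<noteq> 0 \<and> f = a / b)"

definition sign_skew_symmetric :: "('n \<Rightarrow> 'n \<Rightarrow> int) \<Rightarrow> bool" where
  "sign_skew_symmetric B \<longleftrightarrow> (\<forall>i j. (B i j = 0 \<and> B j i = 0) \<or> B i j * B j i < 0)"

text \<open>The division by 2 is exact: the numerator is \<open>0\<close> or \<open>\<plusminus> 2 * B i k * B k j\<close>.\<close>

definition matrix_mutation :: "'n \<Rightarrow> ('n \<Rightarrow> 'n \<Rightarrow> int) \<Rightarrow> 'n \<Rightarrow> 'n \<Rightarrow> int" where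
  "matrix_mutation k B = (\<lambda>i j. if i = k \<or> j = k then - B i j
     else B i j + (\<bar>B i k\<bar> * B k j + B i k * \<bar>B k j\<bar>) div 2)"

definition matrix_mutation_equiv :: "('n \<Rightarrow> 'n \<Rightarrow> int) \<Rightarrow> ('n \<Rightarrow> 'n \<Rightarrow> int) \<Rightarrow> bool" where
  "matrix_mutation_equiv = equivclp (\<lambda>B B'. \<exists>k. B' = matrix_mutation k B)"

record ('n, 'p, 'f) seed =
  cluster :: "'n \<Rightarrow> 'f"
  pplus :: "'n \<Rightarrow> 'p"
  pminus :: "'n \<Rightarrow> 'p"
  exch :: "'n \<Rightarrow> 'n \<Rightarrow> int"

definition is_seed ::
  "(('p::ab_group_add \<Rightarrow>\<^sub>0 int) \<Rightarrow> 'f::field) \<Rightarrow> ('n::finite, 'p, 'f) seed \<Rightarrow> bool" where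
  "is_seed \<iota> S \<longleftrightarrow> free_generators (frac_subfield \<iota>) (cluster S) \<and> sign_skew_symmetric (exch S)"

definition exchange_poly ::
  "(('p::ab_group_add \<Rightarrow>\<^sub>0 int) \<Rightarrow> 'f::field) \<Rightarrow> ('n::finite, 'p, 'f) seed \<Rightarrow> 'n \<Rightarrow> 'f" where
  "exchange_poly \<iota> S j =
     \<iota> (Poly_Mapping.single (pplus S j) 1) *
       (\<Prod>i | exch S i j > 0. cluster S i ^ nat (exch S i j)) +
     \<iota> (Poly_Mapping.single (pminus S j) 1) *
       (\<Prod>i | exch S i j < 0. cluster S i ^ nat (- exch S i j))"

text \<open>
  Exchange polynomials are elements of the subring \<open>poly_ring (range \<iota>) (cluster S)\<close> of \<open>'f\<close>, which
  is a polynomial ring since the cluster is algebraically independent; the divisibility below is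
  divisibility in this subring.
\<close>

definition coprime_seed ::
  "(('p::ab_group_add \<Rightarrow>\<^sub>0 int) \<Rightarrow> 'f::field) \<Rightarrow> ('n::finite, 'p, 'f) seed \<Rightarrow> bool" where
  "coprime_seed \<iota> S \<longleftrightarrow>
     (let A = poly_ring (range \<iota>) (cluster S) in
       \<forall>i j. i \<noteq> j \<longrightarrow>
         (\<forall>d \<in> A. (\<exists>u \<in> A. exchange_poly \<iota> S i = d * u) \<and> (\<exists>v \<in> A. exchange_poly \<iota> S j = d * v) \<longrightarrow>
           (\<exists>a. d = \<iota> (Poly_Mapping.single a 1) \<or> d = - \<iota> (Poly_Mapping.single a 1))))"

definition acyclic_seed :: "('n, 'p, 'f) seed \<Rightarrow> bool" where
  "acyclic_seed S \<longleftrightarrow> acyclic {(i, j). exch S i j > 0}"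

text \<open>
  Mutation is a relation rather than a function: for \<open>i \<noteq> k\<close> only the ratios of the new coefficients
  are prescribed.
\<close>

definition seed_mutation ::
  "(('p::ab_group_add \<Rightarrow>\<^sub>0 int) \<Rightarrow> 'f::field) \<Rightarrow> 'n::finite \<Rightarrow>
     ('n, 'p, 'f) seed \<Rightarrow> ('n, 'p, 'f) seed \<Rightarrow> bool" where
  "seed_mutation \<iota> k S S' \<longleftrightarrow>
     is_seed \<iota> S \<and> is_seed \<iota> S' \<and>
     cluster S' = (cluster S)(k := exchange_poly \<iota> S k / cluster S k) \<and>
     exch S' = matrix_mutation k (exch S) \<and>
     pplus S' k = pminus S k \<and> pminus S' k = pplus S k \<and>
     (\<forall>i. i \<noteq> k \<longrightarrow>
       (exch S k i \<ge> 0 \<longrightarrow>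
          pplus S' i - pminus S' i = zmul (exch S k i) (pplus S k) + (pplus S i - pminus S i)) \<and>
       (exch S k i \<le> 0 \<longrightarrow>
          pplus S' i - pminus S' i = zmul (exch S k i) (pminus S k) + (pplus S i - pminus S i)))"

definition seed_relabeling :: "('n, 'p, 'f) seed \<Rightarrow> ('n, 'p, 'f) seed \<Rightarrow> bool" where
  "seed_relabeling S S' \<longleftrightarrow> (\<exists>\<sigma>. bij \<sigma> \<and>
     cluster S' = cluster S \<circ> \<sigma> \<and> pplus S' = pplus S \<circ> \<sigma> \<and> pminus S' = pminus S \<circ> \<sigma> \<and>
     exch S' = (\<lambda>i j. exch S (\<sigma> i) (\<sigma> j)))"

text \<open>Relabelings are included because seeds that differ by a relabeling are identified.\<close>

definition mutation_equiv ::
  "(('p::ab_group_add \<Rightarrow>\<^sub>0 int) \<Rightarrow> 'f::field) \<Rightarrow>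
     ('n::finite, 'p, 'f) seed \<Rightarrow> ('n, 'p, 'f) seed \<Rightarrow> bool" where
  "mutation_equiv \<iota> = equivclp (\<lambda>S S'. (\<exists>k. seed_mutation \<iota> k S S') \<or> seed_relabeling S S')"

definition totally_mutable :: "('n, 'p, 'f) seed \<Rightarrow> bool" where
  "totally_mutable S \<longleftrightarrow> (\<forall>B. matrix_mutation_equiv (exch S) B \<longrightarrow> sign_skew_symmetric B)"

text \<open>Subalgebras over the group ring, viewed as a subring of \<open>'f\<close> via \<open>\<iota>\<close>.\<close>

definition subalgebra :: "('a::comm_ring_1 \<Rightarrow> 'f::field) \<Rightarrow> 'f set \<Rightarrow> bool" where
  "subalgebra \<iota> A \<longleftrightarrow> range \<iota> \<subseteq> A \<and> (\<forall>a \<in> A. \<forall>b \<in> A. a + b \<in> A \<and> a * b \<in> A)"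

definition cluster_algebra ::
  "(('p::ab_group_add \<Rightarrow>\<^sub>0 int) \<Rightarrow> 'f::field) \<Rightarrow> ('n::finite, 'p, 'f) seed \<Rightarrow> 'f set" where
  "cluster_algebra \<iota> S\<^sub>0 = subalgebra \<iota> hull (\<Union>S \<in> {S. mutation_equiv \<iota> S\<^sub>0 S}. range (cluster S))"

definition upper_cluster_algebra ::
  "(('p::ab_group_add \<Rightarrow>\<^sub>0 int) \<Rightarrow> 'f::field) \<Rightarrow> ('n::finite, 'p, 'f) seed \<Rightarrow> 'f set" where
  "upper_cluster_algebra \<iota> S\<^sub>0 =
     {f. \<forall>S. mutation_equiv \<iota> S\<^sub>0 S \<longrightarrow> f \<in> laurent_ring (range \<iota>) (cluster S)}"

end

theory Submission
  imports Defs "HOL-Library.Function_Algebras" "HOL-Library.Product_Plus"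
    "HOL-Computational_Algebra.Fraction_Field"
begin

text \<open>
  For the coprime acyclic seed \<open>S\<close>, the upper cluster algebra lies in the upper bound (elements that
  are Laurent in \<open>S\<close> and in all seeds adjacent to \<open>S\<close>), and the lower bound (generated by the
  cluster variables of these seeds) lies in the cluster algebra. The two bounds agree by induction on
  the number of non-frozen indices: if \<open>j\<close> is a sink and \<open>i \<rightarrow> j\<close>, then the exchange relation at \<open>j\<close>
  shows that \<open>x\<^sub>i\<close> and \<open>x\<^sub>j\<close> generate the unit ideal of the lower bound, which reduces the claim to its
  localisations at \<open>x\<^sub>i\<close> and \<open>x\<^sub>j\<close>, where one more index is frozen. Without edges, one compares
  homogeneous components and has to know that the exchange binomials are pairwise regular. Unique
  factorisation is not needed for this: in the group ring of a torsion-free group, \<open>1 + w\<close> and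
  \<open>1 + h\<close> can only fail to be regular if \<open>w\<close> and \<open>h\<close> are odd multiples of a common element.

  That every cluster variable is Laurent in every cluster is first shown for generic seeds with
  principal coefficients. There the exchange ratios of each seed are linearly independent, so the
  equality of bounds, applied to two non-frozen indices, shows that the upper bound is invariant under
  mutation. A ring homomorphism then transfers the result to arbitrary coefficients.
\<close>

section \<open>Integer multiples\<close>

text \<open>The Laurent phenomenon is what puts the cluster algebra inside the upper cluster
  algebra. Invariance of the upper bound would give it at once, but asks for regular pairs of
  exchange binomials in every seed on the way, and coprimality of one seed does not hand this to its
  neighbours. Linear independence of the exchange ratios does survive mutation, and principal
  coefficients supply it at the root; hence the detour through generic seeds. Odd multiples enter
  because \<open>s + t\<close> divides \<open>s ^ n + t ^ n\<close> for odd \<open>n\<close>: ratios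
  with a common odd root share a factor. That nothing else obstructs regularity rests on alternating
  coefficient sums along cosets of the subgroup generated by \<open>w\<close>, and on the finiteness
  of supports. Field identities are moved to the group ring of
  \<open>'p \<times> ('n \<Rightarrow> int)\<close>, where degrees and supports make sense; this
  ring in turn inherits cancellation from its embedding in the field. Since mutation fixes the new
  coefficients only up to a common factor, a generic seed can match a given one only up to rescaling
  of the cluster variables.\<close>

lemma zmul_0 [simp]: "zmul 0 a = 0"
  by (simp add: zmul_def)

lemma zmul_succ: "zmul (k + 1) a = zmul k a + a"
proof (cases "k \<ge> 0")
  case True
  then have "nat (k + 1) = Suc (nat k)" "nat (- k) = 0" "nat (- (k + 1)) = 0" by auto
  then show ?thesis by (simp add: zmul_def)
next
  case False
  then have *: "nat (- k) = Suc (nat (- (k + 1)))" "nat k = 0" "nat (k + 1) = 0" by auto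
  show ?thesis unfolding zmul_def * by simp
qed

lemma zmul_pred: "zmul (k - 1) a = zmul k a - a"
  using zmul_succ[of "k - 1" a] by simp

lemma zmul_add: "zmul (k + l) a = zmul k a + zmul l a"
proof (induction l rule: int_induct[where k = 0])
  case (step1 i)
  then show ?case using zmul_succ[of "k + i" a] zmul_succ[of i a] by (simp add: add.assoc)
next
  case (step2 i)
  have "zmul (k + (i - 1)) a = zmul (k + i) a - a"
    using zmul_pred[of "k + i" a] by (simp add: algebra_simps)
  then show ?case unfolding zmul_pred[of i a] using step2 by (simp add: algebra_simps)
qed simp

lemma zmul_1 [simp]: "zmul 1 a = a"
  using zmul_succ[of 0 a] by simp

lemma zmul_minus: "zmul (- k) a = - zmul k a"
  using zmul_add[of k "- k" a] by (simp add: eq_neg_iff_add_eq_0 add.commute)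

lemma zmul_diff: "zmul (k - l) a = zmul k a - zmul l a"
  using zmul_add[of k "- l" a] by (simp add: zmul_minus)

lemma zmul_zero_right [simp]: "zmul k 0 = 0"
  by (simp add: zmul_def)

lemma zmul_add_right: "zmul k (a + b) = zmul k a + zmul k b"
  by (simp add: zmul_def sum.distrib)

lemma zmul_minus_right: "zmul k (- a) = - zmul k a"
  by (simp add: zmul_def sum_negf)

lemma zmul_diff_right: "zmul k (a - b) = zmul k a - zmul k b"
  using zmul_add_right[of k a "- b"] by (simp add: zmul_minus_right)

lemma zmul_sum_right: "zmul k (sum f A) = (\<Sum>i\<in>A. zmul k (f i))"
  by (induction A rule: infinite_finite_induct) (auto simp: zmul_add_right)

lemma zmul_sum_left: "zmul (sum f A) a = (\<Sum>i\<in>A. zmul (f i) a)"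
  by (induction A rule: infinite_finite_induct) (auto simp: zmul_add)

lemma zmul_mult: "zmul (k * l) a = zmul k (zmul l a)"
proof (induction k rule: int_induct[where k = 0])
  case (step1 i)
  then show ?case by (simp add: zmul_add distrib_right)
next
  case (step2 i)
  then show ?case by (simp add: zmul_diff left_diff_distrib)
qed simp

lemma zmul_apply: "zmul k (m :: 'n \<Rightarrow> int) i = k * m i"
  by (induction k rule: int_induct[where k = 0])
    (auto simp: zmul_add zmul_diff distrib_right left_diff_distrib)

lemma zmul_Pair: "zmul k (a, b) = (zmul k a, zmul k b)"
  by (induction k rule: int_induct[where k = 0]) (auto simp: zmul_add zmul_diff zero_prod_def)

lemma fst_zmul: "fst (zmul k a) = zmul k (fst a)"
  by (cases a) (simp add: zmul_Pair)

lemma snd_zmul: "snd (zmul k a) = zmul k (snd a)"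
  by (cases a) (simp add: zmul_Pair)

lemma torsion_free_fun: "torsion_free TYPE('n \<Rightarrow> int)"
  unfolding torsion_free_def
proof (intro allI impI)
  fix a :: "'n \<Rightarrow> int" and k assume "zmul k a = 0"
  then have "k * a i = 0" for i using zmul_apply[of k a i] by simp
  then show "k = 0 \<or> a = 0" by (auto simp: fun_eq_iff)
qed

lemma torsion_free_prod:
  assumes "torsion_free TYPE('a::ab_group_add)" "torsion_free TYPE('b::ab_group_add)"
  shows "torsion_free TYPE('a \<times> 'b)"
  using assms unfolding torsion_free_def by (auto simp: zmul_Pair zero_prod_def)

section \<open>Group rings\<close>

abbreviation group_elem :: "'g \<Rightarrow> 'g \<Rightarrow>\<^sub>0 int" where
  "group_elem g \<equiv> Poly_Mapping.single g 1"

text \<open>Integer-linear extension of an arbitrary weight. Characters make it a ring homomorphism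
  (\<open>lin_mult\<close>), whereas the alternating sums along cosets use it with a weight that is
  not multiplicative.\<close>

definition lin :: "('g \<Rightarrow> 'r::comm_ring_1) \<Rightarrow> ('g \<Rightarrow>\<^sub>0 int) \<Rightarrow> 'r" where
  "lin \<phi> c = (\<Sum>g\<in>Poly_Mapping.keys c. of_int (Poly_Mapping.lookup c g) * \<phi> g)"

lemma lin_superset:
  assumes "finite A" "Poly_Mapping.keys c \<subseteq> A"
  shows "lin \<phi> c = (\<Sum>g\<in>A. of_int (Poly_Mapping.lookup c g) * \<phi> g)"
  unfolding lin_def by (rule sum.mono_neutral_left) (use assms in \<open>auto simp: in_keys_iff\<close>)

lemma lin_zero [simp]: "lin \<phi> 0 = 0"
  by (simp add: lin_def)

lemma lin_single [simp]: "lin \<phi> (Poly_Mapping.single g a) = of_int a * \<phi> g"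
  by (simp add: lin_def)

lemma lin_one: "lin \<phi> 1 = \<phi> 0"
  unfolding single_one[symmetric] lin_single by simp

lemma lin_add: "lin \<phi> (c + d) = lin \<phi> c + lin \<phi> d"
proof -
  let ?A = "Poly_Mapping.keys c \<union> Poly_Mapping.keys d"
  have "lin \<phi> (c + d) = (\<Sum>g\<in>?A. of_int (Poly_Mapping.lookup (c + d) g) * \<phi> g)"
    by (rule lin_superset) (auto simp: Poly_Mapping.keys_add)
  also have "\<dots> = (\<Sum>g\<in>?A. of_int (Poly_Mapping.lookup c g) * \<phi> g) +
      (\<Sum>g\<in>?A. of_int (Poly_Mapping.lookup d g) * \<phi> g)"
    by (simp add: lookup_add algebra_simps sum.distrib)
  finally show ?thesis by (simp add: lin_superset[of ?A])
qed

lemma lin_uminus: "lin \<phi> (- c) = - lin \<phi> c"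
  using lin_add[of \<phi> c "- c"] by (simp add: eq_neg_iff_add_eq_0 add.commute)

lemma lin_diff: "lin \<phi> (c - d) = lin \<phi> c - lin \<phi> d"
  using lin_add[of \<phi> c "- d"] by (simp add: lin_uminus)

lemma lin_sum: "lin \<phi> (sum f A) = (\<Sum>i\<in>A. lin \<phi> (f i))"
  by (induction A rule: infinite_finite_induct) (auto simp: lin_add)

lemma lin_mult_fun: "lin (\<lambda>g. a * \<phi> g) c = a * lin \<phi> c"
  by (simp add: lin_def sum_distrib_left mult.left_commute)

lemma group_ring_expand:
  fixes c :: "'g \<Rightarrow>\<^sub>0 'a::comm_monoid_add"
  shows "c = (\<Sum>g\<in>Poly_Mapping.keys c. Poly_Mapping.single g (Poly_Mapping.lookup c g))"
proof (rule poly_mapping_eqI)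
  fix k
  have "Poly_Mapping.lookup c k = (if k \<in> Poly_Mapping.keys c then Poly_Mapping.lookup c k else 0)"
    by (simp add: in_keys_iff)
  also have "\<dots> = (\<Sum>g\<in>Poly_Mapping.keys c. if k = g then Poly_Mapping.lookup c g else 0)"
    by (simp add: sum.delta')
  finally show "Poly_Mapping.lookup c k = Poly_Mapping.lookup
    (\<Sum>g\<in>Poly_Mapping.keys c. Poly_Mapping.single g (Poly_Mapping.lookup c g)) k"
    by (simp add: lookup_sum lookup_single when_def eq_commute)
qed

lemma group_ring_induct [case_names zero single add]:
  fixes c :: "'g \<Rightarrow>\<^sub>0 'a::comm_monoid_add"
  assumes "P 0" "\<And>g a. P (Poly_Mapping.single g a)" "\<And>c d. P c \<Longrightarrow> P d \<Longrightarrow> P (c + d)"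
  shows "P c"
proof -
  have "P (\<Sum>g\<in>A. Poly_Mapping.single g (Poly_Mapping.lookup c g))" for A
    by (induction A rule: infinite_finite_induct) (auto intro: assms)
  then show ?thesis by (subst group_ring_expand)
qed

lemma lin_mult:
  assumes "\<And>a b. \<phi> (a + b) = \<phi> a * \<phi> b"
  shows "lin \<phi> (c * d) = lin \<phi> c * lin \<phi> d"
proof (induction c rule: group_ring_induct)
  case (single g a)
  then show ?case
    by (induction d rule: group_ring_induct)
      (auto simp: mult_single assms algebra_simps lin_add)
qed (auto simp: lin_add algebra_simps)

lemma lin_shift: "lin \<phi> (group_elem h * c) = lin (\<lambda>s. \<phi> (h + s)) c"
  by (induction c rule: group_ring_induct) (auto simp: mult_single algebra_simps lin_add)

lemma lin_prod:
  assumes "\<And>a b. \<phi> (a + b) = \<phi> a * \<phi> b" "\<phi> 0 = 1"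
  shows "lin \<phi> (\<Prod>i\<in>A. f i) = (\<Prod>i\<in>A. lin \<phi> (f i))"
  by (induction A rule: infinite_finite_induct) (auto simp: lin_mult[OF assms(1)] lin_one assms(2))

lemma lin_power:
  assumes "\<And>a b. \<phi> (a + b) = \<phi> a * \<phi> b" "\<phi> 0 = 1"
  shows "lin \<phi> (c ^ n) = lin \<phi> c ^ n"
  by (induction n) (auto simp: lin_mult[OF assms(1)] lin_one assms(2))

subsection \<open>Restriction of supports\<close>

definition restr :: "'g set \<Rightarrow> ('g \<Rightarrow>\<^sub>0 int) \<Rightarrow> 'g \<Rightarrow>\<^sub>0 int" where
  "restr A c = (\<Sum>g\<in>Poly_Mapping.keys c \<inter> A. Poly_Mapping.single g (Poly_Mapping.lookup c g))"

lemma lookup_restr: "Poly_Mapping.lookup (restr A c) g = (if g \<in> A then Poly_Mapping.lookup c g else 0)"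
  by (simp add: restr_def lookup_sum lookup_single when_def sum.delta in_keys_iff)

lemma restr_add: "restr A (c + d) = restr A c + restr A d"
  by (rule poly_mapping_eqI) (simp add: lookup_restr lookup_add)

lemma restr_zero [simp]: "restr A 0 = 0"
  by (rule poly_mapping_eqI) (simp add: lookup_restr)

lemma restr_sum: "restr A (sum f I) = (\<Sum>i\<in>I. restr A (f i))"
  by (induction I rule: infinite_finite_induct) (auto simp: restr_add)

lemma restr_single: "restr A (Poly_Mapping.single g a) = (if g \<in> A then Poly_Mapping.single g a else 0)"
  by (rule poly_mapping_eqI) (auto simp: lookup_restr lookup_single when_def)

lemma restr_restr: "restr A (restr B c) = restr (A \<inter> B) c"
  by (rule poly_mapping_eqI) (auto simp: lookup_restr)

lemma keys_restr: "Poly_Mapping.keys (restr A c) = Poly_Mapping.keys c \<inter> A"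
  by (auto simp: in_keys_iff lookup_restr split: if_splits)

text \<open>For \<open>A\<close> the set of exponents of one degree this says that \<open>u\<close>
  has degree zero: multiplication by \<open>u\<close> respects homogeneous components.\<close>

definition homogen :: "'g::ab_group_add set \<Rightarrow> ('g \<Rightarrow>\<^sub>0 int) \<Rightarrow> bool" where
  "homogen A u \<longleftrightarrow> (\<forall>c. restr A (u * c) = u * restr A c)"

lemma homogen_single:
  assumes "\<And>g. h + g \<in> A \<longleftrightarrow> g \<in> A"
  shows "homogen A (Poly_Mapping.single h a)"
  unfolding homogen_def
proof
  fix c
  show "restr A (Poly_Mapping.single h a * c) = Poly_Mapping.single h a * restr A c"
    by (induction c rule: group_ring_induct)
      (auto simp: mult_single restr_single restr_add distrib_left assms)
qed

lemma homogen_add: "homogen A u \<Longrightarrow> homogen A v \<Longrightarrow> homogen A (u + v)"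
  by (simp add: homogen_def distrib_right restr_add)

lemma homogen_mult: "homogen A u \<Longrightarrow> homogen A v \<Longrightarrow> homogen A (u * v)"
  by (simp add: homogen_def mult.assoc)

lemma homogen_power: "homogen A u \<Longrightarrow> homogen A (u ^ n)"
  by (induction n) (auto intro: homogen_mult simp: homogen_def mult.assoc)

lemma homogen_prod: "(\<And>i. i \<in> I \<Longrightarrow> homogen A (f i)) \<Longrightarrow> homogen A (\<Prod>i\<in>I. f i)"
  by (induction I rule: infinite_finite_induct) (auto intro: homogen_mult simp: homogen_def mult.assoc)

subsection \<open>Divisibility by binomials\<close>

definition parity_sign :: "int \<Rightarrow> int" where "parity_sign k = (if even k then 1 else - 1)"

lemma parity_sign_add: "parity_sign (k + l) = parity_sign k * parity_sign l" by (auto simp: parity_sign_def)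
lemma parity_sign_0 [simp]: "parity_sign 0 = 1" by (simp add: parity_sign_def)
lemma parity_sign_1 [simp]: "parity_sign 1 = - 1" by (simp add: parity_sign_def)
lemma parity_sign_minus [simp]: "parity_sign (- k) = parity_sign k" by (simp add: parity_sign_def)

text \<open>
  \<open>lin (alternating_weight w t) c\<close> is the alternating sum of the coefficients of \<open>c\<close> along \<open>t + \<int>w\<close>. These sums
  are the obstructions to divisibility by \<open>1 + w\<close>.
\<close>

definition alternating_weight :: "'g::ab_group_add \<Rightarrow> 'g \<Rightarrow> 'g \<Rightarrow> int" where
  "alternating_weight w t s = (if \<exists>k. s = t + zmul k w then parity_sign (THE k. s = t + zmul k w) else 0)"

text \<open>For odd \<open>a\<close> the element \<open>1 + group_elem e\<close> divides
  \<open>1 + group_elem (zmul a e)\<close>, so such a pair has a common factor. The pair of zeros is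
  included, through \<open>e = 0\<close>.\<close>

definition common_odd_root :: "'g::ab_group_add \<Rightarrow> 'g \<Rightarrow> bool" where
  "common_odd_root g h \<longleftrightarrow> (\<exists>e a b. odd a \<and> odd b \<and> g = zmul a e \<and> h = zmul b e)"

lemma common_odd_root_sym: "common_odd_root g h \<longleftrightarrow> common_odd_root h g"
  unfolding common_odd_root_def by blast

context
  fixes w :: "'g::ab_group_add"
  assumes tf: "torsion_free TYPE('g)" and w: "w \<noteq> 0"
begin

lemma zmul_w_inj: "zmul k w = zmul l w \<Longrightarrow> k = l"
  using tf w zmul_diff[of k l w] unfolding torsion_free_def by force

lemma alternating_weight_val: "alternating_weight w t (t + zmul k w) = parity_sign k"
proof -
  have "(THE j. t + zmul k w = t + zmul j w) = k"
    by (rule the_equality) (auto dest: zmul_w_inj)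
  then show ?thesis by (auto simp: alternating_weight_def)
qed

lemma alternating_weight_shift: "alternating_weight w t (zmul j w + s) = parity_sign j * alternating_weight w t s"
proof (cases "\<exists>k. s = t + zmul k w")
  case True
  then obtain k where s: "s = t + zmul k w" by blast
  have "zmul j w + s = t + zmul (j + k) w" by (simp add: s zmul_add algebra_simps)
  then show ?thesis unfolding s by (simp only: alternating_weight_val parity_sign_add)
next
  case False
  have "\<not> (\<exists>k. zmul j w + s = t + zmul k w)"
  proof
    assume "\<exists>k. zmul j w + s = t + zmul k w"
    then obtain k where "zmul j w + s = t + zmul k w" by blast
    then have "s = t + zmul (k - j) w" by (simp add: zmul_diff algebra_simps)
    with False show False by blast
  qed
  with False show ?thesis by (simp add: alternating_weight_def)
qed

lemma alternating_weight_translate: "alternating_weight w (t - h) s = alternating_weight w t (h + s)"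
proof -
  have "(s = t - h + zmul k w) = (h + s = t + zmul k w)" for k
    by (auto simp: algebra_simps)
  then show ?thesis by (simp add: alternating_weight_def)
qed

lemma alternating_weight_translate_w: "alternating_weight w (t - zmul j w) s = parity_sign j * alternating_weight w t s"
  by (simp add: alternating_weight_translate alternating_weight_shift)

lemma lin_alternating_weight_multiple: "lin (alternating_weight w t) ((1 + group_elem w) * c) = 0"
proof -
  have "alternating_weight w t (w + s) = - 1 * alternating_weight w t s" for s using alternating_weight_shift[of t 1 s] by simp
  then have "lin (alternating_weight w t) (group_elem w * c) = - 1 * lin (alternating_weight w t) c"
    by (simp only: lin_shift lin_mult_fun)
  then show ?thesis by (simp add: distrib_right lin_add)
qed

text \<open>Modulo \<open>1 + group_elem w\<close>, translation by \<open>w\<close> is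
  multiplication by -1.\<close>

lemma binomial_dvd_parity_sign: "(1 + group_elem w) dvd group_elem (s + zmul k w) - of_int (parity_sign k) * group_elem s"
proof (induction k rule: int_induct[where k = 0])
  case (step1 i)
  have "group_elem (s + zmul (i + 1) w) - of_int (parity_sign (i + 1)) * group_elem s =
     (1 + group_elem w) * group_elem (s + zmul i w) - (group_elem (s + zmul i w) - of_int (parity_sign i) * group_elem s)"
    by (simp add: distrib_right mult_single parity_sign_add zmul_add algebra_simps)
  then show ?case using step1 by (metis dvd_diff dvd_triv_left)
next
  case (step2 i)
  have parity_sign: "parity_sign (i - 1) = - parity_sign i" using parity_sign_add[of i "- 1"] by simp
  have "group_elem (s + zmul (i - 1) w) - of_int (parity_sign (i - 1)) * group_elem s =
     (1 + group_elem w) * group_elem (s + zmul (i - 1) w) - (group_elem (s + zmul i w) - of_int (parity_sign i) * group_elem s)"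
    by (simp add: distrib_right mult_single parity_sign zmul_diff algebra_simps)
  then show ?case using step2 by (metis dvd_diff dvd_triv_left)
qed simp

text \<open>Moving each support point to a representative of its coset changes \<open>c\<close> by a
  multiple of the binomial; what then sits at a representative \<open>t\<close> is the alternating
  sum based at \<open>t\<close>, which vanishes.\<close>

lemma binomial_dvdI:
  assumes "\<And>t. lin (alternating_weight w t) c = 0"
  shows "(1 + group_elem w) dvd c"
proof -
  define cls where "cls s = range (\<lambda>k. s + zmul k w)" for s
  have cls_eq: "cls (s + zmul k w) = cls s" for s k
  proof -
    have "s + zmul k w + zmul j w \<in> cls s" for j
      unfolding cls_def by (rule range_eqI[of _ _ "k + j"]) (simp add: zmul_add add.assoc)
    moreover have "s + zmul j w \<in> cls (s + zmul k w)" for j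
      unfolding cls_def by (rule range_eqI[of _ _ "j - k"]) (simp add: zmul_diff)
    ultimately show ?thesis unfolding cls_def by blast
  qed
  \<comment> \<open>The choice depends on \<open>s\<close> only through \<open>cls s\<close>, so all
    points of a coset get the same representative.\<close>
  define \<rho> where "\<rho> s = (SOME r. r \<in> cls s)" for s
  have \<rho>: "\<rho> s \<in> cls s" for s
    unfolding \<rho>_def by (rule someI[of _ "s + zmul 0 w"]) (unfold cls_def, rule rangeI)
  have to_rep: "\<exists>k. s = \<rho> s + zmul k w" for s
  proof -
    obtain k where "\<rho> s = s + zmul k w" using \<rho>[of s] unfolding cls_def by blast
    then have "s = \<rho> s + zmul (- k) w" by (simp add: zmul_minus)
    then show ?thesis by blast
  qed
  have d1: "(1 + group_elem w) dvd Poly_Mapping.single s a - Poly_Mapping.single (\<rho> s) (a * alternating_weight w (\<rho> s) s)"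
    for s and a :: int
  proof -
    obtain k where k: "s = \<rho> s + zmul k w" using to_rep by blast
    have al: "alternating_weight w (\<rho> s) s = parity_sign k" by (metis alternating_weight_val k)
    have "of_int z = Poly_Mapping.single (0::'g) z" for z by (subst single_of_int[symmetric]) simp
    then have "Poly_Mapping.single s a - Poly_Mapping.single (\<rho> s) (a * alternating_weight w (\<rho> s) s) =
      of_int a * (group_elem s - of_int (parity_sign k) * group_elem (\<rho> s))"
      by (simp only: al right_diff_distrib mult_single) simp
    then show ?thesis using binomial_dvd_parity_sign[of "\<rho> s" k] k by (metis dvd_mult)
  qed
  let ?K = "Poly_Mapping.keys c" and ?c = "Poly_Mapping.lookup c"
  let ?b = "\<Sum>s\<in>?K. Poly_Mapping.single (\<rho> s) (?c s * alternating_weight w (\<rho> s) s)"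
  have "(1 + group_elem w) dvd (\<Sum>s\<in>?K. Poly_Mapping.single s (?c s) - Poly_Mapping.single (\<rho> s) (?c s * alternating_weight w (\<rho> s) s))"
    by (rule dvd_sum) (rule d1)
  then have "(1 + group_elem w) dvd c - ?b"
    by (simp add: sum_subtractf flip: group_ring_expand)
  moreover have "?b = 0"
  proof (rule poly_mapping_eqI)
    fix t
    show "Poly_Mapping.lookup ?b t = Poly_Mapping.lookup 0 t"
    proof (cases "\<exists>s0. t = \<rho> s0")
      case True
      then obtain s0 where t: "t = \<rho> s0" by blast
      have "(?c s * alternating_weight w (\<rho> s) s when \<rho> s = t) = ?c s * alternating_weight w t s" for s
      proof (cases "\<rho> s = t")
        case False
        have "\<not> (\<exists>k. s = t + zmul k w)"
        proof
          assume "\<exists>k. s = t + zmul k w"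
          then obtain k where k: "s = t + zmul k w" by blast
          obtain l where l: "t = s0 + zmul l w" using \<rho>[of s0] unfolding cls_def t by blast
          have "cls s = cls s0" by (metis k l cls_eq)
          then have "\<rho> s = \<rho> s0" by (simp add: \<rho>_def)
          with False t show False by simp
        qed
        with False show ?thesis by (simp add: alternating_weight_def)
      qed simp
      then have "Poly_Mapping.lookup ?b t = lin (alternating_weight w t) c"
        by (simp add: lookup_sum lookup_single lin_def)
      then show ?thesis by (simp add: assms)
    next
      case False
      then have "\<rho> s \<noteq> t" for s by blast
      then show ?thesis by (simp add: lookup_sum lookup_single when_def)
    qed
  qed
  ultimately show ?thesis by simp
qed

text \<open>The alternating sums of \<open>c\<close> change sign under translation by
  \<open>h\<close> as well as by \<open>w\<close>. If one of them is nonzero, every coset of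
  \<open>\<int>w\<close> through a point \<open>t - zmul m h\<close> meets the finite support of
  \<open>c\<close>; two of these cosets coincide, \<open>w\<close> and \<open>h\<close> satisfy a
  relation, and the signs turn it into a common odd root.\<close>

lemma binomial_dvd_cancel:
  assumes dvd: "(1 + group_elem w) dvd (1 + group_elem h) * c" and odd: "\<not> common_odd_root w h"
  shows "(1 + group_elem w) dvd c"
proof (rule binomial_dvdI, rule ccontr)
  fix t assume nz: "lin (alternating_weight w t) c \<noteq> 0"
  let ?E = "\<lambda>t. lin (alternating_weight w t) c"
  have step: "?E (t - h) = - ?E t" for t
  proof -
    obtain d where "(1 + group_elem h) * c = (1 + group_elem w) * d" using dvd by blast
    then have "lin (alternating_weight w t) ((1 + group_elem h) * c) = 0" by (simp add: lin_alternating_weight_multiple)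
    moreover have "lin (alternating_weight w t) (group_elem h * c) = ?E (t - h)"
      unfolding lin_shift alternating_weight_translate[abs_def] ..
    ultimately show ?thesis by (simp add: distrib_right lin_add)
  qed
  have Eh: "?E (t - zmul m h) = parity_sign m * ?E t" for m
  proof (induction m rule: int_induct[where k = 0])
    case (step1 i)
    have *: "t - zmul (i + 1) h = (t - zmul i h) - h" by (simp add: zmul_add algebra_simps)
    show ?case unfolding * using step[of "t - zmul i h"] step1 by (simp add: parity_sign_add)
  next
    case (step2 i)
    have "t - zmul (i - 1) h - h = t - zmul i h" by (simp add: zmul_diff)
    from step[of "t - zmul (i - 1) h", unfolded this] show ?case
      using step2 parity_sign_add[of i "- 1"] by simp
  qed simp
  have Ew: "?E (t - zmul m w) = parity_sign m * ?E t" for m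
  proof -
    have "alternating_weight w (t - zmul m w) = (\<lambda>s. parity_sign m * alternating_weight w t s)"
      by (rule ext) (rule alternating_weight_translate_w)
    then show ?thesis by (simp only: lin_mult_fun)
  qed
  \<comment> \<open>A nonzero alternating sum has a support point in its coset; these points feed
    the pigeonhole argument on \<open>m\<close>.\<close>
  have "\<exists>s\<in>Poly_Mapping.keys c. \<exists>k. s = t - zmul (int m) h + zmul k w" for m :: nat
  proof (rule ccontr)
    assume "\<not> ?thesis"
    then have "?E (t - zmul (int m) h) = 0" by (auto simp: lin_def alternating_weight_def intro!: sum.neutral)
    with nz Eh[of "int m"] show False by (auto simp: parity_sign_def split: if_splits)
  qed
  then obtain S where S: "\<And>m::nat. S m \<in> Poly_Mapping.keys c"
    "\<And>m. \<exists>k. S m = t - zmul (int m) h + zmul k w" by metis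
  have "range S \<subseteq> Poly_Mapping.keys c" using S by blast
  then have "finite (range S)" by (rule finite_subset) (rule finite_keys)
  then have "\<not> inj S" using finite_imageD infinite_UNIV_nat by blast
  then obtain m n where mn: "S m = S n" "m \<noteq> n" unfolding inj_def by blast
  obtain k l where kl: "S m = t - zmul (int m) h + zmul k w" "S n = t - zmul (int n) h + zmul l w"
    using S(2) by blast
  define M where "M = int m - int n"
  define K where "K = k - l"
  have MK: "zmul M h = zmul K w" "M \<noteq> 0"
    using mn kl by (simp_all add: M_def K_def zmul_diff algebra_simps)
  define g where "g = gcd M K"
  have g: "g \<noteq> 0" using MK by (simp add: g_def)
  obtain M' K' where M'K': "M = g * M'" "K = g * K'" "coprime M' K'"
    using gcd_coprime_exists[of M K] g unfolding g_def by (auto simp: mult.commute)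
  have "zmul g (zmul M' h - zmul K' w) = 0"
    using MK M'K' by (simp add: zmul_diff_right flip: zmul_mult)
  then have eq: "zmul M' h = zmul K' w" using tf g unfolding torsion_free_def by force
  \<comment> \<open>The sum at \<open>t - zmul M' h = t - zmul K' w\<close> is computed in two ways.
    Coprime integers of equal parity are both odd.\<close>
  have "parity_sign M' = parity_sign K'" using Eh[of M'] Ew[of K'] nz eq by simp
  then have odds: "odd M'" "odd K'"
    using M'K'(3) by (auto simp: parity_sign_def split: if_splits dest: coprime_common_divisor)
  obtain u v where uv: "u * M' + v * K' = 1"
    using bezout_int[of M' K'] M'K'(3) by auto
  \<comment> \<open>By the Bezout relation and \<open>eq\<close>, the multiples of \<open>e\<close>
    by \<open>M'\<close> and \<open>K'\<close> are \<open>w\<close> and \<open>h\<close>.\<close>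
  define e where "e = zmul u w + zmul v h"
  have "zmul M' e = zmul (u * M' + v * K') w"
    by (simp add: e_def zmul_add_right zmul_add zmul_mult[of v] flip: eq)
      (simp add: mult.commute flip: zmul_mult)
  moreover have "zmul K' e = zmul (u * M' + v * K') h"
    by (simp add: e_def zmul_add_right zmul_add zmul_mult[of u] eq)
      (simp add: mult.commute flip: zmul_mult)
  ultimately have "w = zmul M' e" "h = zmul K' e" by (simp_all add: uv)
  with odds odd show False unfolding common_odd_root_def by blast
qed

end

section \<open>Subrings of a field\<close>

definition is_subring :: "'k::comm_ring_1 set \<Rightarrow> bool" where
  "is_subring M \<longleftrightarrow> - 1 \<in> M \<and> (\<forall>a\<in>M. \<forall>b\<in>M. a + b \<in> M \<and> a * b \<in> M)"

context
  fixes M :: "'k::comm_ring_1 set"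
  assumes M: "is_subring M"
begin

lemma subring_add: "a \<in> M \<Longrightarrow> b \<in> M \<Longrightarrow> a + b \<in> M"
  and subring_mult: "a \<in> M \<Longrightarrow> b \<in> M \<Longrightarrow> a * b \<in> M"
  using M by (auto simp: is_subring_def)

lemma subring_neg1: "- 1 \<in> M"
  using M by (auto simp: is_subring_def)

lemma subring_1: "1 \<in> M"
  using subring_mult[OF subring_neg1 subring_neg1] by simp

lemma subring_0: "0 \<in> M"
  using subring_add[OF subring_neg1 subring_1] by simp

lemma subring_uminus: "a \<in> M \<Longrightarrow> - a \<in> M"
  using subring_mult[OF subring_neg1, of a] by simp

lemma subring_diff: "a \<in> M \<Longrightarrow> b \<in> M \<Longrightarrow> a - b \<in> M"
  using subring_add[OF _ subring_uminus, of a b] by simp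

lemma subring_power: "a \<in> M \<Longrightarrow> a ^ n \<in> M"
  by (induction n) (auto intro: subring_mult subring_1)

lemma subring_prod: "(\<And>i. i \<in> I \<Longrightarrow> f i \<in> M) \<Longrightarrow> prod f I \<in> M"
  by (induction I rule: infinite_finite_induct) (auto intro: subring_mult subring_1)

lemma subring_sum: "(\<And>i. i \<in> I \<Longrightarrow> f i \<in> M) \<Longrightarrow> sum f I \<in> M"
  by (induction I rule: infinite_finite_induct) (auto intro: subring_add subring_0)

lemma subring_of_nat: "of_nat n \<in> M"
  by (induction n) (auto intro: subring_add subring_0 subring_1)

lemma subring_of_int: "of_int n \<in> M"
  by (cases n rule: int_cases2) (auto intro: subring_of_nat subring_uminus)

lemma subring_lin: "(\<And>g. g \<in> Poly_Mapping.keys c \<Longrightarrow> \<phi> g \<in> M) \<Longrightarrow> lin \<phi> c \<in> M"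
  unfolding lin_def by (auto intro!: subring_sum subring_mult subring_of_int)

lemma subring_power_add_diff:
  assumes "a \<in> M" "d \<in> M"
  shows "\<exists>r\<in>M. (a + d) ^ n = a ^ n + d * r"
proof (induction n)
  case 0
  then show ?case using subring_0 by (intro bexI[of _ 0]) auto
next
  case (Suc n)
  then obtain r where r: "r \<in> M" "(a + d) ^ n = a ^ n + d * r" by blast
  have "(a + d) ^ Suc n = a ^ Suc n + d * (a ^ n + (a + d) * r)"
    by (simp add: r(2) algebra_simps)
  moreover have "a ^ n + (a + d) * r \<in> M"
    using assms r(1) by (intro subring_add subring_mult subring_power)
  ultimately show ?case by blast
qed

text \<open>Induction in steps of two from exponent 1. The cofactor has to stay in \<open>M\<close>,
  because divisibility is later needed inside a polynomial ring.\<close>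

lemma subring_odd_power_sum:
  assumes "s \<in> M" "t \<in> M"
  shows "odd n \<Longrightarrow> \<exists>r\<in>M. s ^ n + t ^ n = (s + t) * r"
proof (induction n rule: less_induct)
  case (less n)
  show ?case
  proof (cases "n = 1")
    case True
    then show ?thesis using subring_1 by (intro bexI[of _ 1]) auto
  next
    case False
    with less.prems have "n = (n - 2) + 2" "odd (n - 2)" "n - 2 < n" by presburger+
    then obtain m where m: "n = m + 2" "odd m" "m < n" by blast
    then obtain r where r: "r \<in> M" "s ^ m + t ^ m = (s + t) * r" using less.IH by blast
    have "s ^ n + t ^ n = s ^ 2 * (s ^ m + t ^ m) + t ^ m * (t + s) * (t - s)"
      by (simp add: m(1) power_add power2_eq_square algebra_simps)
    also have "\<dots> = (s + t) * (s ^ 2 * r + t ^ m * (t - s))"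
      by (simp add: r(2) algebra_simps)
    finally have "s ^ n + t ^ n = (s + t) * (s ^ 2 * r + t ^ m * (t - s))" .
    moreover have "s ^ 2 * r + t ^ m * (t - s) \<in> M"
      using assms r(1) by (intro subring_add subring_mult subring_power subring_diff)
    ultimately show ?thesis by blast
  qed
qed

end

inductive_set sub_gen :: "'k::comm_ring_1 set \<Rightarrow> 'k set" for X where
  base: "a \<in> X \<Longrightarrow> a \<in> sub_gen X"
| neg1: "- 1 \<in> sub_gen X"
| add: "a \<in> sub_gen X \<Longrightarrow> b \<in> sub_gen X \<Longrightarrow> a + b \<in> sub_gen X"
| mult: "a \<in> sub_gen X \<Longrightarrow> b \<in> sub_gen X \<Longrightarrow> a * b \<in> sub_gen X"

lemma is_subring_sub_gen: "is_subring (sub_gen X)"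
  by (auto simp: is_subring_def intro: sub_gen.intros)

lemma sub_gen_minimal:
  assumes "is_subring M" "X \<subseteq> M"
  shows "sub_gen X \<subseteq> M"
proof
  fix a assume "a \<in> sub_gen X"
  then show "a \<in> M"
    by induction (use assms in \<open>auto intro: subring_add subring_mult subring_neg1\<close>)
qed

text \<open>Both \<open>s * f\<close> and \<open>t * f\<close> satisfy the premises with one power
  less, and \<open>f\<close> is their combination with coefficients \<open>a\<close> and
  \<open>b\<close>; so induction on \<open>m + n\<close> replaces a unit-ideal relation between
  powers.\<close>

lemma subring_unit_ideal_descent:
  assumes M: "is_subring M" and "a \<in> M" "b \<in> M" "s \<in> M" "t \<in> M" and 1: "a * s + b * t = 1"
  shows "s ^ m * f \<in> M \<Longrightarrow> t ^ n * f \<in> M \<Longrightarrow> f \<in> M"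
proof (induction "m + n" arbitrary: m n f)
  case 0
  then show ?case by simp
next
  case (Suc k)
  show ?case
  proof (cases "m = 0 \<or> n = 0")
    case True
    then show ?thesis using Suc.prems by auto
  next
    case False
    then obtain m' n' where mn: "m = Suc m'" "n = Suc n'" by (metis not0_implies_Suc)
    have "s * f \<in> M"
    proof (rule Suc.hyps(1)[of m' n])
      show "k = m' + n" using Suc.hyps(2) mn by simp
      show "s ^ m' * (s * f) \<in> M" using Suc.prems(1) by (simp add: mn algebra_simps)
      have "t ^ n * (s * f) = s * (t ^ n * f)" by (simp add: algebra_simps)
      then show "t ^ n * (s * f) \<in> M" using Suc.prems(2) assms by (metis subring_mult)
    qed
    moreover have "t * f \<in> M"
    proof (rule Suc.hyps(1)[of m n'])
      show "k = m + n'" using Suc.hyps(2) mn by simp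
      show "t ^ n' * (t * f) \<in> M" using Suc.prems(2) by (simp add: mn algebra_simps)
      have "s ^ m * (t * f) = t * (s ^ m * f)" by (simp add: algebra_simps)
      then show "s ^ m * (t * f) \<in> M" using Suc.prems(1) assms by (metis subring_mult)
    qed
    ultimately have "a * (s * f) + b * (t * f) \<in> M"
      by (intro subring_add[OF M] subring_mult[OF M assms(2)] subring_mult[OF M assms(3)])
    also have "a * (s * f) + b * (t * f) = (a * s + b * t) * f" by (simp add: algebra_simps)
    finally show ?thesis unfolding 1 by simp
  qed
qed

subsection \<open>Regular pairs\<close>

text \<open>\<open>b\<close> is a nonzerodivisor modulo \<open>a\<close>, which stands in for
  coprimality. The notion is one-sided; \<open>regular_pair_sym\<close> reverses it when
  \<open>a\<close> is cancellable.\<close>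

definition regular_pair :: "'r::comm_ring_1 \<Rightarrow> 'r \<Rightarrow> bool" where
  "regular_pair a b \<longleftrightarrow> (\<forall>c. a dvd b * c \<longrightarrow> a dvd c)"

definition cancellable :: "'r::comm_ring_1 \<Rightarrow> bool" where
  "cancellable a \<longleftrightarrow> (\<forall>b c. a * b = a * c \<longrightarrow> b = c)"

lemma cancellableD: "cancellable a \<Longrightarrow> a * b = a * c \<Longrightarrow> b = c"
  unfolding cancellable_def by blast

lemma regular_pair_sym: "regular_pair a b \<Longrightarrow> cancellable a \<Longrightarrow> regular_pair b a"
  unfolding regular_pair_def
proof (intro allI impI)
  fix c assume ab: "\<forall>c. a dvd b * c \<longrightarrow> a dvd c" and a: "cancellable a" and "b dvd a * c"
  then obtain d where d: "a * c = b * d" by blast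
  then have "a dvd d" using ab by (metis dvd_triv_left)
  then obtain e where e: "d = a * e" by blast
  have "a * c = a * (b * e)" by (simp add: d e algebra_simps)
  then show "b dvd c" using a unfolding cancellable_def by (metis dvd_triv_left)
qed

lemma regular_pair_mult_right: "regular_pair a b \<Longrightarrow> regular_pair a c \<Longrightarrow> regular_pair a (b * c)"
  unfolding regular_pair_def by (metis mult.assoc)

lemma regular_pair_one_right: "regular_pair a 1"
  by (simp add: regular_pair_def)

lemma regular_pair_power_right: "regular_pair a b \<Longrightarrow> regular_pair a (b ^ n)"
  by (induction n) (auto intro: regular_pair_mult_right regular_pair_one_right)

lemma cancellable_mult: "cancellable a \<Longrightarrow> cancellable b \<Longrightarrow> cancellable (a * b)"
  unfolding cancellable_def by (metis mult.assoc)

lemma cancellable_power: "cancellable a \<Longrightarrow> cancellable (a ^ n)"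
proof (induction n)
  case 0
  show ?case by (simp add: cancellable_def)
next
  case (Suc n)
  then show ?case using cancellable_mult[of a "a ^ n"] by simp
qed

lemma regular_pair_power: "regular_pair a b \<Longrightarrow> cancellable a \<Longrightarrow> cancellable b \<Longrightarrow> regular_pair (a ^ m) (b ^ n)"
  by (intro regular_pair_power_right regular_pair_sym[OF regular_pair_power_right[OF regular_pair_sym, of a b]])

lemma regular_pair_prod_right: "(\<And>i. i \<in> I \<Longrightarrow> regular_pair a (f i)) \<Longrightarrow> regular_pair a (prod f I)"
  by (induction I rule: infinite_finite_induct) (auto intro: regular_pair_mult_right regular_pair_one_right)

text \<open>A further factor divides \<open>prod f I * d\<close> and is regular against
  \<open>prod f I\<close>, hence divides the cofactor \<open>d\<close>.\<close>

lemma prod_dvd_of_regular_pair: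
  assumes "finite I" "\<And>i. i \<in> I \<Longrightarrow> f i dvd c"
    "\<And>i j. i \<in> I \<Longrightarrow> j \<in> I \<Longrightarrow> i \<noteq> j \<Longrightarrow> regular_pair (f i) (f j)"
  shows "prod f I dvd c"
  using assms
proof (induction I rule: finite_induct)
  case (insert i I)
  then have "prod f I dvd c" by blast
  then obtain d where d: "c = prod f I * d" by (rule dvdE)
  have "regular_pair (f i) (prod f I)" using insert by (intro regular_pair_prod_right) auto
  moreover have "f i dvd prod f I * d" using insert.prems d by auto
  ultimately have "f i dvd d" unfolding regular_pair_def by blast
  moreover have "prod f (insert i I) = prod f I * f i" using insert.hyps by (simp add: mult.commute)
  ultimately show ?case unfolding d by (simp only: mult_dvd_mono[OF dvd_refl])
qed simp

section \<open>Laurent monomials\<close>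

definition mon :: "('p \<Rightarrow> 'k::field) \<Rightarrow> ('n::finite \<Rightarrow> 'k) \<Rightarrow> 'p \<times> ('n \<Rightarrow> int) \<Rightarrow> 'k" where
  "mon \<psi> x g = \<psi> (fst g) * (\<Prod>i\<in>UNIV. x i powi snd g i)"

definition character :: "('p::ab_group_add \<Rightarrow> 'k::field) \<Rightarrow> bool" where
  "character \<psi> \<longleftrightarrow> \<psi> 0 = 1 \<and> (\<forall>a b. \<psi> (a + b) = \<psi> a * \<psi> b)"

text \<open>Algebraic independence in Laurent form: evaluation embeds the group ring of
  \<open>'p \<times> ('n \<Rightarrow> int)\<close> in the field. In the ambient field it amounts to
  \<open>alg_independent\<close> over the fraction field of the coefficients
  (\<open>chart_of_alg_independent\<close>, \<open>alg_independent_of_chart\<close>).\<close>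

definition chart :: "('p::ab_group_add \<Rightarrow> 'k::field) \<Rightarrow> ('n::finite \<Rightarrow> 'k) \<Rightarrow> bool" where
  "chart \<psi> x \<longleftrightarrow> character \<psi> \<and> (\<forall>c. lin (mon \<psi> x) c = 0 \<longrightarrow> c = 0)"

definition Laur :: "('p::ab_group_add \<Rightarrow> 'k::field) \<Rightarrow> ('n::finite \<Rightarrow> 'k) \<Rightarrow> 'k set" where
  "Laur \<psi> x = range (lin (mon \<psi> x))"

definition unit_vec :: "'n \<Rightarrow> 'n \<Rightarrow> int" where "unit_vec i = (\<lambda>j. if j = i then 1 else 0)"

lemma unit_vec_simps [simp]: "unit_vec i i = 1" "j \<noteq> i \<Longrightarrow> unit_vec i j = 0"
  by (simp_all add: unit_vec_def)

lemma mon_unit: "character \<psi> \<Longrightarrow> mon \<psi> x (0, unit_vec i) = x i"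
proof -
  assume "character \<psi>"
  moreover have "x j powi unit_vec i j = (if j = i then x j else 1)" for j
    by (simp add: unit_vec_def)
  ultimately have "mon \<psi> x (0, unit_vec i) = (\<Prod>j\<in>UNIV. if j = i then x j else 1)"
    by (simp add: mon_def character_def)
  then show ?thesis by simp
qed

lemma character_nonzero:
  assumes "character \<psi>" shows "\<psi> a \<noteq> 0"
proof -
  have "\<psi> a * \<psi> (- a) = \<psi> (a + - a)" using assms unfolding character_def by metis
  then show ?thesis using assms unfolding character_def by auto
qed

lemma character_minus: "character \<psi> \<Longrightarrow> \<psi> (- a) = inverse (\<psi> a)"
  by (metis add.right_inverse character_def inverse_unique)

lemma character_diff: "character \<psi> \<Longrightarrow> \<psi> (a - b) = \<psi> a / \<psi> b"
  unfolding diff_conv_add_uminus[of a b] divide_inverse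
  by (simp only: character_minus character_def[THEN iffD1, THEN conjunct2, rule_format])

lemma character_zmul: "character \<psi> \<Longrightarrow> \<psi> (zmul k a) = \<psi> a powi k"
proof (induction k rule: int_induct[where k = 0])
  case (step1 i)
  then show ?case using character_nonzero[of \<psi> a]
    by (simp add: zmul_add power_int_add character_def)
next
  case (step2 i)
  then show ?case using character_nonzero[of \<psi> a]
    by (simp add: zmul_diff power_int_diff character_diff)
qed (simp add: character_def)

lemma character_sum: "character \<psi> \<Longrightarrow> \<psi> (sum f A) = (\<Prod>i\<in>A. \<psi> (f i))"
  by (induction A rule: infinite_finite_induct) (auto simp: character_def)

context
  fixes \<psi> :: "'p::ab_group_add \<Rightarrow> 'k::field" and x :: "'n::finite \<Rightarrow> 'k"
  assumes \<psi>: "character \<psi>" and nz: "\<And>i. x i \<noteq> 0"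
begin

lemma character_mon: "character (mon \<psi> x)"
  using \<psi> by (auto simp: character_def mon_def power_int_add nz prod.distrib)

lemma mon_0: "mon \<psi> x 0 = 1"
  using character_mon by (simp add: character_def)

lemma mon_add: "mon \<psi> x (a + b) = mon \<psi> x a * mon \<psi> x b"
  using character_mon unfolding character_def by blast

lemma lin_mon_mult: "lin (mon \<psi> x) (c * d) = lin (mon \<psi> x) c * lin (mon \<psi> x) d"
  by (rule lin_mult) (rule mon_add)

lemma lin_mon_power: "lin (mon \<psi> x) (c ^ n) = lin (mon \<psi> x) c ^ n"
  by (rule lin_power) (rule mon_add, rule mon_0)

lemma lin_mon_prod: "lin (mon \<psi> x) (prod f I) = (\<Prod>i\<in>I. lin (mon \<psi> x) (f i))"
  by (rule lin_prod) (rule mon_add, rule mon_0)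

lemma mon_in_Laur: "mon \<psi> x g \<in> Laur \<psi> x"
  unfolding Laur_def by (rule range_eqI[of _ _ "group_elem g"]) simp

lemma is_subring_Laur: "is_subring (Laur \<psi> x)"
proof -
  have "- 1 = lin (mon \<psi> x) (- 1)" by (simp add: lin_uminus lin_one mon_0)
  then have "- 1 \<in> Laur \<psi> x" unfolding Laur_def by (rule range_eqI)
  moreover have "lin (mon \<psi> x) c + lin (mon \<psi> x) d \<in> Laur \<psi> x"
    "lin (mon \<psi> x) c * lin (mon \<psi> x) d \<in> Laur \<psi> x" for c d
    unfolding Laur_def by (auto simp flip: lin_add lin_mon_mult)
  ultimately show ?thesis by (auto simp: is_subring_def Laur_def)
qed

lemma coeff_in_Laur: "\<psi> p \<in> Laur \<psi> x"
  using mon_in_Laur[of "(p, 0)"] by (simp add: mon_def)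

lemma var_in_Laur: "x i \<in> Laur \<psi> x"
  using mon_in_Laur[of "(0, unit_vec i)"] by (simp add: mon_unit[OF \<psi>])

lemma inverse_mon_in_Laur: "inverse (mon \<psi> x g) \<in> Laur \<psi> x"
  using mon_in_Laur[of "- g"] by (simp add: character_minus[OF character_mon])

lemma inverse_var_in_Laur: "inverse (x i) \<in> Laur \<psi> x"
  using inverse_mon_in_Laur[of "(0, unit_vec i)"] by (simp add: mon_unit[OF \<psi>])

end

lemma mon_mem:
  assumes M: "is_subring M" and "\<psi> (fst g) \<in> M"
    and "\<And>i. snd g i > 0 \<Longrightarrow> x i \<in> M" "\<And>i. snd g i < 0 \<Longrightarrow> inverse (x i) \<in> M"
  shows "mon \<psi> x g \<in> M"
proof -
  have "x i powi snd g i \<in> M" for i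
    unfolding power_int_def using assms(3,4)[of i] subring_1[OF M]
    by (cases "snd g i" "0::int" rule: linorder_cases) (auto intro!: subring_power[OF M])
  then show ?thesis unfolding mon_def using assms(2) by (intro subring_mult subring_prod M)
qed

lemma Laur_minimal:
  assumes "is_subring M" "\<And>p. \<psi> p \<in> M" "\<And>i. x i \<in> M" "\<And>i. inverse (x i) \<in> M"
  shows "Laur \<psi> x \<subseteq> M"
  unfolding Laur_def using assms by (auto intro!: subring_lin mon_mem)

subsection \<open>Charts\<close>

context
  fixes \<psi> :: "'p::ab_group_add \<Rightarrow> 'k::field" and x :: "'n::finite \<Rightarrow> 'k"
  assumes ch: "chart \<psi> x"
begin

lemma chart_character: "character \<psi>"
  using ch by (simp add: chart_def)

lemma chart_inj: "lin (mon \<psi> x) c = lin (mon \<psi> x) d \<Longrightarrow> c = d"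
  using ch lin_diff[of "mon \<psi> x" c d] by (auto simp: chart_def)

lemma chart_inj0: "lin (mon \<psi> x) c = 0 \<Longrightarrow> c = 0"
  using ch by (auto simp: chart_def)

lemma chart_nz: "x i \<noteq> 0"
proof
  assume "x i = 0"
  then have "lin (mon \<psi> x) (group_elem (0, unit_vec i)) = 0"
    by (simp add: mon_unit[OF chart_character])
  then have "group_elem (0::'p, unit_vec i) = 0" by (rule chart_inj0)
  then have "Poly_Mapping.lookup (group_elem (0::'p, unit_vec i)) (0, unit_vec i) = 0" by (metis lookup_zero)
  then show False by simp
qed

lemma chart_mon_character: "character (mon \<psi> x)"
  by (rule character_mon[OF chart_character chart_nz])

lemmas chart_simps = lin_mon_mult[OF chart_character chart_nz] lin_mon_power[OF chart_character chart_nz]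
  lin_mon_prod[OF chart_character chart_nz]

lemma chart_cancellable: "c \<noteq> 0 \<Longrightarrow> cancellable (c :: 'p \<times> ('n \<Rightarrow> int) \<Rightarrow>\<^sub>0 int)"
  unfolding cancellable_def
proof (intro allI impI)
  fix b d :: "'p \<times> ('n \<Rightarrow> int) \<Rightarrow>\<^sub>0 int" assume "c \<noteq> 0" "c * b = c * d"
  then have "lin (mon \<psi> x) c * lin (mon \<psi> x) b = lin (mon \<psi> x) c * lin (mon \<psi> x) d"
    by (simp flip: chart_simps)
  then show "b = d" using chart_inj0[of c] \<open>c \<noteq> 0\<close> chart_inj by auto
qed

end

definition binomial_elem :: "'g \<Rightarrow> 'g \<Rightarrow> 'g \<Rightarrow>\<^sub>0 int" where
  "binomial_elem u v = group_elem u + group_elem v"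

lemma binomial_elem_nonzero: "binomial_elem u v \<noteq> 0"
proof
  assume "binomial_elem u v = 0"
  then have "Poly_Mapping.lookup (binomial_elem u v) u = 0" by simp
  then show False by (simp add: binomial_elem_def lookup_add lookup_single when_def split: if_splits)
qed

lemma binomial_elem_factor: "binomial_elem u v = group_elem v * (1 + group_elem (u - v :: 'g::ab_group_add))"
  by (simp add: binomial_elem_def distrib_left mult_single)

lemma group_elem_dvd: "group_elem (v :: 'g::ab_group_add) * c dvd d \<longleftrightarrow> c dvd d"
proof
  assume "c dvd d"
  then have "group_elem v * c dvd group_elem v * d" by (rule mult_dvd_mono[OF dvd_refl])
  moreover have "group_elem v * d dvd d"
    by (rule dvdI[of _ _ "group_elem (- v)"]) (simp add: mult.assoc[symmetric] mult.commute[of _ "group_elem (- v)"] mult_single)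
  ultimately show "group_elem v * c dvd d" by (rule dvd_trans)
qed (meson dvd_mult_right)

text \<open>Up to a group element the binomial is \<open>1 + group_elem (u - v)\<close>, so
  \<open>binomial_dvd_cancel\<close> applies when \<open>u \<noteq> v\<close>. If
  \<open>u = v\<close>, the roles are exchanged; both differences cannot vanish, since 0 and 0 have
  the common odd root 0.\<close>

lemma regular_pair_binomial_elem:
  fixes \<psi> :: "'p::ab_group_add \<Rightarrow> 'k::field" and x :: "'n::finite \<Rightarrow> 'k"
  assumes ch: "chart \<psi> x" and tf: "torsion_free TYPE('p)"
    and odd: "\<not> common_odd_root (u - v) (u' - v')"
  shows "regular_pair (binomial_elem u v) (binomial_elem u' v' :: 'p \<times> ('n \<Rightarrow> int) \<Rightarrow>\<^sub>0 int)"
proof -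
  have tf': "torsion_free TYPE('p \<times> ('n \<Rightarrow> int))"
    by (intro torsion_free_prod tf torsion_free_fun)
  have *: "regular_pair (binomial_elem u v) (binomial_elem u' v' :: 'p \<times> ('n \<Rightarrow> int) \<Rightarrow>\<^sub>0 int)"
    if "u - v \<noteq> 0" "\<not> common_odd_root (u - v) (u' - v')" for u v u' v'
    unfolding regular_pair_def
  proof (intro allI impI)
    fix c assume "binomial_elem u v dvd binomial_elem u' v' * c"
    then have "(1 + group_elem (u - v)) dvd group_elem v' * (1 + group_elem (u' - v')) * c"
      by (simp only: binomial_elem_factor group_elem_dvd)
    then have "(1 + group_elem (u - v)) dvd (1 + group_elem (u' - v')) * (group_elem v' * c)"
      by (simp only: mult.commute mult.left_commute mult.assoc)
    then have "(1 + group_elem (u - v)) dvd group_elem v' * c"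
      using binomial_dvd_cancel[OF tf' that(1)] that(2) by blast
    then have "(1 + group_elem (u - v)) dvd group_elem (- v') * (group_elem v' * c)" by (rule dvd_mult)
    then have "(1 + group_elem (u - v)) dvd c" by (simp add: mult.assoc[symmetric] mult_single)
    then show "binomial_elem u v dvd c" by (simp add: binomial_elem_factor group_elem_dvd)
  qed
  show ?thesis
  proof (cases "u - v = 0")
    case False
    then show ?thesis using * odd by blast
  next
    case True
    have "u' - v' \<noteq> 0"
    proof
      assume "u' - v' = 0"
      with True have "u - v = zmul 1 0 \<and> u' - v' = zmul 1 0" by simp
      then show False using odd unfolding common_odd_root_def by (metis odd_one)
    qed
    then have "regular_pair (binomial_elem u' v') (binomial_elem u v)" using * odd by (subst (asm) common_odd_root_sym) blast
    then show ?thesis by (rule regular_pair_sym) (rule chart_cancellable[OF ch binomial_elem_nonzero])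
  qed
qed

subsection \<open>Exchanging one variable\<close>

definition flip :: "'n \<Rightarrow> 'p \<times> ('n \<Rightarrow> int) \<Rightarrow> 'p \<times> ('n \<Rightarrow> int)" where
  "flip j g = (fst g, (snd g)(j := - snd g j))"

lemma flip_flip [simp]: "flip j (flip j g) = g"
  by (simp add: flip_def)

lemma snd_flip [simp]: "snd (flip j g) j = - snd g j"
  by (simp add: flip_def)

context
  fixes \<psi> :: "'p::ab_group_add \<Rightarrow> 'k::field" and x :: "'n::finite \<Rightarrow> 'k"
    and u v :: "'p \<times> ('n \<Rightarrow> int)" and j :: 'n and P :: 'k and x' :: "'n \<Rightarrow> 'k"
  assumes ch: "chart \<psi> x" and uj: "snd u j = 0" and vj: "snd v j = 0"
  defines "P \<equiv> mon \<psi> x u + mon \<psi> x v"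
  defines "x' \<equiv> x(j := P / x j)"
begin

lemma exchange_binomial: "P = lin (mon \<psi> x) (binomial_elem u v)"
  by (simp add: P_def binomial_elem_def lin_add)

lemma exchange_binomial_nz: "P \<noteq> 0"
  using chart_inj0[OF ch, of "binomial_elem u v"] binomial_elem_nonzero[of u v] exchange_binomial by metis

lemma mon_exchange: "mon \<psi> x' g = mon \<psi> x (flip j g) * P powi snd g j"
proof -
  have "x' i powi snd g i = x i powi snd (flip j g) i * (if i = j then P powi snd g j else 1)" for i
    by (auto simp: x'_def flip_def power_int_divide_distrib power_int_minus field_simps)
  then show ?thesis by (simp add: mon_def prod.distrib) (simp add: flip_def)
qed

text \<open>By \<open>mon_exchange\<close> both sides are expanded in the old variables, the factor
  with exponent \<open>N\<close> clearing negative powers of \<open>P\<close>. As \<open>u\<close>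
  and \<open>v\<close> do not involve \<open>x j\<close>, multiplication by the binomial keeps the
  degree in \<open>x j\<close>, and the parts of degree \<open>- k\<close> can be compared.\<close>

lemma exchange_compare:
  assumes eq: "lin (mon \<psi> x) c = lin (mon \<psi> x') c'"
    and N: "\<And>g. g \<in> Poly_Mapping.keys c' \<Longrightarrow> - int N \<le> snd g j" and k: "- int N \<le> k"
  shows "binomial_elem u v ^ N * restr {g. snd g j = - k} c = binomial_elem u v ^ nat (k + int N) *
    (\<Sum>g\<in>{g \<in> Poly_Mapping.keys c'. snd g j = k}. Poly_Mapping.single (flip j g) (Poly_Mapping.lookup c' g))"
proof -
  let ?L = "lin (mon \<psi> x)" and ?K = "Poly_Mapping.keys c'" and ?c = "Poly_Mapping.lookup c'"
  note simps = chart_simps[OF ch]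
  have "?L (binomial_elem u v ^ N * c) = P ^ N * lin (mon \<psi> x') c'"
    by (simp add: simps exchange_binomial eq)
  also have "\<dots> = (\<Sum>g\<in>?K. ?L (Poly_Mapping.single (flip j g) (?c g) * binomial_elem u v ^ nat (snd g j + int N)))"
    unfolding lin_def[of "mon \<psi> x'"] sum_distrib_left
  proof (rule sum.cong[OF refl])
    fix g assume g: "g \<in> ?K"
    have "P ^ N * P powi snd g j = P powi (snd g j + int N)"
      using exchange_binomial_nz by (simp add: power_int_add mult.commute)
    also have "\<dots> = P ^ nat (snd g j + int N)" using N[OF g] by (simp add: power_int_def)
    finally show "P ^ N * (of_int (?c g) * mon \<psi> x' g) =
        ?L (Poly_Mapping.single (flip j g) (?c g) * binomial_elem u v ^ nat (snd g j + int N))"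
      by (simp add: simps mon_exchange exchange_binomial algebra_simps)
  qed
  finally have *: "binomial_elem u v ^ N * c =
      (\<Sum>g\<in>?K. Poly_Mapping.single (flip j g) (?c g) * binomial_elem u v ^ nat (snd g j + int N))"
    by (intro chart_inj[OF ch]) (simp only: lin_sum)
  let ?A = "{g::'p \<times> ('n \<Rightarrow> int). snd g j = - k}"
  have hom: "homogen ?A (binomial_elem u v ^ n)" for n
    unfolding binomial_elem_def by (intro homogen_power homogen_add homogen_single) (auto simp: uj vj)
  then have "binomial_elem u v ^ N * restr ?A c = restr ?A (binomial_elem u v ^ N * c)" by (simp add: homogen_def)
  also have "\<dots> = (\<Sum>g\<in>?K. binomial_elem u v ^ nat (snd g j + int N) * restr ?A (Poly_Mapping.single (flip j g) (?c g)))"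
    unfolding * restr_sum by (subst mult.commute) (use hom in \<open>simp add: homogen_def\<close>)
  also have "\<dots> = (\<Sum>g\<in>?K. if snd g j = k then binomial_elem u v ^ nat (k + int N) * Poly_Mapping.single (flip j g) (?c g) else 0)"
    by (auto simp: restr_single intro!: sum.cong)
  also have "\<dots> = binomial_elem u v ^ nat (k + int N) *
    (\<Sum>g\<in>{g \<in> ?K. snd g j = k}. Poly_Mapping.single (flip j g) (?c g))"
    by (simp add: sum.inter_filter sum_distrib_left if_distrib cong: if_cong)
  finally show ?thesis .
qed

lemma exchange_bound:
  fixes c' :: "'p \<times> ('n \<Rightarrow> int) \<Rightarrow>\<^sub>0 int"
  shows "\<exists>N. \<forall>g\<in>Poly_Mapping.keys c'. - int N \<le> snd g j"
proof -
  let ?N = "\<Sum>g\<in>Poly_Mapping.keys c'. nat (- snd g j)"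
  have "- int ?N \<le> snd g j" if "g \<in> Poly_Mapping.keys c'" for g
  proof -
    have "nat (- snd g j) \<le> ?N" by (rule member_le_sum[OF that]) auto
    then show ?thesis by linarith
  qed
  then show ?thesis by blast
qed

text \<open>A relation in the new variables vanishes degree by degree: in
  \<open>exchange_compare\<close> with \<open>c = 0\<close> the binomial cancels, and
  \<open>flip\<close> is injective.\<close>

lemma chart_exchange: "chart \<psi> x'"
  unfolding chart_def
proof (intro conjI allI impI)
  show "character \<psi>" by (rule chart_character[OF ch])
  fix c' assume c': "lin (mon \<psi> x') c' = 0"
  obtain N where N: "\<forall>g\<in>Poly_Mapping.keys c'. - int N \<le> snd g j" using exchange_bound by blast
  show "c' = 0"
  proof (rule ccontr)
    assume "c' \<noteq> 0"
    then obtain h where h: "h \<in> Poly_Mapping.keys c'" using keys_eq_empty[of c'] by blast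
    let ?S = "{g \<in> Poly_Mapping.keys c'. snd g j = snd h j}"
    let ?D = "\<Sum>g\<in>?S. Poly_Mapping.single (flip j g) (Poly_Mapping.lookup c' g)"
    have "binomial_elem u v ^ nat (snd h j + int N) * ?D = binomial_elem u v ^ nat (snd h j + int N) * 0"
      using exchange_compare[of 0 c' N "snd h j"] c' N h by simp
    moreover have "cancellable (binomial_elem u v ^ nat (snd h j + int N))"
      by (intro cancellable_power chart_cancellable[OF ch] binomial_elem_nonzero)
    ultimately have "?D = 0" by (rule cancellableD[rotated])
    then have "0 = Poly_Mapping.lookup ?D (flip j h)" by (simp only: lookup_zero)
    also have "\<dots> = (\<Sum>g\<in>?S. if g = h then Poly_Mapping.lookup c' g else 0)"
      unfolding lookup_sum lookup_single when_def
      by (intro sum.cong refl if_cong) (metis flip_flip)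
    also have "\<dots> = Poly_Mapping.lookup c' h" using h by simp
    finally show False using h by (simp add: in_keys_iff)
  qed
qed

text \<open>In the new variables, degree \<open>- n\<close> in \<open>x j\<close> arises only from
  the power \<open>n\<close> of \<open>P / x j\<close>, which carries \<open>P ^ n\<close>.\<close>

lemma exchange_dvd:
  assumes "lin (mon \<psi> x) c \<in> Laur \<psi> x'"
  shows "binomial_elem u v ^ n dvd restr {g. snd g j = - int n} c"
proof -
  obtain c' where c': "lin (mon \<psi> x) c = lin (mon \<psi> x') c'" using assms unfolding Laur_def by blast
  obtain N where N: "\<forall>g\<in>Poly_Mapping.keys c'. - int N \<le> snd g j" using exchange_bound by blast
  obtain D where "binomial_elem u v ^ N * restr {g. snd g j = - int n} c = binomial_elem u v ^ nat (int n + int N) * D"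
    using exchange_compare[OF c', of N "int n"] N by auto
  moreover have "nat (int n + int N) = N + n" by simp
  ultimately have "binomial_elem u v ^ N * restr {g. snd g j = - int n} c = binomial_elem u v ^ N * (binomial_elem u v ^ n * D)"
    by (simp add: power_add mult.assoc)
  moreover have "cancellable (binomial_elem u v ^ N)"
    by (intro cancellable_power chart_cancellable[OF ch] binomial_elem_nonzero)
  ultimately have "restr {g. snd g j = - int n} c = binomial_elem u v ^ n * D"
    by (rule cancellableD[rotated])
  then show ?thesis by simp
qed

end

section \<open>Upper and lower bounds\<close>

definition pos_exponent :: "('n, 'p, 'k) seed \<Rightarrow> 'n \<Rightarrow> 'p \<times> ('n \<Rightarrow> int)" where
  "pos_exponent S j = (pplus S j, \<lambda>i. max (exch S i j) 0)"

definition neg_exponent :: "('n, 'p, 'k) seed \<Rightarrow> 'n \<Rightarrow> 'p \<times> ('n \<Rightarrow> int)" where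
  "neg_exponent S j = (pminus S j, \<lambda>i. max (- exch S i j) 0)"

text \<open>Exponent of the ratio of the two terms of the exchange polynomial: column
  \<open>j\<close> of the exchange matrix extended by coefficients. Its monomial is the element
  usually called y-hat.\<close>

definition exchange_ratio :: "('n, 'p::ab_group_add, 'k) seed \<Rightarrow> 'n \<Rightarrow> 'p \<times> ('n \<Rightarrow> int)" where
  "exchange_ratio S j = pos_exponent S j - neg_exponent S j"

lemma exchange_ratio_eq: "exchange_ratio S j = (pplus S j - pminus S j, \<lambda>i. exch S i j)"
  by (auto simp: exchange_ratio_def pos_exponent_def neg_exponent_def fun_eq_iff)

definition exchange_elem :: "('p \<Rightarrow> 'k::field) \<Rightarrow> ('n::finite, 'p, 'k) seed \<Rightarrow> 'n \<Rightarrow> 'k" where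
  "exchange_elem \<psi> S j = mon \<psi> (cluster S) (pos_exponent S j) + mon \<psi> (cluster S) (neg_exponent S j)"

definition new_variable :: "('p \<Rightarrow> 'k::field) \<Rightarrow> ('n::finite, 'p, 'k) seed \<Rightarrow> 'n \<Rightarrow> 'k" where
  "new_variable \<psi> S j = exchange_elem \<psi> S j / cluster S j"

definition mutated_cluster :: "('p \<Rightarrow> 'k::field) \<Rightarrow> ('n::finite, 'p, 'k) seed \<Rightarrow> 'n \<Rightarrow> 'n \<Rightarrow> 'k" where
  "mutated_cluster \<psi> S j = (cluster S)(j := new_variable \<psi> S j)"

text \<open>The indices outside \<open>V\<close> play the role of frozen, invertible variables.\<close>

definition upper_bound :: "('p::ab_group_add \<Rightarrow> 'k::field) \<Rightarrow> ('n::finite, 'p, 'k) seed \<Rightarrow> 'n set \<Rightarrow> 'k set" where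
  "upper_bound \<psi> S V = Laur \<psi> (cluster S) \<inter> (\<Inter>j\<in>V. Laur \<psi> (mutated_cluster \<psi> S j))"

definition lower_bound :: "('p::ab_group_add \<Rightarrow> 'k::field) \<Rightarrow> ('n::finite, 'p, 'k) seed \<Rightarrow> 'n set \<Rightarrow> 'k set" where
  "lower_bound \<psi> S V = sub_gen (range \<psi> \<union> range (cluster S) \<union>
     (\<lambda>i. inverse (cluster S i)) ` (- V) \<union> new_variable \<psi> S ` V)"

lemma is_subring_lower_bound: "is_subring (lower_bound \<psi> S V)"
  unfolding lower_bound_def by (rule is_subring_sub_gen)

lemma lower_bound_gens:
  "\<psi> p \<in> lower_bound \<psi> S V" "cluster S i \<in> lower_bound \<psi> S V"
  "i \<notin> V \<Longrightarrow> inverse (cluster S i) \<in> lower_bound \<psi> S V"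
  "j \<in> V \<Longrightarrow> new_variable \<psi> S j \<in> lower_bound \<psi> S V"
  unfolding lower_bound_def by (auto intro: sub_gen.base)

text \<open>The only generator that freezing \<open>i\<close> adds is the inverse of
  \<open>cluster S i\<close>, so a power of that variable clears the denominators.\<close>

lemma lower_bound_localize:
  assumes "i \<in> V" and nz: "cluster S i \<noteq> 0" and "f \<in> lower_bound \<psi> S (V - {i})"
  shows "\<exists>m. cluster S i ^ m * f \<in> lower_bound \<psi> S V"
  using assms(3) unfolding lower_bound_def[of \<psi> S "V - {i}"]
proof (induction rule: sub_gen.induct)
  case (base a)
  note L = is_subring_lower_bound[of \<psi> S V]
  show ?case
  proof (cases "a = inverse (cluster S i)")
    case True
    then have "cluster S i ^ 1 * a = 1" using nz by simp
    then show ?thesis using subring_1[OF L] by metis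
  next
    case False
    then have "cluster S i ^ 0 * a \<in> lower_bound \<psi> S V"
      using base by (auto intro: lower_bound_gens)
    then show ?thesis by blast
  qed
next
  case neg1
  have "cluster S i ^ 0 * (- 1) \<in> lower_bound \<psi> S V"
    using subring_neg1[OF is_subring_lower_bound[of \<psi> S V]] by simp
  then show ?case by blast
next
  case (add a b)
  then obtain m n where mn: "cluster S i ^ m * a \<in> lower_bound \<psi> S V" "cluster S i ^ n * b \<in> lower_bound \<psi> S V"
    by blast
  have "cluster S i ^ (m + n) * (a + b) =
      cluster S i ^ n * (cluster S i ^ m * a) + cluster S i ^ m * (cluster S i ^ n * b)"
    by (simp add: power_add algebra_simps)
  moreover have "\<dots> \<in> lower_bound \<psi> S V"
    using mn lower_bound_gens(2)[of S i \<psi> V] is_subring_lower_bound[of \<psi> S V]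
    by (meson subring_add subring_mult subring_power)
  ultimately show ?case by metis
next
  case (mult a b)
  then obtain m n where mn: "cluster S i ^ m * a \<in> lower_bound \<psi> S V" "cluster S i ^ n * b \<in> lower_bound \<psi> S V"
    by blast
  have "cluster S i ^ (m + n) * (a * b) = (cluster S i ^ m * a) * (cluster S i ^ n * b)"
    by (simp add: power_add algebra_simps)
  moreover have "\<dots> \<in> lower_bound \<psi> S V"
    using mn is_subring_lower_bound[of \<psi> S V] by (meson subring_mult)
  ultimately show ?case by metis
qed

lemma sign_skew_diag: "sign_skew_symmetric B \<Longrightarrow> B i i = 0"
  unfolding sign_skew_symmetric_def by (metis not_square_less_zero)

lemma sign_skew_pos: "sign_skew_symmetric B \<Longrightarrow> B i j > 0 \<longleftrightarrow> B j i < 0"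
  unfolding sign_skew_symmetric_def by (smt (verit) mult_less_0_iff)

lemma sign_skew_zero: "sign_skew_symmetric B \<Longrightarrow> B i j = 0 \<longleftrightarrow> B j i = 0"
  unfolding sign_skew_symmetric_def by (smt (verit) mult_eq_0_iff)

lemma snd_pos_exponent_diag:
  assumes "sign_skew_symmetric (exch S)"
  shows "snd (pos_exponent S j) j = 0" "snd (neg_exponent S j) j = 0"
  by (simp_all add: pos_exponent_def neg_exponent_def sign_skew_diag[OF assms])

context
  fixes \<psi> :: "'p::ab_group_add \<Rightarrow> 'k::field" and S :: "('n::finite, 'p, 'k) seed"
  assumes ch: "chart \<psi> (cluster S)" and skew: "sign_skew_symmetric (exch S)"
begin

lemma mutated_cluster_eq: "mutated_cluster \<psi> S j = (cluster S)(j := (mon \<psi> (cluster S) (pos_exponent S j) + mon \<psi> (cluster S) (neg_exponent S j)) / cluster S j)"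
  by (simp add: mutated_cluster_def new_variable_def exchange_elem_def)

lemma exchange_elem_nz: "exchange_elem \<psi> S j \<noteq> 0"
  using exchange_binomial_nz[OF ch snd_pos_exponent_diag[OF skew]] by (simp add: exchange_elem_def)

lemma chart_mutated_cluster: "chart \<psi> (mutated_cluster \<psi> S j)"
  unfolding mutated_cluster_eq by (rule chart_exchange[OF ch snd_pos_exponent_diag[OF skew]])

lemma cluster_new_variable: "cluster S j * new_variable \<psi> S j = exchange_elem \<psi> S j"
  by (simp add: new_variable_def chart_nz[OF ch])

text \<open>Without edges in \<open>V\<close> the exchange binomials have degree zero in the
  variables of \<open>V\<close>. A component of multidegree \<open>m\<close> is therefore divisible
  by the power \<open>- m j\<close> of each binomial with \<open>m j < 0\<close>, by regularity also
  by their product, and each power combines with the negative power of \<open>cluster S j\<close>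
  into a power of \<open>new_variable \<psi> S j\<close>.\<close>

lemma upper_bound_isolated:
  assumes tf: "torsion_free TYPE('p)" and iso: "\<And>i j. i \<in> V \<Longrightarrow> j \<in> V \<Longrightarrow> exch S i j = 0"
    and odd: "\<And>i j. i \<in> V \<Longrightarrow> j \<in> V \<Longrightarrow> i \<noteq> j \<Longrightarrow> \<not> common_odd_root (exchange_ratio S i) (exchange_ratio S j)"
  shows "upper_bound \<psi> S V \<subseteq> lower_bound \<psi> S V"
proof
  fix f assume f: "f \<in> upper_bound \<psi> S V"
  let ?L = "lin (mon \<psi> (cluster S))" and ?M = "lower_bound \<psi> S V"
  note M = is_subring_lower_bound[of \<psi> S V]
  obtain c where c: "f = ?L c" using f unfolding upper_bound_def Laur_def by blast
  define dg :: "'p \<times> ('n \<Rightarrow> int) \<Rightarrow> 'n \<Rightarrow> int" where "dg g = (\<lambda>i. if i \<in> V then snd g i else 0)" for g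
  define A where "A m = {g. dg g = m}" for m
  define b where "b j = binomial_elem (pos_exponent S j) (neg_exponent S j)" for j
  have dec: "c = (\<Sum>m\<in>dg ` Poly_Mapping.keys c. restr (A m) c)"
    by (rule poly_mapping_eqI) (auto simp: lookup_sum lookup_restr A_def sum.delta in_keys_iff image_iff)
  have hom: "homogen (A m) (b j)" if "j \<in> V" for j m
    unfolding b_def binomial_elem_def using that iso
    by (intro homogen_add homogen_single) (auto simp: A_def dg_def pos_exponent_def neg_exponent_def fun_eq_iff)
  have "?L (restr (A m) c) \<in> ?M" for m
  proof -
    define a where "a j = nat (- m j)" for j
    have "b j ^ a j dvd restr (A m) c" if j: "j \<in> V" for j
    proof (cases "m j < 0")
      case True
      have "f \<in> Laur \<psi> (mutated_cluster \<psi> S j)" using f j by (auto simp: upper_bound_def)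
      then have "b j ^ a j dvd restr {g. snd g j = - int (a j)} c"
        unfolding b_def mutated_cluster_eq c using exchange_dvd[OF ch snd_pos_exponent_diag[OF skew]] by blast
      then obtain d where d: "restr {g. snd g j = - int (a j)} c = b j ^ a j * d" by blast
      have "A m \<subseteq> {g. snd g j = - int (a j)}" using True j by (auto simp: A_def dg_def a_def)
      then have "restr (A m) c = restr (A m) (restr {g. snd g j = - int (a j)} c)"
        by (simp add: restr_restr Int_absorb2)
      also have "\<dots> = b j ^ a j * restr (A m) d"
        using homogen_power[OF hom[OF j]] unfolding d homogen_def by blast
      finally show ?thesis by simp
    qed (simp add: a_def)
    moreover have "regular_pair (b i ^ a i) (b j ^ a j)" if "i \<in> V" "j \<in> V" "i \<noteq> j" for i j
      unfolding b_def using odd[OF that] unfolding exchange_ratio_def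
      by (intro regular_pair_power regular_pair_binomial_elem[OF ch tf] chart_cancellable[OF ch binomial_elem_nonzero]) auto
    ultimately have "(\<Prod>j\<in>V. b j ^ a j) dvd restr (A m) c"
      by (intro prod_dvd_of_regular_pair) auto
    then obtain d where d: "restr (A m) c = (\<Prod>j\<in>V. b j ^ a j) * d" by blast
    \<comment> \<open>Projecting the cofactor too makes all its terms have multidegree
      \<open>m\<close>, so that the powers of the exchange polynomials match the negative exponents
      exactly.\<close>
    have "homogen (A m) (\<Prod>j\<in>V. b j ^ a j)" by (intro homogen_prod homogen_power hom)
    then have "restr (A m) (restr (A m) c) = (\<Prod>j\<in>V. b j ^ a j) * restr (A m) d"
      unfolding d homogen_def by blast
    then have "restr (A m) c = (\<Prod>j\<in>V. b j ^ a j) * restr (A m) d"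
      by (simp add: restr_restr)
    then have "?L (restr (A m) c) = (\<Prod>j\<in>V. exchange_elem \<psi> S j ^ a j) * ?L (restr (A m) d)"
      by (simp add: chart_simps[OF ch] b_def exchange_elem_def binomial_elem_def lin_add)
    also have "\<dots> = lin (\<lambda>g. (\<Prod>j\<in>V. exchange_elem \<psi> S j ^ a j) * mon \<psi> (cluster S) g) (restr (A m) d)"
      by (simp add: lin_mult_fun)
    also have "\<dots> \<in> ?M"
    proof (rule subring_lin[OF M])
      fix g assume "g \<in> Poly_Mapping.keys (restr (A m) d)"
      then have g: "snd g i = m i" if "i \<in> V" for i
        using that by (auto simp: keys_restr A_def dg_def)
      let ?h = "\<lambda>i. (if i \<in> V then exchange_elem \<psi> S i ^ a i else 1) * cluster S i powi snd g i"
      have "(\<Prod>j\<in>V. exchange_elem \<psi> S j ^ a j) = (\<Prod>i\<in>UNIV. if i \<in> V then exchange_elem \<psi> S i ^ a i else 1)"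
        using prod.inter_restrict[of UNIV "\<lambda>i. exchange_elem \<psi> S i ^ a i" V] by simp
      then have "(\<Prod>j\<in>V. exchange_elem \<psi> S j ^ a j) * mon \<psi> (cluster S) g = \<psi> (fst g) * (\<Prod>i\<in>UNIV. ?h i)"
        by (simp add: mon_def prod.distrib mult.left_commute)
      moreover have hM: "?h i \<in> ?M" for i
      proof (cases "i \<in> V \<and> snd g i < 0")
        case True
        then have "?h i = new_variable \<psi> S i ^ a i"
          using g[of i] by (simp add: a_def new_variable_def power_int_def power_mult_distrib divide_inverse power_inverse)
        then show ?thesis using True by (simp add: subring_power[OF M] lower_bound_gens)
      next
        case False
        have "?h i = cluster S i powi snd g i" using False g[of i] by (auto simp: a_def)
        moreover have "\<dots> \<in> ?M"
          unfolding power_int_def using False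
          by (auto intro!: subring_power[OF M] lower_bound_gens)
        ultimately show ?thesis by (simp only:)
      qed
      ultimately show "(\<Prod>j\<in>V. exchange_elem \<psi> S j ^ a j) * mon \<psi> (cluster S) g \<in> ?M"
        by (simp only: subring_mult[OF M lower_bound_gens(1) subring_prod[OF M hM]])
    qed
    finally show ?thesis .
  qed
  then have "(\<Sum>m\<in>dg ` Poly_Mapping.keys c. ?L (restr (A m) c)) \<in> ?M"
    by (intro subring_sum[OF M])
  then show "f \<in> ?M" unfolding c by (subst dec) (simp add: lin_sum)
qed

theorem upper_bound_subset_lower_bound:
  assumes tf: "torsion_free TYPE('p)" and "acyclic {(i, j). i \<in> V \<and> j \<in> V \<and> exch S i j > 0}"
    and "\<And>i j. i \<in> V \<Longrightarrow> j \<in> V \<Longrightarrow> i \<noteq> j \<Longrightarrow> exch S i j = 0 \<Longrightarrow> \<not> common_odd_root (exchange_ratio S i) (exchange_ratio S j)"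
  shows "upper_bound \<psi> S V \<subseteq> lower_bound \<psi> S V"
  using assms(2,3)
proof (induction "card V" arbitrary: V rule: less_induct)
  case less
  let ?E = "{(i, j). i \<in> V \<and> j \<in> V \<and> exch S i j > 0}"
  let ?M = "lower_bound \<psi> S V"
  note M = is_subring_lower_bound[of \<psi> S V]
  show ?case
  proof (cases "\<exists>i\<in>V. \<exists>j\<in>V. exch S i j > 0")
    case False
    then have "exch S i j = 0" if "i \<in> V" "j \<in> V" for i j
      using that sign_skew_pos[OF skew, of j i] by (meson linorder_neqE)
    then show ?thesis using less.prems(2) by (intro upper_bound_isolated[OF tf]) auto
  next
    case True
    \<comment> \<open>A vertex minimal for the converse relation among those with an incoming edge
      is a sink: a successor would have an incoming edge as well, the one from this vertex.\<close>
    have "wf (?E\<inverse>)" by (intro finite_acyclic_wf_converse less.prems(1)) simp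
    moreover obtain y where "y \<in> {j \<in> V. \<exists>i\<in>V. exch S i j > 0}" using True by blast
    ultimately obtain z where z: "z \<in> {j \<in> V. \<exists>i\<in>V. exch S i j > 0}"
      and zmin: "\<And>y. (y, z) \<in> ?E\<inverse> \<Longrightarrow> y \<notin> {j \<in> V. \<exists>i\<in>V. exch S i j > 0}"
      by (rule wfE_min) blast
    obtain i where i: "i \<in> V" "exch S i z > 0" and zV: "z \<in> V" using z by blast
    have out: "exch S l z \<ge> 0" if "l \<in> V" for l
    proof (rule ccontr)
      assume "\<not> ?thesis"
      then have "exch S z l > 0" using sign_skew_pos[OF skew, of z l] by simp
      then show False using zmin[of l] that zV by auto
    qed
    \<comment> \<open>Freezing \<open>k\<close> removes one condition, so the upper bound can only
      grow.\<close>
    have IH: "upper_bound \<psi> S V \<subseteq> lower_bound \<psi> S (V - {k})" if k: "k \<in> V" for k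
    proof -
      have "card (V - {k}) < card V" using k by (intro psubset_card_mono) auto
      moreover have "acyclic {(i, j). i \<in> V - {k} \<and> j \<in> V - {k} \<and> exch S i j > 0}"
        by (rule acyclic_subset[OF less.prems(1)]) auto
      ultimately have "upper_bound \<psi> S (V - {k}) \<subseteq> lower_bound \<psi> S (V - {k})"
        using less.prems(2) by (intro less.hyps) auto
      then show ?thesis by (auto simp: upper_bound_def)
    qed
    let ?x = "cluster S" and ?B = "mon \<psi> (cluster S) (neg_exponent S z)"
    let ?A = "mon \<psi> (cluster S) (pos_exponent S z - (0, unit_vec i))"
    note char = chart_character[OF ch] and nz = chart_nz[OF ch]
    have A: "?A \<in> ?M"
      by (rule mon_mem[OF M]) (use i in \<open>auto simp: pos_exponent_def unit_vec_def lower_bound_gens split: if_splits\<close>)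
    \<comment> \<open>Because \<open>z\<close> is a sink in \<open>V\<close>, its negative term
      involves frozen variables only and is a unit of the lower bound.\<close>
    have B: "inverse ?B \<in> ?M"
    proof -
      have "mon \<psi> ?x (- neg_exponent S z) \<in> ?M"
      proof (rule mon_mem[OF M])
        fix l assume "snd (- neg_exponent S z) l < 0"
        then have "l \<notin> V" using out[of l] by (auto simp: neg_exponent_def)
        then show "inverse (?x l) \<in> ?M" by (rule lower_bound_gens)
      qed (auto simp: lower_bound_gens)
      then show ?thesis by (simp add: character_minus[OF chart_mon_character[OF ch]])
    qed
    have Bnz: "?B \<noteq> 0" by (rule character_nonzero[OF chart_mon_character[OF ch]])
    have "mon \<psi> ?x (pos_exponent S z) = ?A * ?x i"
      using mon_add[OF char nz, where a = "pos_exponent S z - (0, unit_vec i)" and b = "(0, unit_vec i)"] mon_unit[OF char, of ?x i] by simp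
    then have "?x z * new_variable \<psi> S z = ?A * ?x i + ?B" by (simp add: cluster_new_variable exchange_elem_def)
    \<comment> \<open>The exchange relation at \<open>z\<close>, divided by
      \<open>?B\<close>.\<close>
    then have unit: "(new_variable \<psi> S z * inverse ?B) * ?x z + (- (?A * inverse ?B)) * ?x i = 1"
      using Bnz by (simp add: field_simps)
    show ?thesis
    proof
      fix f assume f: "f \<in> upper_bound \<psi> S V"
      obtain m where m: "?x z ^ m * f \<in> ?M"
        using lower_bound_localize[OF zV nz] IH[OF zV] f by blast
      obtain n where n: "?x i ^ n * f \<in> ?M"
        using lower_bound_localize[OF i(1) nz] IH[OF i(1)] f by blast
      show "f \<in> ?M"
        by (rule subring_unit_ideal_descent[OF M _ _ _ _ unit m n])
          (use A B zV in \<open>auto intro!: subring_mult[OF M] subring_uminus[OF M] lower_bound_gens\<close>)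
    qed
  qed
qed

text \<open>Turns containments of upper bounds into Laurent expansions of cluster variables.\<close>

lemma cluster_in_upper_bound: "cluster S i \<in> upper_bound \<psi> S UNIV"
proof -
  note char = chart_character[OF ch] and nz = chart_nz[OF ch]
  have "cluster S i \<in> Laur \<psi> (mutated_cluster \<psi> S j)" for j
  proof -
    have nzj: "mutated_cluster \<psi> S j l \<noteq> 0" for l by (rule chart_nz[OF chart_mutated_cluster])
    note M = is_subring_Laur[where x = "mutated_cluster \<psi> S j", OF char nzj]
    note in' = var_in_Laur[where x = "mutated_cluster \<psi> S j", OF char nzj] inverse_var_in_Laur[where x = "mutated_cluster \<psi> S j", OF char nzj] coeff_in_Laur[where x = "mutated_cluster \<psi> S j", OF char nzj]
    show ?thesis
    proof (cases "i = j")
      case False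
      then show ?thesis using in'(1)[of i] by (simp add: mutated_cluster_def)
    next
      case True
      have "cluster S l \<in> Laur \<psi> (mutated_cluster \<psi> S j)" if "exch S l j \<noteq> 0" for l
        using in'(1)[of l] that sign_skew_diag[OF skew, of j] by (cases "l = j") (auto simp: mutated_cluster_def)
      then have "exchange_elem \<psi> S j \<in> Laur \<psi> (mutated_cluster \<psi> S j)"
        unfolding exchange_elem_def
        by (intro subring_add[OF M] mon_mem[OF M] in'(3)) (auto simp: pos_exponent_def neg_exponent_def less_max_iff_disj)
      moreover have "inverse (new_variable \<psi> S j) \<in> Laur \<psi> (mutated_cluster \<psi> S j)"
        using in'(2)[of j] by (simp add: mutated_cluster_def)
      ultimately have "exchange_elem \<psi> S j * inverse (new_variable \<psi> S j) \<in> Laur \<psi> (mutated_cluster \<psi> S j)"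
        by (rule subring_mult[OF M])
      then show ?thesis using True exchange_elem_nz[of j] by (simp add: new_variable_def)
    qed
  qed
  then show ?thesis using var_in_Laur[OF char nz] by (auto simp: upper_bound_def)
qed

end

section \<open>Mutation\<close>

text \<open>Mutation for an arbitrary coefficient character, without the demand that both ends be
  seeds in the ambient field; this makes it available for generic seeds. The two sign cases agree
  when the entry is 0.\<close>

definition mutates :: "('p::ab_group_add \<Rightarrow> 'k::field) \<Rightarrow> 'n \<Rightarrow> ('n::finite, 'p, 'k) seed \<Rightarrow> ('n, 'p, 'k) seed \<Rightarrow> bool" where
  "mutates \<psi> k S S' \<longleftrightarrow> cluster S' = mutated_cluster \<psi> S k \<and> exch S' = matrix_mutation k (exch S) \<and>
     pplus S' k = pminus S k \<and> pminus S' k = pplus S k \<and>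
     (\<forall>i. i \<noteq> k \<longrightarrow> pplus S' i - pminus S' i =
        zmul (exch S k i) (if exch S k i \<ge> 0 then pplus S k else pminus S k) + (pplus S i - pminus S i))"

text \<open>In this form column \<open>j\<close> receives \<open>B k j\<close> times the exponent
  vector of one of the two terms of the exchange polynomial at \<open>k\<close>, which is also the
  shape of the coefficient rule.\<close>

lemma matrix_mutation_alt:
  "matrix_mutation k B i j = (if i = k \<or> j = k then - B i j
     else B i j + (if B k j \<ge> 0 then max (B i k) 0 else max (- B i k) 0) * B k j)"
proof -
  have "\<bar>a\<bar> * b + a * \<bar>b\<bar> = 2 * ((if b \<ge> 0 then max a 0 else max (- a) 0) * b)" for a b :: int
    by (auto simp: abs_if max_def)
  then show ?thesis by (simp add: matrix_mutation_def)
qed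

lemma mon_update_zero: "snd g k = 0 \<Longrightarrow> mon \<psi> (x(k := y)) g = mon \<psi> x g"
  unfolding mon_def by (rule arg_cong[where f = "(*) _"], rule prod.cong) auto

text \<open>Modulo \<open>y\<close> the powers of \<open>Pk\<close> and \<open>A\<close> agree, so
  \<open>1 + W\<close> and \<open>1 + W'\<close> are divisible by \<open>y\<close> together, up to
  factors that stay in \<open>M\<close>.\<close>

lemma exchange_core:
  fixes M :: "'k::field set"
  assumes M: "is_subring M" and "Pk ^ n = A ^ n + y * r" "r \<in> M" "y \<noteq> 0" "A \<noteq> 0" "Pk \<noteq> 0" "V' \<noteq> 0"
    and W': "W' = W * (A / Pk) ^ n" and "V \<in> M" "inverse A \<in> M" "Pk \<in> M" "inverse V' \<in> M"
    and x: "V' * (1 + W') / y \<in> M"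
  shows "V * (1 + W) / y \<in> M"
proof -
  have "W' * Pk ^ n = W * A ^ n" unfolding W' using \<open>Pk \<noteq> 0\<close> by (simp add: power_divide)
  then have eq: "A ^ n * (1 + W) = Pk ^ n * (1 + W') - y * r"
    using \<open>Pk ^ n = A ^ n + y * r\<close> by (simp add: algebra_simps)
  have "V * (1 + W) / y = V * (inverse A ^ n * (A ^ n * (1 + W))) / y"
    using \<open>A \<noteq> 0\<close> by (simp add: power_inverse)
  also have "\<dots> = V * inverse A ^ n * (Pk ^ n * (inverse V' * (V' * (1 + W') / y)) - r)"
    unfolding eq using \<open>y \<noteq> 0\<close> \<open>V' \<noteq> 0\<close> \<open>A \<noteq> 0\<close> by (simp add: field_simps)
  finally have "V * (1 + W) / y = V * inverse A ^ n * (Pk ^ n * (inverse V' * (V' * (1 + W') / y)) - r)" .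
  then show ?thesis
    using x \<open>r \<in> M\<close> \<open>V \<in> M\<close> \<open>inverse A \<in> M\<close> \<open>Pk \<in> M\<close> \<open>inverse V' \<in> M\<close>
    by (simp only: subring_mult[OF M] subring_diff[OF M] subring_power[OF M])
qed

section \<open>Effect of one mutation on exchange ratios and upper bounds\<close>

context
  fixes \<psi> :: "'p::ab_group_add \<Rightarrow> 'k::field" and S S' :: "('n::finite, 'p, 'k) seed" and k :: 'n
  assumes ch: "chart \<psi> (cluster S)" and skew: "sign_skew_symmetric (exch S)" and mut: "mutates \<psi> k S S'"
begin

lemma coeff_character: "character \<psi>"
  by (rule chart_character[OF ch])

lemma cluster_nonzero: "cluster S i \<noteq> 0"
  by (rule chart_nz[OF ch])

lemma cluster_mutated: "cluster S' = mutated_cluster \<psi> S k"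
  using mut by (simp add: mutates_def)

lemma cluster_mutated_other: "i \<noteq> k \<Longrightarrow> cluster S' i = cluster S i"
  by (simp add: cluster_mutated mutated_cluster_def)

lemma cluster_mutated_same: "cluster S' k = new_variable \<psi> S k"
  by (simp add: cluster_mutated mutated_cluster_def)

lemma chart_mutated: "chart \<psi> (cluster S')"
  unfolding cluster_mutated by (rule chart_mutated_cluster[OF ch skew])

lemma exch_mutated: "exch S' i j = (if i = k \<or> j = k then - exch S i j
     else exch S i j + (if exch S k j \<ge> 0 then max (exch S i k) 0 else max (- exch S i k) 0) * exch S k j)"
  using mut by (simp add: mutates_def matrix_mutation_alt)

lemma exch_diag: "exch S i i = 0"
  by (rule sign_skew_diag[OF skew])

lemma pos_exponent_mutated_same: "pos_exponent S' k = neg_exponent S k" "neg_exponent S' k = pos_exponent S k"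
  using mut by (auto simp: mutates_def pos_exponent_def neg_exponent_def matrix_mutation_alt fun_eq_iff)

lemma exchange_elem_mutated_same: "exchange_elem \<psi> S' k = exchange_elem \<psi> S k"
  using snd_pos_exponent_diag[OF skew, of k]
  by (simp add: exchange_elem_def pos_exponent_mutated_same cluster_mutated mutated_cluster_def mon_update_zero)

lemma mutated_cluster_mutated_same: "mutated_cluster \<psi> S' k = cluster S"
  using exchange_elem_nz[OF ch skew, of k] cluster_nonzero[of k]
  by (auto simp: mutated_cluster_def new_variable_def exchange_elem_mutated_same cluster_mutated fun_eq_iff)

lemma exchange_ratio_mutated_same: "exchange_ratio S' k = - exchange_ratio S k"
  by (simp add: exchange_ratio_def pos_exponent_mutated_same)

lemma fst_exchange_ratio_mutated: "j \<noteq> k \<Longrightarrow> fst (exchange_ratio S' j) =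
    fst (exchange_ratio S j) + zmul (exch S k j) (fst (if exch S k j \<ge> 0 then pos_exponent S k else neg_exponent S k))"
  using mut by (auto simp: mutates_def exchange_ratio_eq pos_exponent_def neg_exponent_def)

text \<open>Coefficients and matrix entries both gain a multiple of the same exponent vector. Entry
  \<open>k\<close> of the column changes sign instead, which accounts for subtracting twice the
  multiple of \<open>unit_vec k\<close>.\<close>

lemma exchange_ratio_mutated:
  assumes "j \<noteq> k"
  shows "exchange_ratio S' j = exchange_ratio S j + zmul (exch S k j) (if exch S k j \<ge> 0 then pos_exponent S k else neg_exponent S k)
    - zmul (2 * exch S k j) (0, unit_vec k)"
proof (rule prod_eqI)
  show "fst (exchange_ratio S' j) = fst (exchange_ratio S j + zmul (exch S k j) (if exch S k j \<ge> 0 then pos_exponent S k else neg_exponent S k)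
    - zmul (2 * exch S k j) (0, unit_vec k))"
    using fst_exchange_ratio_mutated[OF assms] by (simp add: fst_zmul)
  show "snd (exchange_ratio S' j) = snd (exchange_ratio S j + zmul (exch S k j) (if exch S k j \<ge> 0 then pos_exponent S k else neg_exponent S k)
    - zmul (2 * exch S k j) (0, unit_vec k))"
    using assms
    by (auto simp: fun_eq_iff exchange_ratio_eq exch_mutated snd_zmul zmul_apply pos_exponent_def neg_exponent_def unit_vec_def exch_diag)
qed

lemma flip_exchange_ratio_mutated:
  assumes "j \<noteq> k"
  shows "flip k (exchange_ratio S' j) = exchange_ratio S j + zmul (exch S k j) (if exch S k j \<ge> 0 then pos_exponent S k else neg_exponent S k)"
  by (subst exchange_ratio_mutated[OF assms], rule prod_eqI)
    (auto simp: flip_def fun_eq_iff exchange_ratio_eq snd_zmul zmul_apply pos_exponent_def neg_exponent_def unit_vec_def exch_diag fst_zmul)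

text \<open>The mutation rule for the y-hat elements. The denominator comes from
  \<open>mon_exchange\<close>, as the new ratio has exponent \<open>- exch S k j\<close> in the
  exchanged variable.\<close>

lemma mon_exchange_ratio_mutated:
  assumes "j \<noteq> k"
  shows "mon \<psi> (cluster S') (exchange_ratio S' j) = mon \<psi> (cluster S) (exchange_ratio S j) *
    (mon \<psi> (cluster S) (if exch S k j \<ge> 0 then pos_exponent S k else neg_exponent S k) / exchange_elem \<psi> S k) powi exch S k j"
proof -
  have "mon \<psi> (cluster S') (exchange_ratio S' j) = mon \<psi> (cluster S) (flip k (exchange_ratio S' j)) *
      exchange_elem \<psi> S k powi (snd (exchange_ratio S' j) k)"
    using mon_exchange[OF ch snd_pos_exponent_diag[OF skew, of k], of "exchange_ratio S' j"]
    by (simp add: cluster_mutated mutated_cluster_def new_variable_def exchange_elem_def)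
  also have "snd (exchange_ratio S' j) k = - exch S k j" by (simp add: exchange_ratio_eq exch_mutated)
  finally show ?thesis
    by (simp add: flip_exchange_ratio_mutated[OF assms] mon_add[OF coeff_character cluster_nonzero] character_zmul[OF chart_mon_character[OF ch]]
        power_int_mult_distrib power_int_inverse power_int_minus divide_inverse)
qed

text \<open>The target cluster arises from \<open>S\<close> by mutating at \<open>k\<close> and then
  at \<open>j\<close>, and the hard generator is \<open>new_variable \<psi> S j\<close>. If
  \<open>exch S k j \<noteq> 0\<close>, the exchange polynomial at \<open>k\<close> reduces to a
  single monomial modulo \<open>cluster S j\<close>, so \<open>exchange_core\<close> carries
  divisibility by \<open>cluster S j\<close> of the exchange polynomial at \<open>j\<close> from
  \<open>S'\<close> back to \<open>S\<close>.\<close>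

lemma lower_bound_subset_Laur:
  assumes jk: "j \<noteq> k" and skew': "sign_skew_symmetric (exch S')"
  shows "lower_bound \<psi> S {k, j} \<subseteq> Laur \<psi> (mutated_cluster \<psi> S' j)"
proof -
  let ?M = "Laur \<psi> (mutated_cluster \<psi> S' j)" and ?x = "cluster S" and ?x' = "cluster S'"
  have ch'': "chart \<psi> (mutated_cluster \<psi> S' j)" by (rule chart_mutated_cluster[OF chart_mutated skew'])
  have nz'': "mutated_cluster \<psi> S' j i \<noteq> 0" for i by (rule chart_nz[OF ch''])
  note M = is_subring_Laur[where x = "mutated_cluster \<psi> S' j", OF coeff_character nz''] and in'' = var_in_Laur[where x = "mutated_cluster \<psi> S' j", OF coeff_character nz''] inverse_var_in_Laur[where x = "mutated_cluster \<psi> S' j", OF coeff_character nz'']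
  have coeff: "\<psi> p \<in> ?M" for p by (rule coeff_in_Laur[where x = "mutated_cluster \<psi> S' j", OF coeff_character nz''])
  have x': "?x' i \<in> ?M" "inverse (?x' i) \<in> ?M" if "i \<noteq> j" for i
    using in''[of i] that by (auto simp: mutated_cluster_def)
  have newj: "new_variable \<psi> S' j \<in> ?M" "inverse (new_variable \<psi> S' j) \<in> ?M"
    using in''[of j] by (auto simp: mutated_cluster_def)
  have mon': "mon \<psi> ?x' g \<in> ?M" if "snd g j = 0" for g
    using that by (intro mon_mem[OF M]) (auto intro: coeff x')
  have "exchange_elem \<psi> S' j \<in> ?M"
    unfolding exchange_elem_def using snd_pos_exponent_diag[OF skew', of j] by (intro subring_add[OF M] mon')
  moreover have "exchange_elem \<psi> S' j \<noteq> 0" by (rule exchange_elem_nz[OF chart_mutated skew'])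
  ultimately have "?x' j \<in> ?M"
    using subring_mult[OF M _ newj(2), of "exchange_elem \<psi> S' j"] by (simp add: new_variable_def)
  then have xj: "?x j \<in> ?M" using cluster_mutated_other[OF jk] by simp
  have mon: "mon \<psi> ?x g \<in> ?M" if "snd g k = 0" "snd g j \<ge> 0" for g
  proof (rule mon_mem[OF M coeff])
    fix i assume "snd g i > 0"
    then show "?x i \<in> ?M" using that xj x'(1)[of i] cluster_mutated_other[of i] by (cases "i = j"; cases "i = k") auto
  next
    fix i assume "snd g i < 0"
    then show "inverse (?x i) \<in> ?M" using that x'(2)[of i] cluster_mutated_other[of i] by (cases "i = j"; cases "i = k") auto
  qed
  have mon_nz: "mon \<psi> ?x g \<noteq> 0" "mon \<psi> ?x' g \<noteq> 0" for g
    using character_nonzero[OF chart_mon_character[OF ch]] character_nonzero[OF chart_mon_character[OF chart_mutated]] by auto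
  have inv_mon: "inverse (mon \<psi> ?x g) = mon \<psi> ?x (- g)" "inverse (mon \<psi> ?x' g) = mon \<psi> ?x' (- g)" for g
    using character_minus[OF chart_mon_character[OF ch]] character_minus[OF chart_mon_character[OF chart_mutated]] by auto
  have Pk: "exchange_elem \<psi> S k \<in> ?M"
    unfolding exchange_elem_def by (intro subring_add[OF M] mon) (auto simp: pos_exponent_def neg_exponent_def exch_diag)
  have Pk_nz: "exchange_elem \<psi> S k \<noteq> 0" by (rule exchange_elem_nz[OF ch skew])
  have "inverse (new_variable \<psi> S k) \<in> ?M" using x'(2)[of k] jk cluster_mutated_same by auto
  then have "exchange_elem \<psi> S k * inverse (new_variable \<psi> S k) \<in> ?M" by (rule subring_mult[OF M Pk])
  then have xk: "?x k \<in> ?M" using Pk_nz by (simp add: new_variable_def)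
  have split: "exchange_elem \<psi> T l = mon \<psi> (cluster T) (neg_exponent T l) * (1 + mon \<psi> (cluster T) (exchange_ratio T l))"
    "exchange_elem \<psi> T l = mon \<psi> (cluster T) (pos_exponent T l) * (1 + inverse (mon \<psi> (cluster T) (exchange_ratio T l)))"
    if "chart \<psi> (cluster T)" for T and l :: 'n
  proof -
    have *: "mon \<psi> (cluster T) (exchange_ratio T l) = mon \<psi> (cluster T) (pos_exponent T l) / mon \<psi> (cluster T) (neg_exponent T l)"
      unfolding exchange_ratio_def by (rule character_diff[OF chart_mon_character[OF that]])
    have **: "mon \<psi> (cluster T) g \<noteq> 0" for g
      by (rule character_nonzero[OF chart_mon_character[OF that]])
    show "exchange_elem \<psi> T l = mon \<psi> (cluster T) (neg_exponent T l) * (1 + mon \<psi> (cluster T) (exchange_ratio T l))"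
      "exchange_elem \<psi> T l = mon \<psi> (cluster T) (pos_exponent T l) * (1 + inverse (mon \<psi> (cluster T) (exchange_ratio T l)))"
      using ** by (auto simp: * exchange_elem_def field_simps)
  qed
  have diag': "exch S' j j = 0" by (rule sign_skew_diag[OF skew'])
  have y': "?x' j = ?x j" by (rule cluster_mutated_other[OF jk])
  have "new_variable \<psi> S j \<in> ?M"
  proof (cases "exch S k j \<ge> 0")
    case True
    define n where "n = nat (exch S k j)"
    have jk_neg: "exch S j k \<le> 0" using True sign_skew_pos[OF skew, of j k] by linarith
    \<comment> \<open>For a positive entry \<open>exch S k j\<close>, the variable
      \<open>cluster S j\<close> divides the negative term at \<open>k\<close>; for entry 0 the
      exponent \<open>n\<close> is 0.\<close>
    have "\<exists>r\<in>?M. exchange_elem \<psi> S k ^ n = mon \<psi> ?x (pos_exponent S k) ^ n + ?x j * r"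
    proof (cases "exch S k j = 0")
      case True
      then show ?thesis using subring_0[OF M] by (auto simp: n_def)
    next
      case False
      then have neg: "exch S j k < 0" using sign_skew_pos[OF skew, of k j] True by linarith
      have D': "mon \<psi> ?x (neg_exponent S k - (0, unit_vec j)) \<in> ?M"
        using neg jk by (intro mon) (auto simp: neg_exponent_def exch_diag)
      have "mon \<psi> ?x (neg_exponent S k) = ?x j * mon \<psi> ?x (neg_exponent S k - (0, unit_vec j))"
        using mon_add[OF coeff_character cluster_nonzero, where a = "(0, unit_vec j)" and b = "neg_exponent S k - (0, unit_vec j)"]
          mon_unit[OF coeff_character, of ?x j] by simp
      note eq = this
      obtain r where r: "r \<in> ?M" "(mon \<psi> ?x (pos_exponent S k) + mon \<psi> ?x (neg_exponent S k)) ^ n =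
          mon \<psi> ?x (pos_exponent S k) ^ n + mon \<psi> ?x (neg_exponent S k) * r"
        using subring_power_add_diff[OF M mon mon, of "pos_exponent S k" "neg_exponent S k" n]
        by (auto simp: pos_exponent_def neg_exponent_def exch_diag)
      have "exchange_elem \<psi> S k ^ n = mon \<psi> ?x (pos_exponent S k) ^ n + ?x j * (mon \<psi> ?x (neg_exponent S k - (0, unit_vec j)) * r)"
        unfolding exchange_elem_def r(2) mult.assoc[symmetric] eq[symmetric] ..
      then show ?thesis using subring_mult[OF M D' r(1)] by blast
    qed
    then obtain r where r: "r \<in> ?M" "exchange_elem \<psi> S k ^ n = mon \<psi> ?x (pos_exponent S k) ^ n + ?x j * r" by blast
    have "mon \<psi> ?x (neg_exponent S j) * (1 + mon \<psi> ?x (exchange_ratio S j)) / ?x j \<in> ?M"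
    proof (rule exchange_core[OF M r(2,1), of "mon \<psi> ?x' (neg_exponent S' j)" "mon \<psi> ?x' (exchange_ratio S' j)"])
      show "mon \<psi> ?x' (exchange_ratio S' j) = mon \<psi> ?x (exchange_ratio S j) * (mon \<psi> ?x (pos_exponent S k) / exchange_elem \<psi> S k) ^ n"
        using mon_exchange_ratio_mutated[OF jk] True by (simp add: n_def power_int_def)
      show "mon \<psi> ?x (neg_exponent S j) \<in> ?M" using True by (intro mon) (auto simp: neg_exponent_def exch_diag)
      show "inverse (mon \<psi> ?x (pos_exponent S k)) \<in> ?M"
        unfolding inv_mon using jk_neg by (intro mon) (auto simp: pos_exponent_def exch_diag)
      show "inverse (mon \<psi> ?x' (neg_exponent S' j)) \<in> ?M"
        unfolding inv_mon by (intro mon') (auto simp: neg_exponent_def diag')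
      show "mon \<psi> ?x' (neg_exponent S' j) * (1 + mon \<psi> ?x' (exchange_ratio S' j)) / ?x j \<in> ?M"
        using newj(1) unfolding new_variable_def split(1)[OF chart_mutated] y' .
    qed (use cluster_nonzero Pk_nz mon_nz Pk in auto)
    then show ?thesis unfolding new_variable_def split(1)[OF ch] .
  next
    case False
    \<comment> \<open>Here \<open>cluster S j\<close> divides the positive term at \<open>k\<close>.
      Inverse ratios are used, so that the exponent in \<open>exchange_core\<close> is again a
      natural number.\<close>
    define n where "n = nat (- exch S k j)"
    have jk_pos: "exch S j k > 0" using False sign_skew_pos[OF skew, of j k] by linarith
    have D': "mon \<psi> ?x (pos_exponent S k - (0, unit_vec j)) \<in> ?M"
      using jk_pos jk by (intro mon) (auto simp: pos_exponent_def exch_diag)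
    have "mon \<psi> ?x (pos_exponent S k) = ?x j * mon \<psi> ?x (pos_exponent S k - (0, unit_vec j))"
      using mon_add[OF coeff_character cluster_nonzero, where a = "(0, unit_vec j)" and b = "pos_exponent S k - (0, unit_vec j)"]
        mon_unit[OF coeff_character, of ?x j] by simp
    note eq = this
    obtain r0 where r0: "r0 \<in> ?M" "(mon \<psi> ?x (neg_exponent S k) + mon \<psi> ?x (pos_exponent S k)) ^ n =
        mon \<psi> ?x (neg_exponent S k) ^ n + mon \<psi> ?x (pos_exponent S k) * r0"
      using subring_power_add_diff[OF M mon mon, of "neg_exponent S k" "pos_exponent S k" n]
      by (auto simp: pos_exponent_def neg_exponent_def exch_diag)
    have "exchange_elem \<psi> S k ^ n = mon \<psi> ?x (neg_exponent S k) ^ n + ?x j * (mon \<psi> ?x (pos_exponent S k - (0, unit_vec j)) * r0)"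
      unfolding exchange_elem_def add.commute[of "mon \<psi> ?x (pos_exponent S k)"] r0(2) mult.assoc[symmetric] eq[symmetric] ..
    then obtain r where r: "r \<in> ?M" "exchange_elem \<psi> S k ^ n = mon \<psi> ?x (neg_exponent S k) ^ n + ?x j * r"
      using subring_mult[OF M D' r0(1)] by blast
    have "mon \<psi> ?x (pos_exponent S j) * (1 + inverse (mon \<psi> ?x (exchange_ratio S j))) / ?x j \<in> ?M"
    proof (rule exchange_core[OF M r(2,1), of "mon \<psi> ?x' (pos_exponent S' j)" "inverse (mon \<psi> ?x' (exchange_ratio S' j))"])
      have "mon \<psi> ?x' (exchange_ratio S' j) = mon \<psi> ?x (exchange_ratio S j) * (mon \<psi> ?x (neg_exponent S k) / exchange_elem \<psi> S k) powi (- int n)"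
        using mon_exchange_ratio_mutated[OF jk] False by (simp add: n_def)
      then show "inverse (mon \<psi> ?x' (exchange_ratio S' j)) = inverse (mon \<psi> ?x (exchange_ratio S j)) * (mon \<psi> ?x (neg_exponent S k) / exchange_elem \<psi> S k) ^ n"
        by (simp add: power_int_minus)
      show "mon \<psi> ?x (pos_exponent S j) \<in> ?M" using False by (intro mon) (auto simp: pos_exponent_def exch_diag)
      show "inverse (mon \<psi> ?x (neg_exponent S k)) \<in> ?M"
        unfolding inv_mon using jk_pos by (intro mon) (auto simp: neg_exponent_def exch_diag)
      show "inverse (mon \<psi> ?x' (pos_exponent S' j)) \<in> ?M"
        unfolding inv_mon by (intro mon') (auto simp: pos_exponent_def diag')
      show "mon \<psi> ?x' (pos_exponent S' j) * (1 + inverse (mon \<psi> ?x' (exchange_ratio S' j))) / ?x j \<in> ?M"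
        using newj(1) unfolding new_variable_def split(2)[OF chart_mutated] y' .
    qed (use cluster_nonzero Pk_nz mon_nz Pk in auto)
    then show ?thesis unfolding new_variable_def split(2)[OF ch] .
  qed
  moreover have "new_variable \<psi> S k \<in> ?M" using x'(1)[of k] jk cluster_mutated_same by auto
  moreover have "?x i \<in> ?M" for i
    using xj xk x'(1)[of i] cluster_mutated_other[of i] by (cases "i = j"; cases "i = k") auto
  moreover have "inverse (?x i) \<in> ?M" if "i \<notin> {k, j}" for i
    using that x'(2)[of i] cluster_mutated_other[of i] by auto
  ultimately show ?thesis
    unfolding lower_bound_def by (intro sub_gen_minimal[OF M]) (auto intro: coeff)
qed

text \<open>For each \<open>j\<close> all indices other than \<open>k\<close> and \<open>j\<close>
  may be frozen, since that enlarges the upper bound. For two indices it lies in the lower bound,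
  and \<open>lower_bound_subset_Laur\<close> finishes.\<close>

theorem upper_bound_mutated:
  assumes tf: "torsion_free TYPE('p)" and skew': "sign_skew_symmetric (exch S')"
    and odd: "\<And>j. j \<noteq> k \<Longrightarrow> exch S k j = 0 \<Longrightarrow> \<not> common_odd_root (exchange_ratio S k) (exchange_ratio S j)"
  shows "upper_bound \<psi> S UNIV \<subseteq> upper_bound \<psi> S' UNIV"
proof -
  have "upper_bound \<psi> S UNIV \<subseteq> Laur \<psi> (mutated_cluster \<psi> S' j)" for j
  proof (cases "j = k")
    case True
    then show ?thesis by (auto simp: mutated_cluster_mutated_same upper_bound_def)
  next
    case False
    \<comment> \<open>Sign-skew-symmetry allows at most one direction between \<open>k\<close> and
      \<open>j\<close>; the ranking gives its source the value 1.\<close>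
    have "acyclic {(i, l). i \<in> {k, j} \<and> l \<in> {k, j} \<and> exch S i l > 0}"
      by (rule acyclicI_order[of _ "\<lambda>i. if (i = k) = (exch S k j > 0) then 1 else 0 :: nat"])
        (use False sign_skew_pos[OF skew, of k j] sign_skew_pos[OF skew, of j k] in \<open>auto simp: exch_diag\<close>)
    then have "upper_bound \<psi> S {k, j} \<subseteq> lower_bound \<psi> S {k, j}"
      by (rule upper_bound_subset_lower_bound[OF ch skew tf])
        (use False odd sign_skew_zero[OF skew] common_odd_root_sym in \<open>blast\<close>)
    then show ?thesis using lower_bound_subset_Laur[OF False skew'] by (auto simp: upper_bound_def)
  qed
  moreover have "upper_bound \<psi> S UNIV \<subseteq> Laur \<psi> (cluster S')"
    by (auto simp: upper_bound_def cluster_mutated)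
  ultimately show ?thesis unfolding upper_bound_def[of \<psi> S'] by blast
qed

end

subsection \<open>Mutation is symmetric\<close>

lemma matrix_mutation_involutive:
  assumes "sign_skew_symmetric B"
  shows "matrix_mutation k (matrix_mutation k B) = B"
  using sign_skew_diag[OF assms, of k] by (auto simp: fun_eq_iff matrix_mutation_alt)

lemma mutates_sym:
  assumes ch: "chart \<psi> (cluster S)" and skew: "sign_skew_symmetric (exch S)" and mut: "mutates \<psi> k S S'"
  shows "mutates \<psi> k S' S"
  unfolding mutates_def
proof (intro conjI allI impI)
  show "cluster S = mutated_cluster \<psi> S' k" by (rule mutated_cluster_mutated_same[OF assms, symmetric])
  show "exch S = matrix_mutation k (exch S')"
    using mut matrix_mutation_involutive[OF skew] by (simp add: mutates_def)
  show "pplus S k = pminus S' k" "pminus S k = pplus S' k" using mut by (simp_all add: mutates_def)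
  fix i assume i: "i \<noteq> k"
  have "exch S' k i = - exch S k i" using mut i by (simp add: mutates_def matrix_mutation_alt)
  then show "pplus S i - pminus S i =
      zmul (exch S' k i) (if 0 \<le> exch S' k i then pplus S' k else pminus S' k) + (pplus S' i - pminus S' i)"
    using mut i unfolding mutates_def by (cases "exch S k i" "0::int" rule: linorder_cases) (auto simp: zmul_minus)
qed

subsection \<open>Relabelling\<close>

definition relabel :: "('n \<Rightarrow> 'n) \<Rightarrow> ('n, 'p, 'k) seed \<Rightarrow> ('n, 'p, 'k) seed" where
  "relabel \<sigma> S = \<lparr>cluster = cluster S \<circ> \<sigma>, pplus = pplus S \<circ> \<sigma>, pminus = pminus S \<circ> \<sigma>,
     exch = (\<lambda>i j. exch S (\<sigma> i) (\<sigma> j))\<rparr>"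

lemma relabel_simps [simp]:
  "cluster (relabel \<sigma> S) = cluster S \<circ> \<sigma>" "pplus (relabel \<sigma> S) = pplus S \<circ> \<sigma>"
  "pminus (relabel \<sigma> S) = pminus S \<circ> \<sigma>" "exch (relabel \<sigma> S) = (\<lambda>i j. exch S (\<sigma> i) (\<sigma> j))"
  by (simp_all add: relabel_def)

lemma relabel_relabel: "relabel \<tau> (relabel \<sigma> S) = relabel (\<sigma> \<circ> \<tau>) S"
  by (simp add: relabel_def comp_assoc)

lemma relabel_id [simp]: "relabel id S = S"
  by (simp add: relabel_def)

lemma seed_relabeling_iff: "seed_relabeling S S' \<longleftrightarrow> (\<exists>\<sigma>. bij \<sigma> \<and> S' = relabel \<sigma> S)"
proof -
  have "S' = relabel \<sigma> S \<longleftrightarrow> cluster S' = cluster S \<circ> \<sigma> \<and> pplus S' = pplus S \<circ> \<sigma> \<and>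
    pminus S' = pminus S \<circ> \<sigma> \<and> exch S' = (\<lambda>i j. exch S (\<sigma> i) (\<sigma> j))" for \<sigma>
    by (cases S') (auto simp: relabel_def)
  then show ?thesis by (simp add: seed_relabeling_def)
qed

lemma seed_relabeling_sym: "seed_relabeling S S' \<Longrightarrow> seed_relabeling S' S"
  unfolding seed_relabeling_iff
proof (elim exE conjE)
  fix \<sigma> assume "bij \<sigma>" "S' = relabel \<sigma> S"
  then have "bij (inv \<sigma>) \<and> S = relabel (inv \<sigma>) S'"
    by (simp add: relabel_relabel bij_imp_bij_inv bij_is_surj[THEN surj_iff[THEN iffD1]])
  then show "\<exists>\<sigma>. bij \<sigma> \<and> S = relabel \<sigma> S'" by blast
qed

lemma mon_comp:
  assumes "bij \<sigma>"
  shows "mon \<psi> (x \<circ> \<sigma>) (p, m \<circ> \<sigma>) = mon \<psi> x (p, m)"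
  using prod.reindex_bij_betw[OF assms, of "\<lambda>i. x i powi m i"] by (simp add: mon_def)

lemma exchange_elem_relabel:
  assumes "bij \<sigma>"
  shows "exchange_elem \<psi> (relabel \<sigma> S) j = exchange_elem \<psi> S (\<sigma> j)"
  using mon_comp[OF assms, of \<psi> "cluster S" _ "\<lambda>i. max (exch S i (\<sigma> j)) 0"]
    mon_comp[OF assms, of \<psi> "cluster S" _ "\<lambda>i. max (- exch S i (\<sigma> j)) 0"]
  by (simp add: exchange_elem_def pos_exponent_def neg_exponent_def comp_def)

lemma mutates_relabel:
  assumes mut: "mutates \<psi> (\<sigma> k) S S'" and \<sigma>: "bij \<sigma>"
  shows "mutates \<psi> k (relabel \<sigma> S) (relabel \<sigma> S')"
proof -
  have inj: "\<sigma> i = \<sigma> j \<longleftrightarrow> i = j" for i j using \<sigma> by (meson bij_is_inj injD)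
  show ?thesis
    using mut unfolding mutates_def
    by (auto simp: fun_eq_iff inj mutated_cluster_def new_variable_def exchange_elem_relabel[OF \<sigma>] matrix_mutation_def)
qed

lemma sign_skew_symmetric_relabel:
  "sign_skew_symmetric B \<Longrightarrow> sign_skew_symmetric (\<lambda>i j. B (\<sigma> i) (\<sigma> j))"
  unfolding sign_skew_symmetric_def by blast

section \<open>Generic seeds\<close>

text \<open>The Laurent ring in twice as many variables as there are indices, one half serving as
  coefficients. Exponents are re-indexed by \<open>nat\<close> so that they are linearly ordered;
  this makes the group ring a domain, whose fraction field can be taken.\<close>

lemma generic_chart_exists:
  "\<exists>(\<psi> :: ('n \<Rightarrow> int) \<Rightarrow> ((nat \<Rightarrow>\<^sub>0 int) \<Rightarrow>\<^sub>0 int) fract) (x :: 'n::finite \<Rightarrow> _). chart \<psi> x"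
proof -
  obtain e :: "'n + 'n \<Rightarrow> nat" where e: "inj e"
    using finite_imp_inj_to_nat_seg[of "UNIV :: ('n + 'n) set"] by auto
  define emb :: "('n \<Rightarrow> int) \<times> ('n \<Rightarrow> int) \<Rightarrow> nat \<Rightarrow>\<^sub>0 int" where
    "emb g = (\<Sum>i\<in>UNIV. Poly_Mapping.single (e (Inl i)) (fst g i)) +
      (\<Sum>i\<in>UNIV. Poly_Mapping.single (e (Inr i)) (snd g i))" for g
  have emb_add: "emb (g + h) = emb g + emb h" for g h
    by (simp add: emb_def single_add sum.distrib algebra_simps)
  have eI: "e a = e b \<longleftrightarrow> a = b" for a b using e by (meson injD)
  have emb_lookup: "Poly_Mapping.lookup (emb g) (e (Inl i)) = fst g i"
    "Poly_Mapping.lookup (emb g) (e (Inr i)) = snd g i" for g i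
    by (simp_all add: emb_def lookup_add lookup_sum lookup_single eI when_def)
  have emb_inj: "emb g = emb h \<longleftrightarrow> g = h" for g h
    by (metis emb_lookup ext prod_eqI)
  have emb_0: "emb 0 = 0" by (simp add: emb_def)
  define T :: "('n \<Rightarrow> int) \<times> ('n \<Rightarrow> int) \<Rightarrow> ((nat \<Rightarrow>\<^sub>0 int) \<Rightarrow>\<^sub>0 int) fract" where
    "T g = Fract (group_elem (emb g)) 1" for g
  have T: "character T"
    unfolding character_def by (simp add: T_def emb_0 emb_add mult_single One_fract_def)
  define \<psi> where "\<psi> p = T (p, 0)" for p
  define x where "x i = T (0, unit_vec i)" for i
  have \<psi>: "character \<psi>"
    using T unfolding character_def \<psi>_def by (metis add.left_neutral add_Pair zero_prod_def)
  have "mon \<psi> x g = T g" for g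
  proof -
    have "g = (fst g, 0) + (\<Sum>i\<in>UNIV. zmul (snd g i) (0, unit_vec i))"
    proof (rule prod_eqI)
      have "fst (zmul k (0 :: 'n \<Rightarrow> int, unit_vec i)) = 0" for k and i :: 'n by (simp only: fst_zmul fst_conv zmul_zero_right)
      then have "fst (\<Sum>i\<in>UNIV. zmul (snd g i) (0 :: 'n \<Rightarrow> int, unit_vec i)) = 0"
        by (simp add: fst_sum)
      then show "fst g = fst ((fst g, 0) + (\<Sum>i\<in>UNIV. zmul (snd g i) (0, unit_vec i)))" by simp
      have "(\<Sum>i\<in>UNIV. zmul (snd g i) (unit_vec i)) j = snd g j" for j
      proof -
        have "(\<Sum>i\<in>A. zmul (snd g i) (unit_vec i)) j = (\<Sum>i\<in>A. snd g i * unit_vec i j)" for A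
          by (induction A rule: infinite_finite_induct) (auto simp: zmul_apply)
        then show ?thesis by (simp add: unit_vec_def if_distrib cong: if_cong)
      qed
      then show "snd g = snd ((fst g, 0) + (\<Sum>i\<in>UNIV. zmul (snd g i) (0, unit_vec i)))"
        by (simp add: snd_sum snd_zmul fun_eq_iff)
    qed
    then have "T g = T ((fst g, 0) + (\<Sum>i\<in>UNIV. zmul (snd g i) (0, unit_vec i)))" by (rule arg_cong)
    also have "\<dots> = T (fst g, 0) * (\<Prod>i\<in>UNIV. T (0, unit_vec i) powi snd g i)"
      using T[unfolded character_def] by (simp only: character_sum[OF T] character_zmul[OF T])
    finally show ?thesis by (simp add: mon_def \<psi>_def x_def)
  qed
  then have mon: "mon \<psi> x = T" by (rule ext)
  have "c = 0" if "lin T c = 0" for c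
  proof -
    let ?s = "\<lambda>A. \<Sum>g\<in>A. Poly_Mapping.single (emb g) (Poly_Mapping.lookup c g)"
    have "of_int z * T g = Fract (Poly_Mapping.single (emb g) z) 1" for z g
    proof -
      have "of_int z = Fract (of_int z :: (nat \<Rightarrow>\<^sub>0 int) \<Rightarrow>\<^sub>0 int) 1" for z
        by (induction z rule: int_induct[where k = 0]) (auto simp: Zero_fract_def One_fract_def)
      moreover have "of_int z = Poly_Mapping.single (0 :: nat \<Rightarrow>\<^sub>0 int) z" for z
        by (subst single_of_int[symmetric]) simp
      ultimately show ?thesis by (simp add: T_def mult_single)
    qed
    then have "(\<Sum>g\<in>A. of_int (Poly_Mapping.lookup c g) * T g) = Fract (?s A) 1" for A
      by (induction A rule: infinite_finite_induct) (auto simp: Zero_fract_def)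
    then have "?s (Poly_Mapping.keys c) = 0"
      using that by (simp add: lin_def Zero_fract_def eq_fract)
    then have "0 = Poly_Mapping.lookup (?s (Poly_Mapping.keys c)) (emb h)" for h by simp
    also have "Poly_Mapping.lookup (?s (Poly_Mapping.keys c)) (emb h) = Poly_Mapping.lookup c h" for h
      by (simp add: lookup_sum lookup_single emb_inj when_def in_keys_iff)
    finally show "c = 0" by (intro poly_mapping_eqI) simp
  qed
  then have "chart \<psi> x" unfolding chart_def using \<psi> by (simp add: mon)
  then show ?thesis by blast
qed

text \<open>Full column rank of the exchange matrix extended by its coefficients.\<close>

definition ratios_independent :: "('n::finite, 'p::ab_group_add, 'k) seed \<Rightarrow> bool" where
  "ratios_independent S \<longleftrightarrow> (\<forall>a. (\<Sum>j\<in>UNIV. zmul (a j) (exchange_ratio S j)) = 0 \<longrightarrow> a = (\<lambda>_. 0))"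

lemma ratios_independent_no_common_odd_root:
  assumes "ratios_independent S" "j \<noteq> k"
  shows "\<not> common_odd_root (exchange_ratio S k) (exchange_ratio S j)"
proof
  assume "common_odd_root (exchange_ratio S k) (exchange_ratio S j)"
  then obtain e a b where e: "odd a" "odd b" "exchange_ratio S k = zmul a e" "exchange_ratio S j = zmul b e"
    unfolding common_odd_root_def by blast
  \<comment> \<open>The nontrivial relation
    \<open>zmul b (zmul a e) - zmul a (zmul b e) = 0\<close>; \<open>b\<close> is nonzero because it
    is odd.\<close>
  define c where "c i = (if i = k then b else if i = j then - a else 0)" for i
  have "(\<Sum>i\<in>UNIV. zmul (c i) (exchange_ratio S i)) = (\<Sum>i\<in>{k, j}. zmul (c i) (exchange_ratio S i))"
    by (rule sum.mono_neutral_right) (auto simp: c_def)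
  also have "\<dots> = 0"
    using assms(2) by (simp add: c_def e(3,4) zmul_minus flip: zmul_mult) (simp add: mult.commute)
  finally have "c = (\<lambda>_. 0)" using assms(1) unfolding ratios_independent_def by blast
  then have "c k = 0" by simp
  then show False using e(2) by (simp add: c_def)
qed

lemma snd_sum_zmul: "snd (\<Sum>j\<in>A. zmul (a j) (w j)) k = (\<Sum>j\<in>A. a j * snd (w j :: 'p::ab_group_add \<times> ('n \<Rightarrow> int)) k)"
  by (induction A rule: infinite_finite_induct) (auto simp: snd_zmul zmul_apply)

text \<open>A relation between the new ratios is one between the old ratios plus a multiple of a
  single extra vector \<open>z\<close>, and coordinate \<open>k\<close> forces that multiple to
  vanish.\<close>

lemma ratios_independent_mutated:
  assumes ch: "chart \<psi> (cluster S)" and skew: "sign_skew_symmetric (exch S)"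
    and mut: "mutates \<psi> k S S'" and w: "ratios_independent S"
  shows "ratios_independent S'"
  unfolding ratios_independent_def
proof (intro allI impI)
  fix a assume a: "(\<Sum>j\<in>UNIV. zmul (a j) (exchange_ratio S' j)) = 0"
  let ?b = "\<lambda>j. exch S k j"
  \<comment> \<open>With \<open>z\<close> based on the negative exponent, both signs of
    \<open>?b j\<close> fit one formula: the positive exponent differs from the negative one by the
    ratio at \<open>k\<close>.\<close>
  define z where "z = neg_exponent S k - zmul 2 (0, unit_vec k)"
  note kk = sign_skew_diag[OF skew, of k]
  have pos: "pos_exponent S k = neg_exponent S k + exchange_ratio S k" by (simp add: exchange_ratio_def)
  have w': "exchange_ratio S' j = exchange_ratio S j + zmul (?b j) z + zmul (if j = k then - 2 else max (?b j) 0) (exchange_ratio S k)" for j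
  proof (cases "j = k")
    case True
    have "zmul 2 (exchange_ratio S k) = exchange_ratio S k + exchange_ratio S k" using zmul_add[of 1 1 "exchange_ratio S k"] by simp
    then show ?thesis using True kk exchange_ratio_mutated_same[OF ch skew mut] by (simp add: zmul_minus)
  next
    case False
    have z': "zmul (?b j) z = zmul (?b j) (neg_exponent S k) - zmul (2 * ?b j) (0, unit_vec k)"
      by (simp add: z_def zmul_diff_right mult.commute[of 2] zmul_mult)
    show ?thesis
    proof (cases "?b j \<ge> 0")
      case True
      then show ?thesis unfolding exchange_ratio_mutated[OF ch skew mut False] z'
        using False by (simp add: pos zmul_add_right)
    qed (use False in \<open>simp add: exchange_ratio_mutated[OF ch skew mut False] z'\<close>)
  qed
  define \<beta> where "\<beta> = (\<Sum>j\<in>UNIV. a j * ?b j)"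
  define s where "s = (\<Sum>j\<in>UNIV. a j * (if j = k then - 2 else max (?b j) 0))"
  have eq: "(\<Sum>j\<in>UNIV. zmul (a j) (exchange_ratio S j)) + zmul \<beta> z + zmul s (exchange_ratio S k) = 0"
    using a unfolding w' by (simp add: zmul_add_right sum.distrib \<beta>_def s_def zmul_sum_left zmul_mult)
  have "snd z k = - 2"
    using kk by (simp add: z_def neg_exponent_def snd_zmul zmul_apply)
  moreover have "snd (exchange_ratio S j) k = ?b j" for j by (simp add: exchange_ratio_eq)
  moreover have "snd ((\<Sum>j\<in>UNIV. zmul (a j) (exchange_ratio S j)) + zmul \<beta> z + zmul s (exchange_ratio S k)) k = 0"
    unfolding eq by simp
  \<comment> \<open>In coordinate \<open>k\<close> the old ratios contribute \<open>\<beta>\<close>,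
    the vector \<open>z\<close> contributes \<open>- 2 * \<beta>\<close>, and the ratio at
    \<open>k\<close> contributes 0.\<close>
  ultimately have "\<beta> = 0" using kk by (simp add: snd_sum_zmul snd_zmul zmul_apply \<beta>_def)
  define a' where "a' j = a j + (if j = k then s else 0)" for j
  have "(\<Sum>j\<in>UNIV. zmul (a' j) (exchange_ratio S j)) = (\<Sum>j\<in>UNIV. zmul (a j) (exchange_ratio S j) + (if j = k then zmul s (exchange_ratio S k) else 0))"
    by (rule sum.cong) (auto simp: a'_def zmul_add)
  also have "\<dots> = 0" using eq \<open>\<beta> = 0\<close> by (simp add: sum.distrib)
  finally have "a' = (\<lambda>_. 0)" using w unfolding ratios_independent_def by blast
  then have a'0: "a' j = 0" for j by simp
  then have other: "a j = 0" if "j \<noteq> k" for j using a'0[of j] that by (simp add: a'_def)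
  \<comment> \<open>Only \<open>j = k\<close> survives, so \<open>s = - 2 * a k\<close>, and
    \<open>a k + s = 0\<close> gives \<open>a k = 0\<close>.\<close>
  have "s = (\<Sum>j\<in>UNIV. if j = k then - 2 * a k else 0)"
    unfolding s_def by (rule sum.cong) (auto simp: other)
  then have "a k = 0" using a'0[of k] by (simp add: a'_def)
  then show "a = (\<lambda>_. 0)" using other by (metis ext)
qed

section \<open>The Laurent phenomenon\<close>

text \<open>
  A generic seed \<open>T\<close> with principal coefficients at the root specialises, under the ring
  homomorphism \<open>\<Phi>\<close> that sends the generic root cluster and coefficients to the given ones, to any
  seed with the same mutation history, up to rescaling of the cluster variables by coefficients \<open>c\<close>.
\<close>

locale specialisation =
  fixes \<psi> :: "'p::ab_group_add \<Rightarrow> 'f::field" and R :: "('n::finite, 'p, 'f) seed"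
    and \<psi>' :: "('n \<Rightarrow> int) \<Rightarrow> 'k::field" and x' :: "'n \<Rightarrow> 'k"
  assumes \<psi>: "character \<psi>" and R_nz: "\<And>i. cluster R i \<noteq> 0" and ch': "chart \<psi>' x'"
begin

text \<open>The homomorphism that sends each principal coefficient to the coefficient ratio of the
  root at the same index.\<close>

definition \<theta> :: "('n \<Rightarrow> int) \<Rightarrow> 'p" where
  "\<theta> p = (\<Sum>j\<in>UNIV. zmul (p j) (pplus R j - pminus R j))"

lemma \<theta>_add: "\<theta> (p + q) = \<theta> p + \<theta> q"
  by (simp add: \<theta>_def zmul_add sum.distrib)

lemma \<theta>_0: "\<theta> 0 = 0"
  by (simp add: \<theta>_def)

lemma \<theta>_minus: "\<theta> (- p) = - \<theta> p"
  using \<theta>_add[of p "- p"] by (simp add: \<theta>_0 eq_neg_iff_add_eq_0 add.commute)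

lemma \<theta>_diff: "\<theta> (p - q) = \<theta> p - \<theta> q"
  using \<theta>_add[of p "- q"] by (simp add: \<theta>_minus)

lemma \<theta>_zmul: "\<theta> (zmul k p) = zmul k (\<theta> p)"
  by (simp add: \<theta>_def zmul_apply zmul_mult zmul_sum_right)

lemma \<theta>_unit_vec: "\<theta> (unit_vec j) = pplus R j - pminus R j"
proof -
  have "\<theta> (unit_vec j) = (\<Sum>i\<in>UNIV. if i = j then pplus R j - pminus R j else 0)"
    unfolding \<theta>_def by (rule sum.cong) (auto simp: unit_vec_def)
  then show ?thesis by simp
qed

lemma character_\<theta>: "character (\<psi> \<circ> \<theta>)"
  using \<psi> by (simp add: character_def \<theta>_add \<theta>_0)

abbreviation \<chi> where "\<chi> \<equiv> mon (\<psi> \<circ> \<theta>) (cluster R)"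

text \<open>Expands in the generic root chart and re-evaluates at the given root. It is meaningful
  only on \<open>Laur \<psi>' x'\<close>, hence the membership premises of the homomorphism rules;
  that generic cluster variables lie there is the crux.\<close>

definition \<Phi> :: "'k \<Rightarrow> 'f" where
  "\<Phi> f = lin \<chi> (inv (lin (mon \<psi>' x')) f)"

lemma \<Phi>_lin: "\<Phi> (lin (mon \<psi>' x') c) = lin \<chi> c"
  unfolding \<Phi>_def by (subst inv_f_f) (auto intro: injI chart_inj[OF ch'])

lemma \<Phi>_add: "f \<in> Laur \<psi>' x' \<Longrightarrow> g \<in> Laur \<psi>' x' \<Longrightarrow> \<Phi> (f + g) = \<Phi> f + \<Phi> g"
  unfolding Laur_def by (auto simp: \<Phi>_lin simp flip: lin_add)

lemma \<Phi>_mult: "f \<in> Laur \<psi>' x' \<Longrightarrow> g \<in> Laur \<psi>' x' \<Longrightarrow> \<Phi> (f * g) = \<Phi> f * \<Phi> g"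
  unfolding Laur_def
  by (auto simp: \<Phi>_lin lin_mon_mult[OF character_\<theta> R_nz] simp flip: chart_simps(1)[OF ch'])

lemma \<Phi>_mon: "\<Phi> (mon \<psi>' x' g) = \<chi> g"
  using \<Phi>_lin[of "group_elem g"] by simp

lemma \<Phi>_coeff: "\<Phi> (\<psi>' p) = \<psi> (\<theta> p)"
  using \<Phi>_mon[of "(p, 0)"] by (simp add: mon_def)

lemma \<Phi>_var: "\<Phi> (x' i) = cluster R i"
  using \<Phi>_mon[of "(0, unit_vec i)"] mon_unit[OF chart_character[OF ch']] mon_unit[OF character_\<theta>] by metis

lemma Laur': "is_subring (Laur \<psi>' x')"
  by (rule is_subring_Laur[OF chart_character[OF ch'] chart_nz[OF ch']])

lemma coeff_Laur': "\<psi>' p \<in> Laur \<psi>' x'"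
  by (rule coeff_in_Laur[OF chart_character[OF ch'] chart_nz[OF ch']])

lemma \<Phi>_1: "\<Phi> 1 = 1"
  using \<Phi>_coeff[of 0] \<psi> chart_character[OF ch'] by (simp add: character_def \<theta>_0)

lemma \<Phi>_power: "f \<in> Laur \<psi>' x' \<Longrightarrow> \<Phi> (f ^ n) = \<Phi> f ^ n"
  by (induction n) (auto simp: \<Phi>_1 \<Phi>_mult subring_power[OF Laur'])

lemma \<Phi>_prod: "(\<And>i. i \<in> A \<Longrightarrow> f i \<in> Laur \<psi>' x') \<Longrightarrow> \<Phi> (prod f A) = (\<Prod>i\<in>A. \<Phi> (f i))"
  by (induction A rule: infinite_finite_induct) (auto simp: \<Phi>_1 \<Phi>_mult subring_prod[OF Laur'])

lemma \<Phi>_in_Laur: "f \<in> Laur \<psi>' x' \<Longrightarrow> \<Phi> f \<in> Laur \<psi> (cluster R)"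
proof -
  assume "f \<in> Laur \<psi>' x'"
  then obtain c where "f = lin (mon \<psi>' x') c" unfolding Laur_def by blast
  then have "\<Phi> f = lin \<chi> c" by (simp add: \<Phi>_lin)
  moreover have "lin \<chi> c \<in> Laur \<psi> (cluster R)"
  proof (rule subring_lin[OF is_subring_Laur[OF \<psi> R_nz]])
    fix g show "\<chi> g \<in> Laur \<psi> (cluster R)"
      using mon_in_Laur[OF \<psi> R_nz, of "\<lambda>i. i" "(\<theta> (fst g), snd g)"] by (simp add: mon_def)
  qed
  ultimately show ?thesis by simp
qed

text \<open>The containment of the upper bound makes \<open>\<Phi>\<close> usable on the cluster
  variables of \<open>T\<close>. The last clause says that the rescaling by \<open>c\<close> carries
  the exchange ratios of \<open>T\<close> exactly to those of \<open>S\<close>, so that the two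
  terms of an exchange polynomial pick up the same factor.\<close>

definition specialises :: "('n, 'n \<Rightarrow> int, 'k) seed \<Rightarrow> ('n, 'p, 'f) seed \<Rightarrow> ('n \<Rightarrow> 'p) \<Rightarrow> bool" where
  "specialises T S c \<longleftrightarrow> chart \<psi>' (cluster T) \<and> exch T = exch S \<and> sign_skew_symmetric (exch S) \<and> ratios_independent T \<and>
     upper_bound \<psi>' T UNIV \<subseteq> Laur \<psi>' x' \<and>
     (\<forall>i. \<Phi> (cluster T i) = \<psi> (c i) * cluster S i) \<and>
     (\<forall>j. \<theta> (pplus T j - pminus T j) + (\<Sum>i\<in>UNIV. zmul (exch S i j) (c i)) = pplus S j - pminus S j)"

lemma specialises_root:
  assumes "sign_skew_symmetric (exch R)"
  shows "\<exists>T c. specialises T R c"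
proof -
  \<comment> \<open>Principal coefficients: the coefficient parts of the ratios are unit vectors, so
    the ratios are independent whatever the matrix.\<close>
  define T where "T = \<lparr>cluster = x', pplus = unit_vec, pminus = (\<lambda>_. 0), exch = exch R\<rparr>"
  have "ratios_independent T"
    unfolding ratios_independent_def
  proof (intro allI impI)
    fix a assume a: "(\<Sum>j\<in>UNIV. zmul (a j) (exchange_ratio T j)) = 0"
    have *: "fst (\<Sum>j\<in>A. zmul (a j) (exchange_ratio T j)) i = (\<Sum>j\<in>A. a j * unit_vec j i)" for A i
      by (induction A rule: infinite_finite_induct) (auto simp: fst_zmul zmul_apply exchange_ratio_eq T_def)
    have "0 = (\<Sum>j\<in>UNIV. a j * unit_vec j i)" for i unfolding *[symmetric] a by simp
    then show "a = (\<lambda>_. 0)" by (simp add: unit_vec_def if_distrib cong: if_cong) (simp add: fun_eq_iff)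
  qed
  moreover have "upper_bound \<psi>' T UNIV \<subseteq> Laur \<psi>' x'" by (auto simp: upper_bound_def T_def)
  moreover have "\<psi> 0 = 1" using \<psi> by (simp add: character_def)
  ultimately have "specialises T R (\<lambda>_. 0)"
    using assms ch' unfolding specialises_def by (simp add: T_def \<Phi>_var \<theta>_unit_vec)
  then show ?thesis by blast
qed

lemma specialises_mutates:
  assumes sp: "specialises T S c" and mut: "mutates \<psi> k S S'" and nz: "\<And>i. cluster S i \<noteq> 0"
    and skew': "sign_skew_symmetric (exch S')"
  shows "\<exists>T' c'. specialises T' S' c'"
proof -
  have chT: "chart \<psi>' (cluster T)" and ex: "exch T = exch S" and skew: "sign_skew_symmetric (exch S)"
    and wi: "ratios_independent T" and ub: "upper_bound \<psi>' T UNIV \<subseteq> Laur \<psi>' x'"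
    and cl: "\<And>i. \<Phi> (cluster T i) = \<psi> (c i) * cluster S i"
    and y: "\<And>j. \<theta> (pplus T j - pminus T j) + (\<Sum>i\<in>UNIV. zmul (exch S i j) (c i)) = pplus S j - pminus S j"
    using sp unfolding specialises_def by auto
  have skewT: "sign_skew_symmetric (exch T)" by (simp add: ex skew)
  \<comment> \<open>Only coefficient ratios matter away from \<open>k\<close>; the representative
    with trivial \<open>pminus\<close> is chosen.\<close>
  define T' where "T' = \<lparr>cluster = mutated_cluster \<psi>' T k,
    pplus = (\<lambda>i. if i = k then pminus T k else
       zmul (exch T k i) (if exch T k i \<ge> 0 then pplus T k else pminus T k) + (pplus T i - pminus T i)),
    pminus = (\<lambda>i. if i = k then pplus T k else 0), exch = matrix_mutation k (exch T)\<rparr>"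
  have mutT: "mutates \<psi>' k T T'" by (simp add: mutates_def T'_def)
  have ex': "exch T' = exch S'" using mut by (simp add: T'_def ex mutates_def)
  have skewT': "sign_skew_symmetric (exch T')" by (simp add: ex' skew')
  have chT': "chart \<psi>' (cluster T')" by (rule chart_mutated[OF chT skewT mutT])
  have wi': "ratios_independent T'" by (rule ratios_independent_mutated[OF chT skewT mutT wi])
  \<comment> \<open>Invariance is applied to the mutation back from \<open>T'\<close> to
    \<open>T\<close>, hence with the independence of the ratios of \<open>T'\<close>.\<close>
  have "upper_bound \<psi>' T' UNIV \<subseteq> upper_bound \<psi>' T UNIV"
    by (rule upper_bound_mutated[OF chT' skewT' mutates_sym[OF chT skewT mutT] torsion_free_fun skewT])
      (rule ratios_independent_no_common_odd_root[OF wi'])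
  then have ub': "upper_bound \<psi>' T' UNIV \<subseteq> Laur \<psi>' x'" using ub by blast
  have clL: "cluster T i \<in> Laur \<psi>' x'" "cluster T' i \<in> Laur \<psi>' x'" for i
    using cluster_in_upper_bound[OF chT skewT] cluster_in_upper_bound[OF chT' skewT'] ub ub' by blast+
  \<comment> \<open>The coefficient \<open>q\<close> is free, so each term of a generic exchange
    polynomial can be compared with the corresponding term for \<open>S\<close>. Nonnegative
    exponents keep the monomial in the domain of \<open>\<Phi>\<close>.\<close>
  have \<Phi>_mono: "\<Phi> (mon \<psi>' (cluster T) (p, m)) =
      \<psi> (\<theta> p + (\<Sum>i\<in>UNIV. zmul (m i) (c i)) - q) * mon \<psi> (cluster S) (q, m)"
    and mono_L: "mon \<psi>' (cluster T) (p, m) \<in> Laur \<psi>' x'" if "\<And>i. m i \<ge> 0" for m p q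
  proof -
    have pw: "cluster T i powi m i = cluster T i ^ nat (m i)" for i using that by (simp add: power_int_def)
    have L: "(\<Prod>i\<in>UNIV. cluster T i powi m i) \<in> Laur \<psi>' x'"
      unfolding pw by (intro subring_prod[OF Laur'] subring_power[OF Laur'] clL)
    then show "mon \<psi>' (cluster T) (p, m) \<in> Laur \<psi>' x'"
      by (simp add: mon_def subring_mult[OF Laur'] coeff_Laur')
    have "\<Phi> (cluster T i powi m i) = \<psi> (zmul (m i) (c i)) * cluster S i powi m i" for i
      unfolding pw using that[of i]
      by (simp add: \<Phi>_power clL cl power_mult_distrib character_zmul[OF \<psi>]) (simp add: power_int_def)
    then have "\<Phi> (\<Prod>i\<in>UNIV. cluster T i powi m i) =
        \<psi> (\<Sum>i\<in>UNIV. zmul (m i) (c i)) * (\<Prod>i\<in>UNIV. cluster S i powi m i)"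
      unfolding pw by (simp add: \<Phi>_prod subring_power[OF Laur'] clL prod.distrib character_sum[OF \<psi>])
    then show "\<Phi> (mon \<psi>' (cluster T) (p, m)) =
      \<psi> (\<theta> p + (\<Sum>i\<in>UNIV. zmul (m i) (c i)) - q) * mon \<psi> (cluster S) (q, m)"
      using \<psi> character_nonzero[OF \<psi>, of q] L
      by (simp add: mon_def \<Phi>_mult coeff_Laur' \<Phi>_coeff character_diff[OF \<psi>]) (simp add: character_def)
  qed
  define hp where "hp i = max (exch S i k) 0" for i
  define hm where "hm i = max (- exch S i k) 0" for i
  \<comment> \<open>The factor acquired by the negative term; by the ratio clause it is also the
    factor of the positive term.\<close>
  define \<gamma> where "\<gamma> = \<theta> (pminus T k) + (\<Sum>i\<in>UNIV. zmul (hm i) (c i)) - pminus S k"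
  have "exch S i k = hp i - hm i" for i by (simp add: hp_def hm_def)
  then have s: "(\<Sum>i\<in>UNIV. zmul (exch S i k) (c i)) = (\<Sum>i\<in>UNIV. zmul (hp i) (c i)) - (\<Sum>i\<in>UNIV. zmul (hm i) (c i))"
    by (simp only: sum_subtractf[symmetric] zmul_diff[symmetric])
  have "pplus S k = pminus S k + (\<theta> (pplus T k) - \<theta> (pminus T k) + (\<Sum>i\<in>UNIV. zmul (exch S i k) (c i)))"
    using y[of k] by (simp add: \<theta>_diff)
  then have \<gamma>': "\<gamma> = \<theta> (pplus T k) + (\<Sum>i\<in>UNIV. zmul (hp i) (c i)) - pplus S k"
    unfolding s by (simp add: \<gamma>_def)
  have up: "pos_exponent T k = (pplus T k, hp)" "pos_exponent S k = (pplus S k, hp)"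
    "neg_exponent T k = (pminus T k, hm)" "neg_exponent S k = (pminus S k, hm)"
    by (auto simp: pos_exponent_def neg_exponent_def ex hp_def hm_def fun_eq_iff)
  have pos: "hp i \<ge> 0" "hm i \<ge> 0" for i by (auto simp: hp_def hm_def)
  have "\<Phi> (exchange_elem \<psi>' T k) = \<Phi> (mon \<psi>' (cluster T) (pos_exponent T k)) + \<Phi> (mon \<psi>' (cluster T) (neg_exponent T k))"
    unfolding exchange_elem_def up by (intro \<Phi>_add mono_L pos)
  also have "\<dots> = \<psi> \<gamma> * exchange_elem \<psi> S k"
    unfolding exchange_elem_def up \<Phi>_mono[OF pos(1), where q = "pplus S k"] \<Phi>_mono[OF pos(2), where q = "pminus S k"]
    by (simp add: distrib_left flip: \<gamma>' \<gamma>_def)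
  finally have \<Phi>_exchange_elem: "\<Phi> (exchange_elem \<psi>' T k) = \<psi> \<gamma> * exchange_elem \<psi> S k" .
  have "cluster T k * cluster T' k = exchange_elem \<psi>' T k"
    using cluster_new_variable[OF chT skewT] by (simp add: T'_def mutated_cluster_def)
  then have "\<psi> (c k) * cluster S k * \<Phi> (cluster T' k) = \<psi> \<gamma> * exchange_elem \<psi> S k"
    using \<Phi>_mult[OF clL(1) clL(2), of k k] by (simp add: cl \<Phi>_exchange_elem)
  also have "exchange_elem \<psi> S k = cluster S k * cluster S' k"
    using mut nz[of k] by (simp add: mutates_def mutated_cluster_def new_variable_def)
  finally have "cluster S k * (\<psi> (c k) * \<Phi> (cluster T' k)) = cluster S k * (\<psi> \<gamma> * cluster S' k)"
    by (simp only: ac_simps)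
  then have "\<psi> (c k) * \<Phi> (cluster T' k) = \<psi> \<gamma> * cluster S' k" using nz[of k] by simp
  then have clk: "\<Phi> (cluster T' k) = \<psi> (\<gamma> - c k) * cluster S' k"
    using character_nonzero[OF \<psi>, of "c k"] by (simp add: character_diff[OF \<psi>] field_simps)
  \<comment> \<open>Forced by the exchange relation: the product of old and new variable scales by
    \<open>\<gamma>\<close>, the old one by \<open>c k\<close>.\<close>
  define c' where "c' = c(k := \<gamma> - c k)"
  have cl': "\<Phi> (cluster T' i) = \<psi> (c' i) * cluster S' i" for i
  proof (cases "i = k")
    case False
    then have "cluster T' i = cluster T i" "cluster S' i = cluster S i"
      using mut by (simp_all add: T'_def mutates_def mutated_cluster_def)
    then show ?thesis using False cl[of i] by (simp add: c'_def)
  qed (simp add: clk c'_def)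
  have kk: "exch S k k = 0" by (rule sign_skew_diag[OF skew])
  have exS': "exch S' i j = (if i = k \<or> j = k then - exch S i j
     else exch S i j + (if exch S k j \<ge> 0 then hp i else hm i) * exch S k j)" for i j
    using mut by (simp add: mutates_def matrix_mutation_alt hp_def hm_def)
  have y': "\<theta> (pplus T' j - pminus T' j) + (\<Sum>i\<in>UNIV. zmul (exch S' i j) (c' i)) = pplus S' j - pminus S' j" for j
  proof (cases "j = k")
    case True
    have "(\<Sum>i\<in>UNIV. zmul (exch S' i k) (c' i)) = (\<Sum>i\<in>UNIV. - zmul (exch S i k) (c i))"
      by (rule sum.cong) (auto simp: exS' zmul_minus c'_def kk)
    then have s: "(\<Sum>i\<in>UNIV. zmul (exch S' i k) (c' i)) = - (\<Sum>i\<in>UNIV. zmul (exch S i k) (c i))"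
      by (simp add: sum_negf)
    have t: "\<theta> (pplus T' k - pminus T' k) = - \<theta> (pplus T k - pminus T k)"
      by (simp add: T'_def \<theta>_diff)
    have "\<theta> (pplus T' k - pminus T' k) + (\<Sum>i\<in>UNIV. zmul (exch S' i k) (c' i)) = - (pplus S k - pminus S k)"
      unfolding s t y[of k, symmetric] by simp
    then show ?thesis using True mut by (simp add: mutates_def)
  next
    case False
    let ?b = "exch S k j"
    \<comment> \<open>The sign of \<open>?b\<close> selects the term at \<open>k\<close> that enters
      the mutation rules. As \<open>\<gamma>\<close> can be read off from either term, both signs
      are treated together.\<close>
    define h where "h i = (if ?b \<ge> 0 then hp i else hm i)" for i
    define pT where "pT = (if ?b \<ge> 0 then pplus T k else pminus T k)"
    define pS where "pS = (if ?b \<ge> 0 then pplus S k else pminus S k)"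
    have \<gamma>h: "\<gamma> = \<theta> pT + (\<Sum>i\<in>UNIV. zmul (h i) (c i)) - pS"
      using \<gamma>' \<gamma>_def by (simp add: h_def pT_def pS_def)
    have hk: "h k = 0" by (simp add: h_def hp_def hm_def kk)
    have "(\<Sum>i\<in>UNIV. zmul (exch S' i j) (c' i)) =
        (\<Sum>i\<in>UNIV. zmul (exch S i j) (c i) + zmul ?b (zmul (h i) (c i)) + (if i = k then - zmul ?b \<gamma> else 0))"
    proof (rule sum.cong[OF refl])
      fix i
      show "zmul (exch S' i j) (c' i) =
        zmul (exch S i j) (c i) + zmul ?b (zmul (h i) (c i)) + (if i = k then - zmul ?b \<gamma> else 0)"
        using False hk by (auto simp: exS' c'_def zmul_minus zmul_diff_right zmul_add h_def[symmetric]
          mult.commute[of _ ?b] zmul_mult)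
    qed
    also have "\<dots> = (\<Sum>i\<in>UNIV. zmul (exch S i j) (c i)) + zmul ?b (\<Sum>i\<in>UNIV. zmul (h i) (c i)) - zmul ?b \<gamma>"
      by (simp add: sum.distrib zmul_sum_right)
    also have "\<dots> = (\<Sum>i\<in>UNIV. zmul (exch S i j) (c i)) + zmul ?b pS - zmul ?b (\<theta> pT)"
      by (simp add: \<gamma>h zmul_add_right zmul_diff_right)
    finally have s: "(\<Sum>i\<in>UNIV. zmul (exch S' i j) (c' i)) =
      (\<Sum>i\<in>UNIV. zmul (exch S i j) (c i)) + zmul ?b pS - zmul ?b (\<theta> pT)" .
    have "pplus T' j - pminus T' j = zmul ?b pT + (pplus T j - pminus T j)"
      using False by (simp add: T'_def ex pT_def)
    then have t: "\<theta> (pplus T' j - pminus T' j) = zmul ?b (\<theta> pT) + \<theta> (pplus T j - pminus T j)"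
      by (simp only: \<theta>_add \<theta>_zmul)
    have "pplus S' j - pminus S' j = zmul ?b pS + (pplus S j - pminus S j)"
      using mut False by (simp add: mutates_def pS_def)
    then show ?thesis unfolding s t y[of j, symmetric] by simp
  qed
  have "specialises T' S' c'"
    unfolding specialises_def using chT' ex' skew' wi' ub' cl' y' by blast
  then show ?thesis by blast
qed

lemma specialises_Laur:
  assumes "specialises T S c"
  shows "cluster S i \<in> Laur \<psi> (cluster R)"
proof -
  have "cluster T i \<in> Laur \<psi>' x'"
    using assms cluster_in_upper_bound[of \<psi>' T i] unfolding specialises_def by auto
  then have "\<Phi> (cluster T i) \<in> Laur \<psi> (cluster R)" by (rule \<Phi>_in_Laur)
  moreover have "cluster S i = \<psi> (- c i) * \<Phi> (cluster T i)"
    using assms character_nonzero[OF \<psi>, of "c i"] unfolding specialises_def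
    by (simp add: character_minus[OF \<psi>])
  ultimately show ?thesis
    using subring_mult[OF is_subring_Laur[OF \<psi> R_nz] coeff_in_Laur[OF \<psi> R_nz]] by simp
qed

end

section \<open>Polynomial and Laurent subrings of the ambient field\<close>

text \<open>Common form of \<open>poly_eval\<close> and \<open>laurent_eval\<close>; here the
  coefficients are field elements, unlike in \<open>lin\<close>.\<close>

definition lin_comb :: "('e \<Rightarrow> 'f::field) \<Rightarrow> ('e \<Rightarrow>\<^sub>0 'f) \<Rightarrow> 'f" where
  "lin_comb \<phi> q = (\<Sum>m\<in>Poly_Mapping.keys q. Poly_Mapping.lookup q m * \<phi> m)"

lemma lin_comb_zero [simp]: "lin_comb \<phi> 0 = 0"
  by (simp add: lin_comb_def)

lemma lin_comb_single [simp]: "lin_comb \<phi> (Poly_Mapping.single m r) = r * \<phi> m"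
  by (simp add: lin_comb_def)

lemma lin_comb_add: "lin_comb \<phi> (q + r) = lin_comb \<phi> q + lin_comb \<phi> r"
  unfolding lin_comb_def by (rule setsum_keys_plus_distrib) (auto simp: distrib_right)

lemma lin_comb_sum: "lin_comb \<phi> (sum q A) = (\<Sum>i\<in>A. lin_comb \<phi> (q i))"
  by (induction A rule: infinite_finite_induct) (auto simp: lin_comb_add)

context
  fixes R :: "'f::field set" and \<phi> :: "('n \<Rightarrow>\<^sub>0 'e::comm_monoid_add) \<Rightarrow> 'f"
  assumes R: "is_subring R" and \<phi>0: "\<phi> 0 = 1" and \<phi>: "\<And>a b. \<phi> (a + b) = \<phi> a * \<phi> b"
begin

lemma lin_comb_term: "r \<in> R \<Longrightarrow> r * \<phi> m \<in> lin_comb \<phi> ` polys_over R"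
  by (rule image_eqI[of _ _ "Poly_Mapping.single m r"])
    (auto simp: polys_over_def lookup_single when_def subring_0[OF R])

lemma lin_comb_image_coeff: "R \<subseteq> lin_comb \<phi> ` polys_over R"
  using lin_comb_term[of _ 0] by (auto simp: \<phi>0)

lemma lin_comb_image_monomial: "\<phi> m \<in> lin_comb \<phi> ` polys_over R"
  using lin_comb_term[OF subring_1[OF R], of m] by simp

lemma lin_comb_image_subring: "is_subring (lin_comb \<phi> ` polys_over R)"
proof -
  let ?E = "lin_comb \<phi> ` polys_over R"
  have add: "a + b \<in> ?E" if ab: "a \<in> ?E" "b \<in> ?E" for a b
  proof -
    obtain q where "a = lin_comb \<phi> q" "q \<in> polys_over R" using ab(1) by (rule imageE)
    moreover obtain r where "b = lin_comb \<phi> r" "r \<in> polys_over R" using ab(2) by (rule imageE)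
    moreover from calculation have "q + r \<in> polys_over R"
      by (auto simp: polys_over_def lookup_add subring_add[OF R])
    ultimately show ?thesis by (metis lin_comb_add image_eqI)
  qed
  have sum: "sum f A \<in> ?E" if "\<And>i. i \<in> A \<Longrightarrow> f i \<in> ?E" for f and A :: "(('n \<Rightarrow>\<^sub>0 'e) \<times> ('n \<Rightarrow>\<^sub>0 'e)) set"
    using that lin_comb_image_coeff subring_0[OF R]
    by (induction A rule: infinite_finite_induct) (auto intro!: add)
  have "a * b \<in> ?E" if ab: "a \<in> ?E" "b \<in> ?E" for a b
  proof -
    obtain q where q: "a = lin_comb \<phi> q" "q \<in> polys_over R" using ab(1) by (rule imageE)
    obtain r where r: "b = lin_comb \<phi> r" "r \<in> polys_over R" using ab(2) by (rule imageE)
    have "a * b = (\<Sum>(m, m')\<in>Poly_Mapping.keys q \<times> Poly_Mapping.keys r.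
        (Poly_Mapping.lookup q m * Poly_Mapping.lookup r m') * \<phi> (m + m'))"
      by (simp add: q r lin_comb_def sum_product sum.cartesian_product \<phi> algebra_simps)
    also have "\<dots> \<in> ?E"
    proof (rule sum, clarify)
      have "Poly_Mapping.lookup q m \<in> R" "Poly_Mapping.lookup r m \<in> R" for m
        using q(2) r(2) by (auto simp: polys_over_def)
      then show "Poly_Mapping.lookup q m * Poly_Mapping.lookup r m' * \<phi> (m + m') \<in> ?E" for m m'
        by (intro lin_comb_term subring_mult[OF R])
    qed
    finally show ?thesis .
  qed
  moreover have "- 1 \<in> ?E" using lin_comb_image_coeff subring_neg1[OF R] by blast
  ultimately show ?thesis using add by (auto simp: is_subring_def)
qed

lemma lin_comb_image_minimal:
  assumes "is_subring M" "R \<subseteq> M" "\<And>m. \<phi> m \<in> M"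
  shows "lin_comb \<phi> ` polys_over R \<subseteq> M"
  using assms unfolding lin_comb_def polys_over_def by (auto intro!: subring_sum subring_mult)

end

definition pmono :: "('n::finite \<Rightarrow> 'f::field) \<Rightarrow> ('n \<Rightarrow>\<^sub>0 nat) \<Rightarrow> 'f" where
  "pmono x m = (\<Prod>i\<in>UNIV. x i ^ Poly_Mapping.lookup m i)"

definition lmono :: "('n::finite \<Rightarrow> 'f::field) \<Rightarrow> ('n \<Rightarrow>\<^sub>0 int) \<Rightarrow> 'f" where
  "lmono x m = (\<Prod>i\<in>UNIV. x i powi Poly_Mapping.lookup m i)"

lemma poly_eval_lin_comb: "poly_eval x = lin_comb (pmono x)"
  by (simp add: fun_eq_iff poly_eval_def lin_comb_def pmono_def)

lemma laurent_eval_lin_comb: "laurent_eval x = lin_comb (lmono x)"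
  by (simp add: fun_eq_iff laurent_eval_def lin_comb_def lmono_def)

lemma pmono_0: "pmono x 0 = 1" and pmono_add: "pmono x (a + b) = pmono x a * pmono x b"
  by (simp_all add: pmono_def lookup_add power_add prod.distrib)

lemma lmono_0: "lmono x 0 = 1"
  by (simp add: lmono_def)

lemma lmono_add: "(\<And>i. x i \<noteq> 0) \<Longrightarrow> lmono x (a + b) = lmono x a * lmono x b"
  by (simp add: lmono_def lookup_add power_int_add prod.distrib)

lemma pmono_var: "pmono x (Poly_Mapping.single i 1) = x i"
proof -
  have "pmono x (Poly_Mapping.single i 1) = (\<Prod>j\<in>UNIV. if j = i then x j else 1)"
    unfolding pmono_def by (rule prod.cong) (auto simp: lookup_single when_def)
  then show ?thesis by simp
qed

lemma lmono_var: "lmono x (Poly_Mapping.single i k) = x i powi k"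
proof -
  have "lmono x (Poly_Mapping.single i k) = (\<Prod>j\<in>UNIV. if j = i then x j powi k else 1)"
    unfolding lmono_def by (rule prod.cong) (auto simp: lookup_single when_def)
  then show ?thesis by simp
qed

lemma poly_ring_lin_comb: "poly_ring R x = lin_comb (pmono x) ` polys_over R"
  by (simp add: poly_ring_def poly_eval_lin_comb)

lemma poly_ring_subring: "is_subring R \<Longrightarrow> is_subring (poly_ring R x)"
  unfolding poly_ring_lin_comb by (rule lin_comb_image_subring) (auto simp: pmono_0 pmono_add)

lemma poly_ring_coeff: "is_subring R \<Longrightarrow> R \<subseteq> poly_ring R x"
  unfolding poly_ring_lin_comb by (rule lin_comb_image_coeff) (auto simp: pmono_0 pmono_add)

lemma poly_ring_minimal:
  "is_subring R \<Longrightarrow> is_subring M \<Longrightarrow> R \<subseteq> M \<Longrightarrow> (\<And>m. pmono x m \<in> M) \<Longrightarrow> poly_ring R x \<subseteq> M"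
  unfolding poly_ring_lin_comb by (rule lin_comb_image_minimal) (auto simp: pmono_0 pmono_add)

lemma poly_ring_var: "is_subring R \<Longrightarrow> x i \<in> poly_ring R x"
  unfolding poly_ring_lin_comb
  using lin_comb_image_monomial[where \<phi> = "pmono x" and m = "Poly_Mapping.single i 1" and R = R]
  by (simp add: pmono_var[unfolded One_nat_def] pmono_0 pmono_add)

lemma prod_positive_exponents:
  fixes x :: "'n::finite \<Rightarrow> 'f::field" and e :: "'n \<Rightarrow> int"
  shows "(\<Prod>i | e i > 0. x i ^ nat (e i)) = (\<Prod>i\<in>UNIV. x i powi max (e i) 0)"
  by (rule prod.mono_neutral_cong_left) (auto simp: power_int_def max_def)

section \<open>The ambient field\<close>

locale ambient =
  fixes \<iota> :: "('p::ab_group_add \<Rightarrow>\<^sub>0 int) \<Rightarrow> 'f::field"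
  assumes emb: "ring_embedding \<iota>" and tf: "torsion_free TYPE('p)"
begin

definition \<psi> :: "'p \<Rightarrow> 'f" where "\<psi> p = \<iota> (group_elem p)"

lemma \<iota>_1: "\<iota> 1 = 1" and \<iota>_add: "\<iota> (a + b) = \<iota> a + \<iota> b" and \<iota>_mult: "\<iota> (a * b) = \<iota> a * \<iota> b"
  and \<iota>_eq: "\<iota> a = \<iota> b \<longleftrightarrow> a = b"
  using emb by (auto simp: ring_embedding_def dest: injD)

lemma \<iota>_0: "\<iota> 0 = 0"
  using \<iota>_add[of 0 0] by (metis add.right_neutral add_left_imp_eq)

lemma \<iota>_minus: "\<iota> (- a) = - \<iota> a"
  using \<iota>_add[of a "- a"] by (simp add: \<iota>_0 eq_neg_iff_add_eq_0 add.commute)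

lemma \<iota>_eq_0: "\<iota> a = 0 \<longleftrightarrow> a = 0"
  using \<iota>_eq[of a 0] by (simp add: \<iota>_0)

lemma \<iota>_prod: "\<iota> (prod f A) = (\<Prod>i\<in>A. \<iota> (f i))"
  by (induction A rule: infinite_finite_induct) (auto simp: \<iota>_1 \<iota>_mult)

lemma \<iota>_sum: "\<iota> (sum f A) = (\<Sum>i\<in>A. \<iota> (f i))"
  by (induction A rule: infinite_finite_induct) (auto simp: \<iota>_0 \<iota>_add)

lemma \<iota>_of_int: "\<iota> (of_int k) = of_int k"
  by (induction k rule: int_induct[where k = 0])
    (auto simp: \<iota>_0 \<iota>_1 \<iota>_add \<iota>_minus diff_conv_add_uminus simp del: add_uminus_conv_diff)

lemma \<iota>_single: "\<iota> (Poly_Mapping.single p k) = of_int k * \<psi> p"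
proof -
  have "of_int k = Poly_Mapping.single (0::'p) k" by (subst single_of_int[symmetric]) simp
  then have "Poly_Mapping.single p k = of_int k * group_elem p" by (simp add: mult_single)
  then show ?thesis by (simp add: \<iota>_mult \<iota>_of_int \<psi>_def)
qed

lemma \<iota>_lin: "\<iota> c = lin \<psi> c"
  by (induction c rule: group_ring_induct) (auto simp: \<iota>_0 \<iota>_add \<iota>_single lin_add)

lemma character_\<psi>: "character \<psi>"
  by (simp add: character_def \<psi>_def \<iota>_1 flip: \<iota>_mult) (simp add: mult_single)

lemma is_subring_range: "is_subring (range \<iota>)"
proof -
  have "- 1 = \<iota> (- 1)" by (simp add: \<iota>_minus \<iota>_1)
  then show ?thesis by (auto simp: is_subring_def simp flip: \<iota>_add \<iota>_mult)
qed

abbreviation K where "K \<equiv> frac_subfield \<iota>"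

lemma is_subring_K: "is_subring K"
  unfolding is_subring_def
proof (intro conjI ballI)
  have "- 1 = \<iota> (- 1) / \<iota> 1" by (simp add: \<iota>_minus \<iota>_1)
  then show "- 1 \<in> K" unfolding frac_subfield_def by force
  fix a b assume "a \<in> K" "b \<in> K"
  then obtain p q r s where *: "a = \<iota> p / \<iota> q" "q \<noteq> 0" "b = \<iota> r / \<iota> s" "s \<noteq> 0"
    unfolding frac_subfield_def by blast
  have qs: "q * s \<noteq> 0" using *(2,4) \<iota>_eq_0[of "q * s"] by (simp add: \<iota>_mult \<iota>_eq_0)
  have "a + b = \<iota> (p * s + r * q) / \<iota> (q * s)" "a * b = \<iota> (p * r) / \<iota> (q * s)"
    using *(2,4) by (simp_all add: * \<iota>_mult \<iota>_add \<iota>_eq_0 field_simps)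
  then show "a + b \<in> K" "a * b \<in> K" unfolding frac_subfield_def using qs by blast+
qed

lemma range_subset_K: "range \<iota> \<subseteq> K"
proof
  fix a assume "a \<in> range \<iota>"
  then obtain p where "a = \<iota> p / \<iota> 1" by (auto simp: \<iota>_1)
  then show "a \<in> K" unfolding frac_subfield_def by force
qed

lemma \<psi>_range: "\<psi> p \<in> range \<iota>"
  by (simp add: \<psi>_def)

lemma laurent_ring_eq:
  assumes nz: "\<And>i. x i \<noteq> 0"
  shows "laurent_ring (range \<iota>) x = Laur \<psi> x"
proof
  note L = is_subring_Laur[where x = x, OF character_\<psi> nz]
  have add: "lmono x (a + b) = lmono x a * lmono x b" for a b by (rule lmono_add) (rule nz)
  have "lmono x m = mon \<psi> x (0, Poly_Mapping.lookup m)" for m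
    using character_\<psi> by (simp add: mon_def lmono_def character_def)
  then have "lmono x m \<in> Laur \<psi> x" for m using mon_in_Laur[where x = x, OF character_\<psi> nz] by simp
  moreover have "range \<iota> \<subseteq> Laur \<psi> x"
    using coeff_in_Laur[where x = x, OF character_\<psi> nz] by (auto simp: \<iota>_lin intro: subring_lin[OF L])
  ultimately show "laurent_ring (range \<iota>) x \<subseteq> Laur \<psi> x"
    unfolding laurent_ring_def laurent_eval_lin_comb
    by (intro lin_comb_image_minimal[OF is_subring_range lmono_0 add L])
  let ?E = "lin_comb (lmono x) ` polys_over (range \<iota>)"
  note E = lin_comb_image_monomial[OF is_subring_range lmono_0 add, of "Poly_Mapping.single _ _", unfolded lmono_var]
  have "Laur \<psi> x \<subseteq> ?E"
  proof (rule Laur_minimal)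
    show "is_subring ?E" by (rule lin_comb_image_subring[OF is_subring_range lmono_0 add])
    show "\<psi> p \<in> ?E" for p using lin_comb_image_coeff[OF is_subring_range lmono_0 add] \<psi>_range by blast
    show "x i \<in> ?E" for i using E[of i 1] by simp
    show "inverse (x i) \<in> ?E" for i using E[of i "- 1"] by (simp add: power_int_minus)
  qed
  then show "Laur \<psi> x \<subseteq> laurent_ring (range \<iota>) x"
    unfolding laurent_ring_def laurent_eval_lin_comb .
qed

lemma alg_independent_nz:
  assumes "alg_independent K (x :: 'n::finite \<Rightarrow> 'f)" shows "x i \<noteq> 0"
proof
  assume 0: "x i = 0"
  let ?q = "Poly_Mapping.single (Poly_Mapping.single i 1) 1 :: ('n \<Rightarrow>\<^sub>0 nat) \<Rightarrow>\<^sub>0 'f"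
  have "?q \<in> polys_over K"
    using subring_0[OF is_subring_K] subring_1[OF is_subring_K] by (auto simp: polys_over_def lookup_single when_def)
  moreover have "poly_eval x ?q = 0" unfolding poly_eval_lin_comb lin_comb_single pmono_var by (simp add: 0)
  ultimately have "?q = 0" using assms unfolding alg_independent_def by blast
  then have "Poly_Mapping.lookup ?q (Poly_Mapping.single i 1) = 0" by (metis lookup_zero)
  then show False by simp
qed

text \<open>Multiplying by the power \<open>N\<close> of every variable turns a Laurent relation
  into a polynomial one. Group ring terms with the same exponents are collected into one
  coefficient, and injectivity of \<open>\<iota>\<close> separates them again.\<close>

lemma chart_of_alg_independent:
  assumes ai: "alg_independent K (x :: 'n::finite \<Rightarrow> 'f)"
  shows "chart \<psi> x"
  unfolding chart_def
proof (intro conjI allI impI character_\<psi>)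
  fix c assume c: "lin (mon \<psi> x) c = 0"
  note nz = alg_independent_nz[OF ai]
  let ?C = "Poly_Mapping.keys c"
  define N where "N = (\<Sum>g\<in>?C. \<Sum>i\<in>UNIV. nat (- snd g i))"
  have N: "0 \<le> snd g i + int N" if "g \<in> ?C" for g i
  proof -
    have "nat (- snd g i) \<le> (\<Sum>i\<in>UNIV. nat (- snd g i))" by (rule member_le_sum) auto
    also have "\<dots> \<le> N" unfolding N_def using that by (intro member_le_sum) auto
    finally show ?thesis by linarith
  qed
  define sh :: "('n \<Rightarrow> int) \<Rightarrow> 'n \<Rightarrow>\<^sub>0 nat" where "sh m = Abs_poly_mapping (\<lambda>i. nat (m i + int N))" for m
  have sh: "Poly_Mapping.lookup (sh m) i = nat (m i + int N)" for m i by (simp add: sh_def)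
  have sh_inj: "sh (snd g) = sh (snd h) \<longleftrightarrow> snd g = snd h" if "g \<in> ?C" "h \<in> ?C" for g h
  proof
    assume "sh (snd g) = sh (snd h)"
    then have "nat (snd g i + int N) = nat (snd h i + int N)" for i using sh by metis
    then show "snd g = snd h" using N[OF that(1)] N[OF that(2)] by (intro ext) (metis add_right_cancel eq_nat_nat_iff)
  qed simp
  define r where "r g = of_int (Poly_Mapping.lookup c g) * \<psi> (fst g)" for g
  define q where "q = (\<Sum>g\<in>?C. Poly_Mapping.single (sh (snd g)) (r g))"
  have "r g * pmono x (sh (snd g)) = (\<Prod>i\<in>UNIV. x i ^ N) * (of_int (Poly_Mapping.lookup c g) * mon \<psi> x g)"
    if "g \<in> ?C" for g
  proof -
    have "x i ^ nat (snd g i + int N) = x i ^ N * x i powi snd g i" for i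
    proof -
      have "x i ^ nat (snd g i + int N) = x i powi (snd g i + int N)" using N[OF that, of i] by (simp add: power_int_def)
      then show ?thesis using nz[of i] by (simp add: power_int_add mult.commute)
    qed
    then have "pmono x (sh (snd g)) = (\<Prod>i\<in>UNIV. x i ^ N) * (\<Prod>i\<in>UNIV. x i powi snd g i)"
      by (simp add: pmono_def sh prod.distrib)
    then show ?thesis by (simp add: r_def mon_def)
  qed
  then have "poly_eval x q = (\<Prod>i\<in>UNIV. x i ^ N) * lin (mon \<psi> x) c"
    by (simp add: poly_eval_lin_comb q_def lin_comb_sum lin_def sum_distrib_left)
  then have "poly_eval x q = 0" using c by simp
  moreover have rK: "r g \<in> K" for g
    unfolding r_def using \<psi>_range range_subset_K
    by (intro subring_mult[OF is_subring_K] subring_of_int[OF is_subring_K]) blast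
  then have "Poly_Mapping.lookup q m \<in> K" for m
    unfolding q_def lookup_sum lookup_single when_def
    using subring_0[OF is_subring_K] by (intro subring_sum[OF is_subring_K]) auto
  then have "q \<in> polys_over K" by (simp add: polys_over_def)
  ultimately have "q = 0" using ai unfolding alg_independent_def by blast
  have "g \<notin> ?C" for g
  proof
    assume g: "g \<in> ?C"
    let ?G = "{h \<in> ?C. snd h = snd g}"
    have "0 = Poly_Mapping.lookup q (sh (snd g))" using \<open>q = 0\<close> by simp
    also have "\<dots> = (\<Sum>h\<in>?C. if snd h = snd g then r h else 0)"
      unfolding q_def lookup_sum lookup_single when_def using sh_inj g by (intro sum.cong) auto
    also have "\<dots> = (\<Sum>h\<in>?G. r h)" by (simp add: sum.inter_filter)
    also have "\<dots> = \<iota> (\<Sum>h\<in>?G. Poly_Mapping.single (fst h) (Poly_Mapping.lookup c h))"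
      by (simp add: \<iota>_sum \<iota>_single r_def)
    finally have "\<iota> (\<Sum>h\<in>?G. Poly_Mapping.single (fst h) (Poly_Mapping.lookup c h)) = 0" by (rule sym)
    then have "(\<Sum>h\<in>?G. Poly_Mapping.single (fst h) (Poly_Mapping.lookup c h)) = 0" by (rule iffD1[OF \<iota>_eq_0])
    then have "0 = Poly_Mapping.lookup (\<Sum>h\<in>?G. Poly_Mapping.single (fst h) (Poly_Mapping.lookup c h)) (fst g)"
      by simp
    also have "\<dots> = (\<Sum>h\<in>?G. if h = g then Poly_Mapping.lookup c h else 0)"
      unfolding lookup_sum lookup_single when_def by (intro sum.cong) (auto simp: prod_eq_iff)
    also have "\<dots> = Poly_Mapping.lookup c g" using g by simp
    finally show False using g by (simp add: in_keys_iff)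
  qed
  then show "c = 0" using keys_eq_empty[of c] by blast
qed

text \<open>A relation over the fraction field is cleared of denominators by their product
  \<open>D\<close>, then spread out over group elements.\<close>

lemma alg_independent_of_chart:
  assumes ch: "chart \<psi> (x :: 'n::finite \<Rightarrow> 'f)"
  shows "alg_independent K x"
  unfolding alg_independent_def
proof (intro ballI impI)
  fix q assume qK: "q \<in> polys_over K" and q: "poly_eval x q = 0"
  let ?Q = "Poly_Mapping.keys q"
  have "\<exists>a b. b \<noteq> 0 \<and> Poly_Mapping.lookup q m = \<iota> a / \<iota> b" for m
    using qK unfolding polys_over_def frac_subfield_def by blast
  then obtain a b where b: "\<And>m. b m \<noteq> 0" and ab: "\<And>m. Poly_Mapping.lookup q m = \<iota> (a m) / \<iota> (b m)" by metis
  define r where "r m = a m * (\<Prod>m'\<in>?Q - {m}. b m')" for m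
  define D where "D = (\<Prod>m\<in>?Q. \<iota> (b m))"
  have D: "D \<noteq> 0" unfolding D_def using b by (simp add: \<iota>_eq_0)
  have r: "\<iota> (r m) = Poly_Mapping.lookup q m * D" if "m \<in> ?Q" for m
  proof -
    have "D = \<iota> (b m) * (\<Prod>m'\<in>?Q - {m}. \<iota> (b m'))" unfolding D_def using that by (simp add: prod.remove)
    then show ?thesis using b[of m] by (simp add: r_def ab \<iota>_mult \<iota>_prod \<iota>_eq_0)
  qed
  define E where "E m = (\<lambda>i. int (Poly_Mapping.lookup m i))" for m :: "'n \<Rightarrow>\<^sub>0 nat"
  have E_inj: "E m = E m' \<longleftrightarrow> m = m'" for m m'
    by (auto simp: E_def fun_eq_iff intro: poly_mapping_eqI)
  define c where "c = (\<Sum>m\<in>?Q. \<Sum>p\<in>Poly_Mapping.keys (r m). Poly_Mapping.single (p, E m) (Poly_Mapping.lookup (r m) p))"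
  have "lin (mon \<psi> x) c = (\<Sum>m\<in>?Q. \<Sum>p\<in>Poly_Mapping.keys (r m).
      of_int (Poly_Mapping.lookup (r m) p) * (\<psi> p * pmono x m))"
    by (simp add: c_def lin_sum mon_def E_def pmono_def)
  also have "\<dots> = (\<Sum>m\<in>?Q. lin \<psi> (r m) * pmono x m)"
    by (simp add: lin_def sum_distrib_right mult.assoc)
  also have "\<dots> = (\<Sum>m\<in>?Q. D * (Poly_Mapping.lookup q m * pmono x m))"
    by (rule sum.cong) (auto simp: r \<iota>_lin[symmetric])
  also have "\<dots> = D * poly_eval x q"
    by (simp add: poly_eval_lin_comb lin_comb_def sum_distrib_left)
  finally have "c = 0" using q chart_inj0[OF ch] by simp
  have "m \<notin> ?Q" for m
  proof
    assume m: "m \<in> ?Q"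
    have "Poly_Mapping.lookup (r m) p = 0" for p
    proof -
      have "(\<Sum>p'\<in>Poly_Mapping.keys (r m'). Poly_Mapping.lookup (r m') p' when (p', E m') = (p, E m)) =
        (if m' = m then Poly_Mapping.lookup (r m) p else 0)" for m'
        by (auto simp: E_inj when_def in_keys_iff)
      then have "Poly_Mapping.lookup c (p, E m) = Poly_Mapping.lookup (r m) p"
        using m by (simp add: c_def lookup_sum lookup_single)
      then show ?thesis by (simp add: \<open>c = 0\<close>)
    qed
    then have "r m = 0" by (intro poly_mapping_eqI) simp
    then have "Poly_Mapping.lookup q m * D = 0" using r[OF m] by (simp add: \<iota>_0)
    then show False using D m by (simp add: in_keys_iff)
  qed
  then show "q = 0" using keys_eq_empty[of q] by blast
qed

section \<open>Rational functions in a tuple of field elements\<close>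

definition fracs :: "('n::finite \<Rightarrow> 'f) \<Rightarrow> 'f set" where
  "fracs x = {a / b | a b. a \<in> poly_ring K x \<and> b \<in> poly_ring K x \<and> b \<noteq> 0}"

lemma fracs_mono: "poly_ring K x \<subseteq> fracs x"
proof
  fix a assume "a \<in> poly_ring K x"
  moreover have "1 \<in> poly_ring K x" by (rule subring_1[OF poly_ring_subring[OF is_subring_K]])
  ultimately have "\<exists>a' b. a = a' / b \<and> a' \<in> poly_ring K x \<and> b \<in> poly_ring K x \<and> b \<noteq> 0"
    by (intro exI[of _ a] exI[of _ 1]) auto
  then show "a \<in> fracs x" by (simp add: fracs_def)
qed

lemma is_subring_fracs: "is_subring (fracs x)"
  unfolding is_subring_def
proof (intro conjI ballI)
  note P = poly_ring_subring[OF is_subring_K, of x]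
  show "- 1 \<in> fracs x" using fracs_mono subring_neg1[OF P] by blast
  fix a b assume "a \<in> fracs x" "b \<in> fracs x"
  then obtain p q r s where *: "a = p / q" "q \<noteq> 0" "b = r / s" "s \<noteq> 0"
    "p \<in> poly_ring K x" "q \<in> poly_ring K x" "r \<in> poly_ring K x" "s \<in> poly_ring K x"
    unfolding fracs_def by blast
  have "a + b = (p * s + r * q) / (q * s)" "a * b = (p * r) / (q * s)" "q * s \<noteq> 0"
    using * by (simp_all add: field_simps)
  moreover have "p * s + r * q \<in> poly_ring K x" "p * r \<in> poly_ring K x" "q * s \<in> poly_ring K x"
    using * by (auto intro!: subring_add[OF P] subring_mult[OF P])
  ultimately show "a + b \<in> fracs x" "a * b \<in> fracs x" unfolding fracs_def by blast+
qed

lemma inverse_fracs: "a \<in> fracs x \<Longrightarrow> inverse a \<in> fracs x"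
proof (cases "a = 0")
  case True
  then show ?thesis using subring_0[OF is_subring_fracs[of x]] by simp
next
  case False
  assume "a \<in> fracs x"
  then obtain p q where "a = p / q" "q \<noteq> 0" "p \<in> poly_ring K x" "q \<in> poly_ring K x"
    unfolding fracs_def by blast
  moreover from this have "inverse a = q / p" "p \<noteq> 0" using False by (auto simp: field_simps)
  ultimately show ?thesis unfolding fracs_def by blast
qed

lemma var_fracs: "x i \<in> fracs x"
  using fracs_mono poly_ring_var[OF is_subring_K] by blast

lemma coeff_fracs: "K \<subseteq> fracs x"
  using fracs_mono poly_ring_coeff[OF is_subring_K] by blast

lemma free_generators_iff: "free_generators K x \<longleftrightarrow> chart \<psi> x \<and> fracs x = UNIV"
proof -
  have "(\<forall>f. \<exists>a\<in>poly_ring K x. \<exists>b\<in>poly_ring K x. b \<noteq> 0 \<and> f = a / b) \<longleftrightarrow> fracs x = UNIV"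
    unfolding fracs_def by blast
  then show ?thesis
    unfolding free_generators_def using chart_of_alg_independent alg_independent_of_chart by blast
qed

lemma fracs_UNIV_transfer:
  assumes "fracs x = UNIV" and "\<And>i. x i \<in> fracs y"
  shows "fracs y = UNIV"
proof -
  have "poly_ring K x \<subseteq> fracs y"
  proof (rule poly_ring_minimal[OF is_subring_K is_subring_fracs coeff_fracs])
    fix m show "pmono x m \<in> fracs y"
      unfolding pmono_def
      by (intro subring_prod[OF is_subring_fracs] subring_power[OF is_subring_fracs] assms(2))
  qed
  then have "a / b \<in> fracs y" if "a \<in> poly_ring K x" "b \<in> poly_ring K x" for a b
    unfolding divide_inverse using that by (intro subring_mult[OF is_subring_fracs] inverse_fracs) auto
  then have "fracs x \<subseteq> fracs y" unfolding fracs_def[of x] by blast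
  then show ?thesis using assms(1) by (simp add: top_unique)
qed

subsection \<open>Seeds\<close>

lemma is_seed_iff: "is_seed \<iota> S \<longleftrightarrow> chart \<psi> (cluster S) \<and> fracs (cluster S) = UNIV \<and> sign_skew_symmetric (exch S)"
  by (simp add: is_seed_def free_generators_iff)

lemma exchange_poly_eq: "exchange_poly \<iota> S j = exchange_elem \<psi> S j"
  using prod_positive_exponents[of "cluster S" "\<lambda>i. exch S i j"]
    prod_positive_exponents[of "cluster S" "\<lambda>i. - exch S i j"]
  by (simp add: exchange_poly_def exchange_elem_def mon_def pos_exponent_def neg_exponent_def \<psi>_def)

lemma seed_mutation_iff: "seed_mutation \<iota> k S S' \<longleftrightarrow> is_seed \<iota> S \<and> is_seed \<iota> S' \<and> mutates \<psi> k S S'"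
proof -
  have *: "((b \<ge> 0 \<longrightarrow> d = zmul b u + e) \<and> (b \<le> 0 \<longrightarrow> d = zmul b v + e)) \<longleftrightarrow>
      d = zmul b (if b \<ge> 0 then u else v) + e" for b and d e u v :: 'p
    by (cases b "0::int" rule: linorder_cases) auto
  show ?thesis
    unfolding seed_mutation_def mutates_def exchange_poly_eq mutated_cluster_def new_variable_def * by blast
qed

lemma seed_mutation_sym: "seed_mutation \<iota> k S S' \<Longrightarrow> seed_mutation \<iota> k S' S"
  unfolding seed_mutation_iff by (simp add: mutates_sym is_seed_iff)

lemma is_seed_relabel:
  assumes S: "is_seed \<iota> S" and \<sigma>: "bij \<sigma>"
  shows "is_seed \<iota> (relabel \<sigma> S)"
  unfolding is_seed_iff
proof (intro conjI)
  have ch: "chart \<psi> (cluster S)" and fr: "fracs (cluster S) = UNIV" and sk: "sign_skew_symmetric (exch S)"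
    using S by (auto simp: is_seed_iff)
  have \<sigma>inv: "\<sigma> (inv \<sigma> i) = i" "inv \<sigma> (\<sigma> i) = i" for i
    using \<sigma> by (simp_all add: bij_is_surj surj_f_inv_f bij_is_inj)
  show "sign_skew_symmetric (exch (relabel \<sigma> S))" using sign_skew_symmetric_relabel[OF sk] by simp
  show "fracs (cluster (relabel \<sigma> S)) = UNIV"
    using fracs_UNIV_transfer[OF fr, of "cluster S \<circ> \<sigma>"] var_fracs[of "cluster S \<circ> \<sigma>" "inv \<sigma> _"] by (simp add: \<sigma>inv)
  have "chart \<psi> (cluster S \<circ> \<sigma>)"
    unfolding chart_def
  proof (intro conjI allI impI character_\<psi>)
    fix c assume c: "lin (mon \<psi> (cluster S \<circ> \<sigma>)) c = 0"
    define \<pi> where "\<pi> g = (fst g, snd g \<circ> inv \<sigma>)" for g :: "'p \<times> ('a \<Rightarrow> int)"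
    have \<pi>: "\<pi> g = \<pi> h \<longleftrightarrow> g = h" for g h
      by (auto simp: \<pi>_def prod_eq_iff fun_eq_iff) (metis \<sigma>inv(2))
    have mon: "mon \<psi> (cluster S \<circ> \<sigma>) g = mon \<psi> (cluster S) (\<pi> g)" for g
      using mon_comp[OF \<sigma>, of \<psi> "cluster S" "fst g" "snd g \<circ> inv \<sigma>"] \<sigma>
      by (simp add: \<pi>_def comp_assoc bij_is_inj)
    let ?c = "\<Sum>g\<in>Poly_Mapping.keys c. Poly_Mapping.single (\<pi> g) (Poly_Mapping.lookup c g)"
    have "lin (mon \<psi> (cluster S)) ?c = 0" using c by (simp add: lin_sum lin_def[of _ c] mon)
    then have "?c = 0" by (rule chart_inj0[OF ch])
    then have "0 = Poly_Mapping.lookup ?c (\<pi> h)" for h by simp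
    also have "Poly_Mapping.lookup ?c (\<pi> h) = Poly_Mapping.lookup c h" for h
      by (simp add: lookup_sum lookup_single \<pi> when_def in_keys_iff)
    finally show "c = 0" by (intro poly_mapping_eqI) simp
  qed
  then show "chart \<psi> (cluster (relabel \<sigma> S))" by simp
qed

lemma mutates_exists: "\<exists>S'. mutates \<psi> k S S'"
proof -
  define S' where "S' = \<lparr>cluster = mutated_cluster \<psi> S k,
    pplus = (\<lambda>i. if i = k then pminus S k else
       zmul (exch S k i) (if exch S k i \<ge> 0 then pplus S k else pminus S k) + (pplus S i - pminus S i)),
    pminus = (\<lambda>i. if i = k then pplus S k else 0), exch = matrix_mutation k (exch S)\<rparr>"
  have "mutates \<psi> k S S'" by (simp add: mutates_def S'_def)
  then show ?thesis by blast
qed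

text \<open>Charts pass through an exchange, and the old variable is the exchange polynomial over
  the new one, so the new cluster still generates the field.\<close>

lemma is_seed_mutates:
  assumes S: "is_seed \<iota> S" and mut: "mutates \<psi> k S S'" and skew': "sign_skew_symmetric (exch S')"
  shows "is_seed \<iota> S'"
  unfolding is_seed_iff
proof (intro conjI skew')
  have ch: "chart \<psi> (cluster S)" and fr: "fracs (cluster S) = UNIV" and sk: "sign_skew_symmetric (exch S)"
    using S by (auto simp: is_seed_iff)
  show "chart \<psi> (cluster S')" by (rule chart_mutated[OF ch sk mut])
  let ?F = "fracs (cluster S')"
  note F = is_subring_fracs[of "cluster S'"]
  have other: "cluster S i \<in> ?F" if "i \<noteq> k" for i
    using var_fracs[of "cluster S'" i] cluster_mutated_other[OF ch sk mut that] by simp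
  have "\<psi> p \<in> ?F" for p using coeff_fracs range_subset_K \<psi>_range by blast
  then have "mon \<psi> (cluster S) g \<in> ?F" if "snd g k = 0" for g
    using that by (intro mon_mem[OF F]) (metis other inverse_fracs less_irrefl)+
  then have "exchange_elem \<psi> S k \<in> ?F"
    unfolding exchange_elem_def using snd_pos_exponent_diag[OF sk, of k] by (intro subring_add[OF F])
  moreover have "inverse (new_variable \<psi> S k) \<in> ?F"
    using inverse_fracs[OF var_fracs[of "cluster S'" k]] cluster_mutated_same[OF ch sk mut] by simp
  ultimately have "exchange_elem \<psi> S k * inverse (new_variable \<psi> S k) \<in> ?F" by (rule subring_mult[OF F])
  then have "cluster S k \<in> ?F" using exchange_elem_nz[OF ch sk, of k] by (simp add: new_variable_def)
  then show "?F = UNIV" using other by (intro fracs_UNIV_transfer[OF fr]) metis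
qed

section \<open>Mutation equivalence and total mutability\<close>

lemma mutation_equiv_sym: "mutation_equiv \<iota> S S' \<Longrightarrow> mutation_equiv \<iota> S' S"
  unfolding mutation_equiv_def by (rule equivclp_sym)

lemma mutation_equiv_trans: "mutation_equiv \<iota> S S' \<Longrightarrow> mutation_equiv \<iota> S' S'' \<Longrightarrow> mutation_equiv \<iota> S S''"
  unfolding mutation_equiv_def by (rule transpD[OF transp_equivclp])

lemma mutation_equiv_mutation: "seed_mutation \<iota> k S S' \<Longrightarrow> mutation_equiv \<iota> S S'"
  unfolding mutation_equiv_def by (rule r_into_equivclp) blast

text \<open>Mutations and relabellings are both reversible, so backward steps of the generated
  equivalence need no cases of their own.\<close>

lemma mutation_equiv_induct [consumes 1, case_names base mutation relabeling]:
  assumes "mutation_equiv \<iota> R S" and "P R"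
    and "\<And>S S' k. P S \<Longrightarrow> seed_mutation \<iota> k S S' \<Longrightarrow> P S'"
    and "\<And>S \<sigma>. P S \<Longrightarrow> bij \<sigma> \<Longrightarrow> P (relabel \<sigma> S)"
  shows "P S"
  using assms(1) unfolding mutation_equiv_def
proof (induction rule: equivclp_induct)
  case (step y z)
  then consider k where "seed_mutation \<iota> k y z" | "seed_relabeling y z"
    using seed_mutation_sym seed_relabeling_sym by blast
  then show ?case using step(3) assms(3,4) by cases (auto simp: seed_relabeling_iff)
qed (rule assms(2))

lemma is_seed_mutation_equiv: "mutation_equiv \<iota> R S \<Longrightarrow> is_seed \<iota> R \<Longrightarrow> is_seed \<iota> S"
  by (induction rule: mutation_equiv_induct) (auto simp: seed_mutation_iff is_seed_relabel)

lemma relabel_step: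
  assumes "bij \<sigma>" "bij \<tau>"
  shows "\<exists>\<rho>. bij \<rho> \<and> relabel \<rho> (relabel \<tau> S) = relabel \<sigma> S"
proof -
  have "\<tau> \<circ> (inv \<tau> \<circ> \<sigma>) = \<sigma>"
    unfolding comp_assoc[symmetric] using assms(2) by (simp add: bij_is_surj[THEN surj_iff[THEN iffD1]])
  then show ?thesis
    using assms by (intro exI[of _ "inv \<tau> \<circ> \<sigma>"]) (simp add: relabel_relabel bij_comp bij_imp_bij_inv)
qed

lemma matrix_mutation_equiv_trans:
  "matrix_mutation_equiv A B \<Longrightarrow> matrix_mutation_equiv B C \<Longrightarrow> matrix_mutation_equiv A C"
  unfolding matrix_mutation_equiv_def by (rule transpD[OF transp_equivclp])

text \<open>Total mutability concerns matrices reached by mutations alone, while seeds are also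
  relabelled; \<open>\<sigma>\<close> undoes the accumulated relabelling.\<close>

lemma exch_mutation_equiv:
  assumes "mutation_equiv \<iota> R S"
  shows "\<exists>\<sigma>. bij \<sigma> \<and> matrix_mutation_equiv (exch R) (exch (relabel \<sigma> S))"
  using assms
proof (induction rule: mutation_equiv_induct)
  case base
  have "matrix_mutation_equiv (exch R) (exch (relabel id R))"
    by (simp add: matrix_mutation_equiv_def equivclp_def)
  then show ?case using bij_id by blast
next
  case (mutation S S' k)
  then obtain \<sigma> where \<sigma>: "bij \<sigma>" "matrix_mutation_equiv (exch R) (exch (relabel \<sigma> S))" by blast
  have "\<sigma> (inv \<sigma> k) = k" using \<sigma>(1) by (simp add: bij_is_surj surj_f_inv_f)
  then have "mutates \<psi> (inv \<sigma> k) (relabel \<sigma> S) (relabel \<sigma> S')"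
    using mutation(2) \<sigma>(1) by (intro mutates_relabel) (simp_all add: seed_mutation_iff)
  then have "exch (relabel \<sigma> S') = matrix_mutation (inv \<sigma> k) (exch (relabel \<sigma> S))"
    unfolding mutates_def by blast
  then have "matrix_mutation_equiv (exch (relabel \<sigma> S)) (exch (relabel \<sigma> S'))"
    unfolding matrix_mutation_equiv_def by (intro r_into_equivclp) blast
  then have "matrix_mutation_equiv (exch R) (exch (relabel \<sigma> S'))"
    by (rule matrix_mutation_equiv_trans[OF \<sigma>(2)])
  then show ?case using \<sigma>(1) by blast
next
  case (relabeling S \<tau>)
  then show ?case using relabel_step by metis
qed

text \<open>\<open>seed_mutation\<close> requires its result to be a seed; total mutability provides
  the sign-skew-symmetry this takes.\<close>

lemma seed_mutation_exists:
  assumes tm: "totally_mutable R" and seed: "is_seed \<iota> R" and eq: "mutation_equiv \<iota> R S"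
  shows "\<exists>S'. seed_mutation \<iota> k S S'"
proof -
  have S: "is_seed \<iota> S" by (rule is_seed_mutation_equiv[OF eq seed])
  obtain S' where mut: "mutates \<psi> k S S'" using mutates_exists by blast
  obtain \<sigma> where \<sigma>: "bij \<sigma>" "matrix_mutation_equiv (exch R) (exch (relabel \<sigma> S))"
    using exch_mutation_equiv[OF eq] by blast
  have inv: "\<sigma> (inv \<sigma> i) = i" for i using \<sigma>(1) by (simp add: bij_is_surj surj_f_inv_f)
  have "mutates \<psi> (inv \<sigma> k) (relabel \<sigma> S) (relabel \<sigma> S')"
    using mut \<sigma>(1) by (intro mutates_relabel) (simp_all add: inv)
  then have "exch (relabel \<sigma> S') = matrix_mutation (inv \<sigma> k) (exch (relabel \<sigma> S))"
    unfolding mutates_def by blast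
  then have "matrix_mutation_equiv (exch (relabel \<sigma> S)) (exch (relabel \<sigma> S'))"
    unfolding matrix_mutation_equiv_def by (intro r_into_equivclp) blast
  then have "matrix_mutation_equiv (exch R) (exch (relabel \<sigma> S'))"
    by (rule matrix_mutation_equiv_trans[OF \<sigma>(2)])
  then have "sign_skew_symmetric (exch (relabel \<sigma> S'))" using tm unfolding totally_mutable_def by blast
  then have "sign_skew_symmetric (\<lambda>i j. exch (relabel \<sigma> S') (inv \<sigma> i) (inv \<sigma> j))"
    by (rule sign_skew_symmetric_relabel)
  then have "sign_skew_symmetric (exch S')" by (simp add: inv)
  then have "is_seed \<iota> S'" by (rule is_seed_mutates[OF S mut])
  then show ?thesis using S mut seed_mutation_iff by blast
qed

theorem Laurent_phenomenon:
  fixes R S :: "('n::finite, 'p, 'f) seed"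
  assumes R: "is_seed \<iota> R" and eq: "mutation_equiv \<iota> R S"
  shows "cluster S i \<in> Laur \<psi> (cluster R)"
proof -
  obtain \<psi>' :: "('n \<Rightarrow> int) \<Rightarrow> ((nat \<Rightarrow>\<^sub>0 int) \<Rightarrow>\<^sub>0 int) fract" and x' :: "'n \<Rightarrow> _"
    where ch': "chart \<psi>' x'"
    using generic_chart_exists by blast
  have nz: "cluster T i \<noteq> 0" if "is_seed \<iota> T" for T :: "('n, 'p, 'f) seed" and i
    using that chart_nz unfolding is_seed_iff by blast
  interpret specialisation \<psi> R \<psi>' x'
    by unfold_locales (rule character_\<psi>, rule nz[OF R], rule ch')
  \<comment> \<open>Relabellings have no counterpart on the generic side; they are collected in
    \<open>\<sigma>\<close> and removed at the end.\<close>
  have "is_seed \<iota> S \<and> (\<exists>\<sigma> T c. bij \<sigma> \<and> specialises T (relabel \<sigma> S) c)"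
    using eq
  proof (induction rule: mutation_equiv_induct)
    case base
    obtain T c where "specialises T (relabel id R) c"
      using specialises_root R unfolding is_seed_iff by auto
    then show ?case using R bij_id by blast
  next
    case (mutation S S' k)
    then obtain \<sigma> T c where \<sigma>: "bij \<sigma>" and T: "specialises T (relabel \<sigma> S) c" by blast
    have S': "is_seed \<iota> S'" "is_seed \<iota> S" "mutates \<psi> k S S'" using mutation(2) by (auto simp: seed_mutation_iff)
    have "\<sigma> (inv \<sigma> k) = k" using \<sigma> by (simp add: bij_is_surj surj_f_inv_f)
    then have "mutates \<psi> (inv \<sigma> k) (relabel \<sigma> S) (relabel \<sigma> S')"
      using S'(3) \<sigma> by (intro mutates_relabel) simp_all
    moreover have "sign_skew_symmetric (exch (relabel \<sigma> S'))"
      using is_seed_relabel[OF S'(1) \<sigma>] by (simp add: is_seed_iff)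
    ultimately obtain T' c' where "specialises T' (relabel \<sigma> S') c'"
      using specialises_mutates[OF T] nz[OF is_seed_relabel[OF S'(2) \<sigma>]] by blast
    then show ?case using S'(1) \<sigma> by blast
  next
    case (relabeling S \<tau>)
    then obtain \<sigma> T c where "bij \<sigma>" "specialises T (relabel \<sigma> S) c" by blast
    moreover then obtain \<rho> where "bij \<rho>" "relabel \<rho> (relabel \<tau> S) = relabel \<sigma> S"
      using relabel_step[OF _ relabeling(2)] by blast
    ultimately show ?case using relabeling is_seed_relabel by metis
  qed
  then obtain \<sigma> T c where \<sigma>: "bij \<sigma>" and T: "specialises T (relabel \<sigma> S) c" by blast
  have "cluster (relabel \<sigma> S) (inv \<sigma> i) \<in> Laur \<psi> (cluster R)" by (rule specialises_Laur[OF T])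
  then show ?thesis using \<sigma> by (simp add: bij_is_surj surj_f_inv_f)
qed

subsection \<open>Coprimality\<close>

text \<open>
  A common odd root \<open>e\<close> of the exchange ratios yields the common factor \<open>e\<^sup>+ + e\<^sup>-\<close> of the exchange
  polynomials, because \<open>s + t\<close> divides \<open>s\<^sup>n + t\<^sup>n\<close> for odd \<open>n\<close>.
\<close>

lemma coprime_no_common_odd_root:
  fixes S :: "('n::finite, 'p, 'f) seed"
  assumes S: "is_seed \<iota> S" and co: "coprime_seed \<iota> S" and ij: "i \<noteq> j"
  shows "\<not> common_odd_root (exchange_ratio S i) (exchange_ratio S j)"
proof
  assume "common_odd_root (exchange_ratio S i) (exchange_ratio S j)"
  then obtain e a b where e: "odd a" "odd b" "exchange_ratio S i = zmul a e" "exchange_ratio S j = zmul b e"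
    unfolding common_odd_root_def by blast
  have ch: "chart \<psi> (cluster S)" using S by (simp add: is_seed_iff)
  note mc = chart_mon_character[OF ch]
  let ?A = "poly_ring (range \<iota>) (cluster S)" and ?m = "mon \<psi> (cluster S)"
  note A = poly_ring_subring[OF is_subring_range, of "cluster S"]
  have \<psi>A: "\<psi> p \<in> ?A" for p using poly_ring_coeff[OF is_subring_range] \<psi>_range by blast
  have monA: "?m (p, m) \<in> ?A" if "\<And>i. m i \<ge> 0" for p m
    using that by (intro mon_mem[OF A]) (auto intro: \<psi>A poly_ring_var[OF is_subring_range] simp: not_less[symmetric])
  obtain q m where qm: "e = (q, m)" by fastforce
  \<comment> \<open>Numerator and denominator of the root \<open>e\<close>. Their exponents are
    nonnegative, so both lie in the polynomial ring; the coefficient \<open>q\<close> is placed in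
    the numerator.\<close>
  define up where "up = (q, \<lambda>i. max (m i) 0)"
  define un where "un = (0 :: 'p, \<lambda>i. max (- m i) 0)"
  have st: "?m up \<in> ?A" "?m un \<in> ?A" unfolding up_def un_def by (auto intro!: monA)
  define d where "d = ?m up + ?m un"
  have dA: "d \<in> ?A" unfolding d_def by (rule subring_add[OF A st])
  have factor: "\<exists>u\<in>?A. exchange_poly \<iota> S l = d * u" if l: "odd a" "exchange_ratio S l = zmul a e" for l a
  proof -
    define n where "n = nat \<bar>a\<bar>"
    have n: "odd n" "a = int n \<or> a = - int n" using l(1) by (auto simp: n_def even_nat_iff)
    obtain r where r: "r \<in> ?A" "?m up ^ n + ?m un ^ n = d * r"
      using subring_odd_power_sum[OF A st n(1)] unfolding d_def by blast
    have ex: "exch S i l = a * m i" for i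
      using l(2) by (simp add: exchange_ratio_eq qm zmul_Pair fun_eq_iff zmul_apply)
    have p: "pplus S l - pminus S l = zmul a q" using l(2) by (simp add: exchange_ratio_eq qm zmul_Pair)
    have mx: "max (int n * z) 0 = int n * max z 0" for z
      by (cases "z \<ge> 0") (auto simp: max_def mult_nonneg_nonneg mult_le_0_iff)
    have mp: "?m ((p', 0) + zmul (int n) g) = \<psi> p' * ?m g ^ n" for p' g
    proof -
      have "?m (g + h) = ?m g * ?m h" for g h using mc unfolding character_def by blast
      moreover have "?m (p', 0) = \<psi> p'" by (simp add: mon_def)
      ultimately show ?thesis by (simp add: character_zmul[OF mc])
    qed
    \<comment> \<open>The two terms of the exchange polynomial have disjoint variables, as do
      \<open>up\<close> and \<open>un\<close>; so up to a coefficient they are the powers of these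
      two, swapped when \<open>a\<close> is negative.\<close>
    have "\<exists>p'. exchange_elem \<psi> S l = \<psi> p' * (?m up ^ n + ?m un ^ n)"
      using n(2)
    proof
      assume a: "a = int n"
      have "pos_exponent S l = (pminus S l, 0) + zmul (int n) up" "neg_exponent S l = (pminus S l, 0) + zmul (int n) un"
        using p mx[of "m _"] mx[of "- m _"]
        by (auto simp: pos_exponent_def neg_exponent_def up_def un_def zmul_Pair fun_eq_iff zmul_apply ex a algebra_simps)
      then show ?thesis by (auto simp: exchange_elem_def mp distrib_left)
    next
      assume a: "a = - int n"
      have "pos_exponent S l = (pplus S l, 0) + zmul (int n) un" "neg_exponent S l = (pplus S l, 0) + zmul (int n) up"
        using p mx[of "m _"] mx[of "- m _"]
        by (auto simp: pos_exponent_def neg_exponent_def up_def un_def zmul_Pair fun_eq_iff zmul_apply ex a zmul_minus algebra_simps)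
      then have "exchange_elem \<psi> S l = \<psi> (pplus S l) * (?m up ^ n + ?m un ^ n)"
        by (simp add: exchange_elem_def mp distrib_left)
      then show ?thesis by blast
    qed
    then obtain p' where "exchange_elem \<psi> S l = d * (\<psi> p' * r)" by (auto simp: r(2) mult.left_commute)
    moreover have "\<psi> p' * r \<in> ?A" by (rule subring_mult[OF A \<psi>A r(1)])
    ultimately show ?thesis unfolding exchange_poly_eq by blast
  qed
  obtain z where z: "d = \<iota> (group_elem z) \<or> d = - \<iota> (group_elem z)"
    using co ij dA factor[OF e(1,3)] factor[OF e(2,4)] unfolding coprime_seed_def Let_def by blast
  have d: "d = lin ?m (binomial_elem up un)" by (simp add: d_def binomial_elem_def lin_add)
  have z': "\<iota> (group_elem z) = lin ?m (group_elem (z, 0))" by (simp add: mon_def \<psi>_def)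
  have "binomial_elem up un = group_elem (z, 0) \<or> binomial_elem up un = - group_elem (z, 0)"
    using z unfolding d z' lin_uminus[symmetric] using chart_inj[OF ch] by blast
  \<comment> \<open>The sum of coefficients is 2 for the binomial but 1 or -1 for a signed group
    element.\<close>
  then have "lin (\<lambda>_. 1 :: int) (binomial_elem up un) = 1 \<or> lin (\<lambda>_. 1 :: int) (binomial_elem up un) = - 1"
    by (auto simp: lin_uminus)
  then show False by (simp add: binomial_elem_def lin_add)
qed

section \<open>The two inclusions between the algebras\<close>

lemma subalgebra_subring: "subalgebra \<iota> A \<Longrightarrow> is_subring A"
proof -
  assume A: "subalgebra \<iota> A"
  have "\<iota> (- 1) \<in> A" using A unfolding subalgebra_def by blast
  then show "is_subring A" using A by (simp add: is_subring_def subalgebra_def \<iota>_minus \<iota>_1)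
qed

lemma subalgebra_INT:
  assumes "\<And>S. S \<in> A \<Longrightarrow> subalgebra \<iota> (F S)"
  shows "subalgebra \<iota> (\<Inter>S\<in>A. F S)"
  unfolding subalgebra_def
  by (intro conjI ballI subsetI INT_I) (use assms in \<open>auto simp: subalgebra_def\<close>)

lemma subalgebra_Laur:
  assumes "is_seed \<iota> S"
  shows "subalgebra \<iota> (Laur \<psi> (cluster S))"
proof -
  have nz: "cluster S i \<noteq> 0" for i using assms chart_nz unfolding is_seed_iff by blast
  note L = is_subring_Laur[where x = "cluster S", OF character_\<psi> nz]
  have "\<iota> c \<in> Laur \<psi> (cluster S)" for c
    by (subst \<iota>_lin) (intro subring_lin[OF L] coeff_in_Laur[OF character_\<psi> nz])
  then show ?thesis using L by (auto simp: subalgebra_def is_subring_def)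
qed

lemma upper_cluster_algebra_eq:
  assumes "is_seed \<iota> R"
  shows "upper_cluster_algebra \<iota> R = (\<Inter>S\<in>{S. mutation_equiv \<iota> R S}. Laur \<psi> (cluster S))"
proof -
  have "laurent_ring (range \<iota>) (cluster S) = Laur \<psi> (cluster S)" if "mutation_equiv \<iota> R S" for S
    using is_seed_mutation_equiv[OF that assms] chart_nz unfolding is_seed_iff
    by (intro laurent_ring_eq) blast
  then show ?thesis unfolding upper_cluster_algebra_def by auto
qed

text \<open>Any seed equivalent to \<open>R\<close> may serve as root in
  \<open>Laurent_phenomenon\<close>, so each cluster variable lies in all the Laurent rings, and
  these are subalgebras.\<close>

lemma cluster_algebra_subset_upper:
  assumes R: "is_seed \<iota> R"
  shows "cluster_algebra \<iota> R \<subseteq> upper_cluster_algebra \<iota> R"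
  unfolding cluster_algebra_def
proof (rule hull_minimal)
  have "subalgebra \<iota> (Laur \<psi> (cluster S))" if "mutation_equiv \<iota> R S" for S
    by (rule subalgebra_Laur[OF is_seed_mutation_equiv[OF that R]])
  then show "subalgebra \<iota> (upper_cluster_algebra \<iota> R)"
    unfolding upper_cluster_algebra_eq[OF R] by (intro subalgebra_INT) simp
  show "(\<Union>S\<in>{S. mutation_equiv \<iota> R S}. range (cluster S)) \<subseteq> upper_cluster_algebra \<iota> R"
    unfolding upper_cluster_algebra_eq[OF R]
    using Laurent_phenomenon[OF is_seed_mutation_equiv[OF _ R]] mutation_equiv_trans[OF mutation_equiv_sym]
    by blast
qed

text \<open>Total mutability makes every neighbour of \<open>S\<close> a seed equivalent to
  \<open>R\<close>. The Laurent conditions at these neighbours give the upper bound at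
  \<open>S\<close>, and their cluster variables give the generators of the lower bound.\<close>

lemma upper_subset_cluster_algebra:
  assumes R: "is_seed \<iota> R" and tm: "totally_mutable R" and eq: "mutation_equiv \<iota> R S"
    and co: "coprime_seed \<iota> S" and ac: "acyclic_seed S"
  shows "upper_cluster_algebra \<iota> R \<subseteq> cluster_algebra \<iota> R"
proof -
  have S: "is_seed \<iota> S" by (rule is_seed_mutation_equiv[OF eq R])
  have ch: "chart \<psi> (cluster S)" and sk: "sign_skew_symmetric (exch S)" using S by (auto simp: is_seed_iff)
  have mut: "\<exists>S'. mutation_equiv \<iota> R S' \<and> cluster S' = mutated_cluster \<psi> S j" for j
  proof -
    obtain S' where "seed_mutation \<iota> j S S'" using seed_mutation_exists[OF tm R eq] by blast
    then show ?thesis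
      using mutation_equiv_trans[OF eq mutation_equiv_mutation] unfolding seed_mutation_iff mutates_def by blast
  qed
  have "upper_cluster_algebra \<iota> R \<subseteq> upper_bound \<psi> S UNIV"
  proof
    fix f assume "f \<in> upper_cluster_algebra \<iota> R"
    then have f: "f \<in> Laur \<psi> (cluster S')" if "mutation_equiv \<iota> R S'" for S'
      using that unfolding upper_cluster_algebra_eq[OF R] by blast
    have "f \<in> Laur \<psi> (mutated_cluster \<psi> S j)" for j using mut[of j] f by metis
    then show "f \<in> upper_bound \<psi> S UNIV" using f[OF eq] by (simp add: upper_bound_def)
  qed
  also have "\<dots> \<subseteq> lower_bound \<psi> S UNIV"
    by (rule upper_bound_subset_lower_bound[OF ch sk tf])
      (use ac coprime_no_common_odd_root[OF S co] in \<open>auto simp: acyclic_seed_def\<close>)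
  also have "\<dots> \<subseteq> cluster_algebra \<iota> R"
    unfolding cluster_algebra_def hull_def
  proof (rule Inter_greatest)
    fix A assume "A \<in> {t. subalgebra \<iota> t \<and> (\<Union>S\<in>{S. mutation_equiv \<iota> R S}. range (cluster S)) \<subseteq> t}"
    then have A: "subalgebra \<iota> A" and cl: "\<And>S i. mutation_equiv \<iota> R S \<Longrightarrow> cluster S i \<in> A" by blast+
    have "new_variable \<psi> S j \<in> A" for j
    proof -
      obtain S' where "mutation_equiv \<iota> R S'" "cluster S' = mutated_cluster \<psi> S j" using mut by blast
      then show ?thesis using cl[of S' j] by (simp add: mutated_cluster_def)
    qed
    moreover have "\<psi> p \<in> A" for p using A unfolding subalgebra_def \<psi>_def by blast
    ultimately show "lower_bound \<psi> S UNIV \<subseteq> A"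
      unfolding lower_bound_def using cl[OF eq]
      by (intro sub_gen_minimal[OF subalgebra_subring[OF A]]) auto
  qed
  finally show ?thesis .
qed

end

theorem corollary1p19:
  fixes \<iota> :: "('p::ab_group_add \<Rightarrow>\<^sub>0 int) \<Rightarrow> 'f::field"
    and S\<^sub>0 :: "('n::finite, 'p, 'f) seed"
  assumes "torsion_free TYPE('p)"
    and "ring_embedding \<iota>"
    and "\<exists>y :: 'n \<Rightarrow> 'f. free_generators (frac_subfield \<iota>) y"
    and "is_seed \<iota> S\<^sub>0" and "totally_mutable S\<^sub>0"
    and "\<exists>S. mutation_equiv \<iota> S\<^sub>0 S \<and> coprime_seed \<iota> S \<and> acyclic_seed S"
  shows "cluster_algebra \<iota> S\<^sub>0 = upper_cluster_algebra \<iota> S\<^sub>0"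
proof -
  interpret ambient \<iota> using assms(1,2) by unfold_locales
  obtain S where "mutation_equiv \<iota> S\<^sub>0 S" "coprime_seed \<iota> S" "acyclic_seed S" using assms(6) by blast
  then show ?thesis
    using cluster_algebra_subset_upper upper_subset_cluster_algebra assms(4,5) by (intro equalityI)
qed

end
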